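(* Let $\nu\ge3$ be an integer and let $r>0$ and $0<\omega<1$ be real numbers. Then there is a constant $\Gamma=\Gamma(r,\omega,\nu)$ such that the following holds. Let $P$ be a $k_1\times\cdots\times k_\nu$ transportation polytope, given by the overdetermined system $Ax=b$, $x\ge0$, with $A$ having columns $a_1,\dots,a_n$, $n=k_1k_2\cdots k_\nu$. Let $z=(\zeta_1,\dots,\zeta_n)$ be the unique point of $P\cap[0,1]^n$ at which the strictly concave function $$g(x)=\sum_{j=1}^n\left(\xi_j\ln\frac1{\xi_j}+(1-\xi_j)\ln\frac1{1-\xi_j}\right),\qquad x=(\xi_1,\dots,\xi_n),$$ attains its maximum on $P\cap[0,1]^n$. Let $$q(t)=\frac12\sum_{j=1}^n(\zeta_j-\zeta_j^2)\langle a_j,t\rangle^2,\qquad t\in\mathbb{R}^{k_1+\cdots+k_\nu}.$$ Suppose there is $k>0$ such that $$\omega k\le k_j\le k\ \ (j=1,\dots,\nu),\qquad r\le\zeta_j-\zeta_j^2\ \ (j=1,\dots,n),\qquad \omega k\ge2,$$ and $$\frac{10\nu^4 2^\nu}{r\omega^\nu}\ln(k)\,k^{-\nu+2}\le\frac1{4\nu^2},\qquad \frac{20\nu^6 2^\nu}{r^2\omega^\nu}\ln(k)\,k^{-\nu+2}\le\frac34 .$$ Then $|P\cap\{0,1\}^n|$ is approximated by $$\frac{e^{g(z)}}{(2\pi)^{(k_1+\cdots+k_\nu-\nu+1)/2}}\det(q|_{\mathcal L})^{-1/2}$$ to within relative error $\Gamma k^{-\nu+2.5}$. Moreover there exists a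 constant $N=N(r,\omega,\nu)$ such that if $k\ge N$, then $\Gamma$ may be chosen to be $$\Gamma=\frac{400\,\nu^{12}2^\nu}{r^2\omega^{2\nu}}.$$
   Context: A $k_1\times\cdots\times k_\nu$ ($\nu$-index) transportation polytope is the set of arrays $(\xi_{m_1,\dots,m_\nu})$, $1\le m_j\le k_j$, of non-negative real numbers such that for every $j\in\{1,\dots,\nu\}$ and every $m_j\in\{1,\dots,k_j\}$, $$\sum_{m_1,\dots,m_{j-1},m_{j+1},\dots,m_\nu}\xi_{m_1,\dots,m_\nu}=S^j_{m_j},$$ where the $S^j_{m_j}$ are constants, called the margins. Arrays are identified with vectors in $\mathbb{R}^n$, $n=k_1\cdots k_\nu$. The polytope is $\{x\in\mathbb{R}^n: Ax=b,\ x\ge0\}$, where the column $a_{m_1\ldots m_\nu}\in\mathbb{R}^{k_1+\cdots+k_\nu}$ of $A$ is zero except for a $1$ in positions $m_1,\ k_1+m_2,\ k_1+k_2+m_3,\dots,k_1+\cdots+k_{\nu-1}+m_\nu$, and the entry of $b$ in position $k_1+\cdots+k_{j-1}+m_j$ is $S^j_{m_j}$. The columns are also listed as $a_1,\dots,a_n$, with the same indexing as the coordinates of $x$. $\mathcal L=\{(\xi_1,\dots,\xi_{k_1+\cdots+k_\nu}):\ \xi_{k_1+\cdots+k_j}=0\text{ for all }2\le j\le\nu\}\subset\mathbb{R}^{k_1+\cdots+k_\nu}$, and $Q$ is the orthogonal projection of $\mathbb{R}^{k_1+\cdots+k_\nu}$ onto $\mathcal L$. If $q(t)=\frac12\langle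 t,Bt\rangle$ with $B$ symmetric positive semidefinite, then $\det(q|_{\mathcal L})$ is the product of the eigenvalues (with multiplicity) of $QBQ$ on eigenvectors lying in $\mathcal L$. Convention: $0\ln\frac10=0$. "$M$ is approximated by $E$ to within relative error $\varepsilon$" means $|M-E|\le\varepsilon E$.
   Formalization: The margins are additionally assumed to be integers; without this the claim fails, e.g. for ν=3, all k_j=k odd and all margins k²/2, where there are no 0-1 points but the estimate is positive. *)

theory Defs
  imports Complex_Main "Jordan_Normal_Form.Matrix_Kernel"
begin

text \<open>
  Everything is 0-based. The sizes \<open>k\<^sub>1, \<dots>, k\<^sub>\<nu>\<close> form a list \<open>ks\<close>, and \<open>multi_indices ks\<close>
  lists all multi-indices (lists \<open>m\<close> with \<open>length m = \<nu>\<close> and \<open>m ! j < ks ! j\<close>) without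
  repetition; an array is the vector in \<open>\<real>\<^sup>n\<close>, \<open>n = prod_list ks\<close>, whose \<open>i\<close>-th coordinate
  is the entry at \<open>multi_indices ks ! i\<close>.
\<close>

definition multi_indices :: "nat list \<Rightarrow> nat list list" where
  "multi_indices ks = product_lists (map (\<lambda>k. [0..<k]) ks)"

lemma set_multi_indices:
  "set (multi_indices ks) = {m. length m = length ks \<and> (\<forall>j<length ks. m ! j < ks ! j)}"
  by (auto simp: multi_indices_def product_lists_set list_all2_conv_all_nth)

lemma distinct_multi_indices: "distinct (multi_indices ks)"
  by (simp add: multi_indices_def distinct_product_lists)

lemma length_multi_indices: "length (multi_indices ks) = prod_list ks"
  by (induction ks) (simp_all add: multi_indices_def length_concat comp_def sum_list_triv)

text \<open>\<open>S j m\<close> is the margin in direction \<open>j\<close> at the index value \<open>m\<close>.\<close>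

definition transportation_polytope :: "nat list \<Rightarrow> (nat \<Rightarrow> nat \<Rightarrow> real) \<Rightarrow> real vec set" where
  "transportation_polytope ks S =
     {x \<in> carrier_vec (prod_list ks). 0\<^sub>v (prod_list ks) \<le> x \<and>
        (\<forall>j<length ks. \<forall>m<ks ! j.
           (\<Sum>i \<in> {i. i < prod_list ks \<and> multi_indices ks ! i ! j = m}. x $ i) = S j m)}"

definition transportation_mat :: "nat list \<Rightarrow> real mat" where
  "transportation_mat ks = mat (sum_list ks) (prod_list ks)
     (\<lambda>(p, i). if \<exists>j<length ks. p = sum_list (take j ks) + multi_indices ks ! i ! j then 1 else 0)"

definition margin_vec :: "nat list \<Rightarrow> (nat \<Rightarrow> nat \<Rightarrow> real) \<Rightarrow> real vec" where
  "margin_vec ks S = vec_of_list (concat (map (\<lambda>j. map (S j) [0..<ks ! j]) [0..<length ks]))"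

lemma nth_concat_offset:
  assumes "j < length xss" "m < length (xss ! j)"
  shows "concat xss ! (sum_list (map length (take j xss)) + m) = xss ! j ! m"
  using assms
proof (induction xss arbitrary: j)
  case (Cons xs xss)
  then show ?case by (cases j) (simp_all add: nth_append)
qed simp

lemma position_split:
  fixes ks :: "nat list"
  shows "p < sum_list ks \<Longrightarrow> \<exists>j<length ks. \<exists>m<ks ! j. p = sum_list (take j ks) + m"
proof (induction ks arbitrary: p)
  case (Cons a ks)
  show ?case
  proof (cases "p < a")
    case True
    then show ?thesis by (intro exI[of _ 0]) auto
  next
    case False
    then have "p - a < sum_list ks" using Cons.prems by auto
    from Cons.IH[OF this] obtain j m where "j < length ks" "m < ks ! j"
      "p - a = sum_list (take j ks) + m" by auto
    then show ?thesis using False by (intro exI[of _ "Suc j"]) auto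
  qed
qed simp

lemma position_less:
  fixes ks :: "nat list"
  shows "j < j' \<Longrightarrow> j' < length ks \<Longrightarrow> m < ks ! j \<Longrightarrow> sum_list (take j ks) + m < sum_list (take j' ks)"
proof -
  assume a: "j < j'" "j' < length ks" "m < ks ! j"
  have "take j' ks = take (Suc j) ks @ drop (Suc j) (take j' ks)"
    using a by (metis Suc_leI append_take_drop_id min.absorb1 take_take)
  then have "sum_list (take (Suc j) ks) \<le> sum_list (take j' ks)"
    by (metis le_add1 sum_list_append)
  then show ?thesis using a by (simp add: take_Suc_conv_app_nth)
qed

lemma position_bound:
  fixes ks :: "nat list"
  assumes "j < length ks" "m < ks ! j"
  shows "sum_list (take j ks) + m < sum_list ks"
proof -
  have "sum_list ks = sum_list (take j ks) + (ks ! j + sum_list (drop (Suc j) ks))"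
    using assms by (metis append_take_drop_id Cons_nth_drop_Suc sum_list.Cons sum_list_append)
  then show ?thesis using assms by simp
qed

lemma position_inj:
  fixes ks :: "nat list"
  assumes "j < length ks" "m < ks ! j" "j' < length ks" "m' < ks ! j'"
    "sum_list (take j ks) + m = sum_list (take j' ks) + m'"
  shows "j = j'" "m = m'"
proof -
  show "j = j'"
    using position_less[of j j' ks m] position_less[of j' j ks m'] assms
    by (cases j j' rule: linorder_cases) auto
  then show "m = m'" using assms by simp
qed

lemma multi_indices_nth_less:
  "i < prod_list ks \<Longrightarrow> j < length ks \<Longrightarrow> multi_indices ks ! i ! j < ks ! j"
  using set_multi_indices[of ks] nth_mem[of i "multi_indices ks"] length_multi_indices[of ks] by auto

lemma transportation_mat_nth:
  assumes "j < length ks" "m < ks ! j" "i < prod_list ks"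
  shows "transportation_mat ks $$ (sum_list (take j ks) + m, i) =
    (if multi_indices ks ! i ! j = m then 1 else 0)"
proof -
  let ?p = "sum_list (take j ks) + m"
  have "(\<exists>j'<length ks. ?p = sum_list (take j' ks) + multi_indices ks ! i ! j') \<longleftrightarrow>
      multi_indices ks ! i ! j = m"
    using position_inj[OF assms(1,2)] multi_indices_nth_less[OF assms(3)] assms(1) by metis
  then show ?thesis
    using position_bound[OF assms(1,2)] assms(3) by (simp add: transportation_mat_def)
qed

lemma sum_list_take_upt: "j \<le> length ks \<Longrightarrow> sum_list (map ((!) ks) [0..<j]) = sum_list (take j ks)"
  by (metis map_nth take_map take_upt add_0 )

lemma dim_margin_vec: "dim_vec (margin_vec ks S) = sum_list ks"
  by (simp add: margin_vec_def length_concat comp_def map_nth)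

lemma margin_vec_nth:
  assumes "j < length ks" "m < ks ! j"
  shows "margin_vec ks S $ (sum_list (take j ks) + m) = S j m"
proof -
  let ?xss = "map (\<lambda>j. map (S j) [0..<ks ! j]) [0..<length ks]"
  have "sum_list (map length (take j ?xss)) = sum_list (take j ks)"
    using assms by (simp add: take_map comp_def sum_list_take_upt)
  then show ?thesis
    using nth_concat_offset[of j ?xss m] assms by (simp add: margin_vec_def vec_of_list_index)
qed

lemma transportation_polytope_eq:
  "transportation_polytope ks S =
     {x \<in> carrier_vec (prod_list ks).
        transportation_mat ks *\<^sub>v x = margin_vec ks S \<and> 0\<^sub>v (prod_list ks) \<le> x}"
proof -
  have "(\<forall>j<length ks. \<forall>m<ks ! j.
           (\<Sum>i \<in> {i. i < prod_list ks \<and> multi_indices ks ! i ! j = m}. x $ i) = S j m) \<longleftrightarrow>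
        transportation_mat ks *\<^sub>v x = margin_vec ks S" (is "?L \<longleftrightarrow> ?R")
    if x: "x \<in> carrier_vec (prod_list ks)" for x
  proof -
    have entry: "(transportation_mat ks *\<^sub>v x) $ (sum_list (take j ks) + m) =
        (\<Sum>i \<in> {i. i < prod_list ks \<and> multi_indices ks ! i ! j = m}. x $ i)"
      if jm: "j < length ks" "m < ks ! j" for j m
    proof -
      have "(transportation_mat ks *\<^sub>v x) $ (sum_list (take j ks) + m) =
          (\<Sum>i = 0..<prod_list ks. transportation_mat ks $$ (sum_list (take j ks) + m, i) * x $ i)"
        using x jm position_bound[OF jm]
        by (auto simp: scalar_prod_def transportation_mat_def row_def intro!: sum.cong)
      also have "\<dots> = (\<Sum>i = 0..<prod_list ks. if multi_indices ks ! i ! j = m then x $ i else 0)"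
        using jm by (auto simp: transportation_mat_nth intro!: sum.cong)
      also have "\<dots> = (\<Sum>i \<in> {i. i < prod_list ks \<and> multi_indices ks ! i ! j = m}. x $ i)"
        by (simp add: sum.If_cases Int_def)
      finally show ?thesis .
    qed
    have "?R \<longleftrightarrow> (\<forall>p<sum_list ks. (transportation_mat ks *\<^sub>v x) $ p = margin_vec ks S $ p)"
      by (auto simp: vec_eq_iff dim_margin_vec transportation_mat_def)
    also have "\<dots> \<longleftrightarrow> (\<forall>j<length ks. \<forall>m<ks ! j.
        (transportation_mat ks *\<^sub>v x) $ (sum_list (take j ks) + m) =
          margin_vec ks S $ (sum_list (take j ks) + m))"
    proof (intro iffI allI impI)
      fix p
      assume *: "\<forall>j<length ks. \<forall>m<ks ! j.
        (transportation_mat ks *\<^sub>v x) $ (sum_list (take j ks) + m) =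
          margin_vec ks S $ (sum_list (take j ks) + m)" and "p < sum_list ks"
      then show "(transportation_mat ks *\<^sub>v x) $ p = margin_vec ks S $ p"
        using position_split[of p ks] by auto
    qed (use position_bound in blast)
    also have "\<dots> \<longleftrightarrow> ?L"
      by (simp add: entry margin_vec_nth)
    finally show ?thesis by simp
  qed
  then show ?thesis unfolding transportation_polytope_def by blast
qed

definition cube01 :: "nat \<Rightarrow> real vec set" where
  "cube01 n = {x \<in> carrier_vec n. \<forall>i<n. 0 \<le> x $ i \<and> x $ i \<le> 1}"

definition binary_vecs :: "nat \<Rightarrow> real vec set" where
  "binary_vecs n = {x \<in> carrier_vec n. \<forall>i<n. x $ i \<in> {0, 1}}"

text \<open>With \<open>1 / 0 = 0\<close> the convention \<open>0 ln (1/0) = 0\<close> holds automatically.\<close>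

definition entropy :: "real vec \<Rightarrow> real" where
  "entropy x = (\<Sum>i<dim_vec x. x $ i * ln (1 / x $ i) + (1 - x $ i) * ln (1 / (1 - x $ i)))"

definition covariance_form :: "real mat \<Rightarrow> real vec \<Rightarrow> real vec \<Rightarrow> real" where
  "covariance_form A z t = 1/2 * (\<Sum>i<dim_col A. (z $ i - (z $ i)\<^sup>2) * (col A i \<bullet> t)\<^sup>2)"

text \<open>Position \<open>k\<^sub>1 + \<dots> + k\<^sub>j\<close> of the 1-based convention has index \<open>k\<^sub>1 + \<dots> + k\<^sub>j - 1\<close> here.\<close>

definition reduced_space :: "nat list \<Rightarrow> real vec set" where
  "reduced_space ks =
     {t \<in> carrier_vec (sum_list ks). \<forall>j\<in>{2..length ks}. t $ (sum_list (take j ks) - 1) = 0}"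

definition orthogonal_projection :: "real vec set \<Rightarrow> real vec \<Rightarrow> real vec" where
  "orthogonal_projection L v =
     (THE w. w \<in> L \<and> (\<forall>u\<in>L. (v - w) \<bullet> u = 0))"

lemma orthogonal_projection_reduced_space:
  assumes v: "v \<in> carrier_vec (sum_list ks)" and d: "0 < sum_list ks"
  shows "orthogonal_projection (reduced_space ks) v =
    vec (sum_list ks) (\<lambda>p. if \<exists>j\<in>{2..length ks}. p = sum_list (take j ks) - 1 then 0 else v $ p)"
    (is "_ = ?w")
  unfolding orthogonal_projection_def
proof (rule the_equality)
  let ?d = "sum_list ks" and ?Z = "\<lambda>p. \<exists>j\<in>{2..length ks}. p = sum_list (take j ks) - 1"
  have wv: "(v - ?w) \<bullet> u = 0" if "u \<in> reduced_space ks" for u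
    using that v unfolding scalar_prod_def reduced_space_def
    by (intro sum.neutral) auto
  have pos: "sum_list (take j ks) - 1 < ?d" for j
  proof -
    have "sum_list (take j ks) \<le> ?d"
      by (metis append_take_drop_id le_add1 sum_list_append)
    then show ?thesis using d by linarith
  qed
  show "?w \<in> reduced_space ks \<and> (\<forall>u\<in>reduced_space ks. (v - ?w) \<bullet> u = 0)"
    using wv pos by (auto simp: reduced_space_def)
  fix w
  assume w: "w \<in> reduced_space ks \<and> (\<forall>u\<in>reduced_space ks. (v - w) \<bullet> u = 0)"
  then have wc: "w \<in> carrier_vec ?d" by (simp add: reduced_space_def)
  have "w $ p = v $ p" if p: "p < ?d" "\<not> ?Z p" for p
  proof -
    have "unit_vec ?d p \<in> reduced_space ks"
      using p pos by (auto simp: reduced_space_def)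
    with w have "(v - w) \<bullet> unit_vec ?d p = 0" by blast
    then show ?thesis using p v wc by simp
  qed
  moreover have "w $ p = 0" if "?Z p" for p
    using that w by (auto simp: reduced_space_def)
  ultimately show "w = ?w" using wc by (intro eq_vecI) auto
qed

definition form_mat :: "nat \<Rightarrow> (real vec \<Rightarrow> real) \<Rightarrow> real mat" where
  "form_mat d q = (THE B. B \<in> carrier_mat d d \<and> B\<^sup>T = B \<and>
     (\<forall>t\<in>carrier_vec d. 0 \<le> t \<bullet> (B *\<^sub>v t)) \<and>
     (\<forall>t\<in>carrier_vec d. q t = 1/2 * (t \<bullet> (B *\<^sub>v t))))"

lemma symmetric_form_mat_unique:
  fixes B C :: "real mat"
  assumes B: "B \<in> carrier_mat d d" "B\<^sup>T = B" and C: "C \<in> carrier_mat d d" "C\<^sup>T = C"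
    and eq: "\<And>t. t \<in> carrier_vec d \<Longrightarrow> t \<bullet> (B *\<^sub>v t) = t \<bullet> (C *\<^sub>v t)"
  shows "B = C"
proof (rule eq_matI)
  let ?e = "unit_vec d :: nat \<Rightarrow> real vec"
  have e: "?e i \<bullet> (M *\<^sub>v ?e j) = M $$ (i, j)"
    if "M \<in> carrier_mat d d" "i < d" "j < d" for M i j
    using that by (simp add: scalar_prod_left_unit[of _ d])
  have sym: "M $$ (j, i) = M $$ (i, j)"
    if "M \<in> carrier_mat d d" "M\<^sup>T = M" "i < d" "j < d" for M :: "real mat" and i j
    using that by (metis carrier_matD index_transpose_mat(1))
  fix i j assume ij: "i < dim_row C" "j < dim_col C"
  have exp: "(?e i + ?e j) \<bullet> (M *\<^sub>v (?e i + ?e j)) =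
      M $$ (i, i) + M $$ (i, j) + M $$ (j, i) + M $$ (j, j)" if M: "M \<in> carrier_mat d d" for M
  proof -
    have "(?e i + ?e j) \<bullet> (M *\<^sub>v (?e i + ?e j)) =
        (?e i + ?e j) \<bullet> (M *\<^sub>v ?e i + M *\<^sub>v ?e j)"
      using M by (simp add: mult_add_distrib_mat_vec[OF M])
    also have "\<dots> = ?e i \<bullet> (M *\<^sub>v ?e i) + ?e i \<bullet> (M *\<^sub>v ?e j) +
        (?e j \<bullet> (M *\<^sub>v ?e i) + ?e j \<bullet> (M *\<^sub>v ?e j))"
      using M by (simp add: add_scalar_prod_distrib[of _ d] scalar_prod_add_distrib[of _ d])
    finally show ?thesis using M C ij by (simp only: e carrier_matD)
  qed
  show "B $$ (i, j) = C $$ (i, j)"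
    using eq[of "?e i + ?e j"] eq[of "?e i"] eq[of "?e j"] exp[OF B(1)] exp[OF C(1)]
      e[OF B(1)] e[OF C(1)] sym[OF B, of i j] sym[OF C, of i j] ij C(1) by simp
qed (use B(1) C(1) in auto)

lemma form_mat_covariance_form:
  assumes A: "A \<in> carrier_mat d n" and z: "\<And>i. i < n \<Longrightarrow> 0 \<le> z $ i - (z $ i)\<^sup>2"
  shows "form_mat d (covariance_form A z) =
    mat d d (\<lambda>(p, p'). \<Sum>i<n. (z $ i - (z $ i)\<^sup>2) * A $$ (p, i) * A $$ (p', i))" (is "_ = ?B")
  unfolding form_mat_def
proof (rule the_equality)
  let ?c = "\<lambda>i. z $ i - (z $ i)\<^sup>2"
  have q: "t \<bullet> (?B *\<^sub>v t) = (\<Sum>i<n. ?c i * (col A i \<bullet> t)\<^sup>2)" if t: "t \<in> carrier_vec d" for t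
  proof -
    have "t \<bullet> (?B *\<^sub>v t) =
        (\<Sum>p<d. \<Sum>p'<d. \<Sum>i<n. ?c i * A $$ (p, i) * A $$ (p', i) * t $ p * t $ p')"
      using t by (auto simp: scalar_prod_def row_def sum_distrib_left sum_distrib_right
          atLeast0LessThan mult_ac intro!: sum.cong)
    also have "\<dots> = (\<Sum>p<d. \<Sum>i<n. \<Sum>p'<d. ?c i * A $$ (p, i) * A $$ (p', i) * t $ p * t $ p')"
      by (intro sum.cong refl sum.swap)
    also have "\<dots> = (\<Sum>i<n. \<Sum>p<d. \<Sum>p'<d. ?c i * A $$ (p, i) * A $$ (p', i) * t $ p * t $ p')"
      by (rule sum.swap)
    also have "\<dots> = (\<Sum>i<n. ?c i * (col A i \<bullet> t)\<^sup>2)"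
      using t A by (auto simp: scalar_prod_def power2_eq_square sum_product sum_distrib_left
          atLeast0LessThan mult_ac intro!: sum.cong)
    finally show ?thesis .
  qed
  have sym: "?B\<^sup>T = ?B" by (rule eq_matI) (auto simp: mult_ac intro!: sum.cong)
  have qB: "covariance_form A z t = 1/2 * (t \<bullet> (?B *\<^sub>v t))" if "t \<in> carrier_vec d" for t
    using q[OF that] A by (simp add: covariance_form_def)
  have "0 \<le> t \<bullet> (?B *\<^sub>v t)" if "t \<in> carrier_vec d" for t
    using z by (auto simp: q[OF that] intro!: sum_nonneg mult_nonneg_nonneg)
  then show "?B \<in> carrier_mat d d \<and> ?B\<^sup>T = ?B \<and> (\<forall>t\<in>carrier_vec d. 0 \<le> t \<bullet> (?B *\<^sub>v t)) \<and>
      (\<forall>t\<in>carrier_vec d. covariance_form A z t = 1/2 * (t \<bullet> (?B *\<^sub>v t)))"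
    using sym qB by simp
  fix B
  assume "B \<in> carrier_mat d d \<and> B\<^sup>T = B \<and> (\<forall>t\<in>carrier_vec d. 0 \<le> t \<bullet> (B *\<^sub>v t)) \<and>
      (\<forall>t\<in>carrier_vec d. covariance_form A z t = 1/2 * (t \<bullet> (B *\<^sub>v t)))"
  then have B: "B \<in> carrier_mat d d" "B\<^sup>T = B"
    and Bq: "\<And>t. t \<in> carrier_vec d \<Longrightarrow> covariance_form A z t = 1/2 * (t \<bullet> (B *\<^sub>v t))"
    by blast+
  have eq: "t \<bullet> (B *\<^sub>v t) = t \<bullet> (?B *\<^sub>v t)" if "t \<in> carrier_vec d" for t
    using trans[OF Bq[OF that, symmetric] qB[OF that]] by linarith
  show "B = ?B"
    by (rule symmetric_form_mat_unique[OF B _ sym eq]) (rule mat_carrier)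
qed

definition subspace_dim :: "nat \<Rightarrow> real vec set \<Rightarrow> nat" where
  "subspace_dim d W = vectorspace.dim class_ring (module_vec TYPE(real) d\<lparr>carrier := W\<rparr>)"

definition eigenspace_on :: "real vec set \<Rightarrow> (real vec \<Rightarrow> real vec) \<Rightarrow> real \<Rightarrow> real vec set" where
  "eigenspace_on L T l = {v \<in> L. T v = l \<cdot>\<^sub>v v}"

text \<open>
  The product of the eigenvalues of \<open>Q B Q\<close> on eigenvectors lying in \<open>L\<close>, where
  \<open>q t = 1/2 \<langle>t, B t\<rangle>\<close>; each eigenvalue counts with the dimension of its eigenspace in \<open>L\<close>
  (\<open>Q B Q\<close> is symmetric, so this is also its algebraic multiplicity there).
\<close>

definition form_det_on :: "nat \<Rightarrow> real vec set \<Rightarrow> (real vec \<Rightarrow> real) \<Rightarrow> real" where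
  "form_det_on d L q =
     (let Q = orthogonal_projection L; B = form_mat d q; T = (\<lambda>v. Q (B *\<^sub>v Q v))
      in \<Prod>l \<in> {l. \<exists>v\<in>eigenspace_on L T l. v \<noteq> 0\<^sub>v d}. l ^ subspace_dim d (eigenspace_on L T l))"

definition approximates_within :: "real \<Rightarrow> real \<Rightarrow> real \<Rightarrow> bool" where
  "approximates_within M E \<epsilon> \<longleftrightarrow> \<bar>M - E\<bar> \<le> \<epsilon> * E"

end

theory Submission
  imports Defs "HOL-Probability.Probability" "HOL-Real_Asymp.Real_Asymp"
    "Jordan_Normal_Form.Spectral_Radius" "Jordan_Normal_Form.Jordan_Normal_Form_Uniqueness"
begin

text \<open>
  By maximality of the entropy, a vector of independent Bernoulli variables with means \<open>z\<close> gives every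
  0-1 point of the polytope the same probability \<open>exp (- entropy z)\<close>. The number of these points is
  therefore \<open>exp (entropy z)\<close> times the probability that the margins of the random array are the
  prescribed ones, which by Fourier inversion is an integral over a torus of a product of
  characteristic functions, one for each entry of the array.

  Near the origin the integrand is \<open>exp (- q + i f + \<rho>)\<close> with \<open>f\<close> an odd cubic and \<open>\<rho>\<close> of fourth
  order. Only the even part \<open>cos f - 1\<close> contributes, so the relative error is bounded by the Gaussian
  expectations of \<open>f\<^sup>2\<close> and of the quartic term; both are \<open>O(k\<^sup>2 / k\<^sup>\<nu>)\<close>, because each linear form
  \<open>\<langle>a\<^sub>j, t\<rangle>\<close> has variance \<open>O(k / n)\<close> and the forms satisfy a Bessel inequality. The remaining part
  of the torus is negligible: writing one entry of an array of the form \<open>x\<^sub>1 + \<dots> + x\<^sub>\<nu>\<close> through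
  entries that differ from a random one in a single index shows that if one \<open>\<langle>a\<^sub>j, t\<rangle>\<close> is far from
  \<open>2\<pi>\<int>\<close>, then so is a proportion of order \<open>1 / k\<close> of all of them. The resulting bound
  \<open>O(k\<^sup>2 / k\<^sup>\<nu>)\<close> beats the claimed \<open>k powr (- \<nu> + 2.5)\<close> by a factor \<open>sqrt k\<close>, which absorbs the
  constant for large \<open>k\<close>.
\<close>

section \<open>The determinant of a form on the reduced space\<close>

text \<open>The blocks of margin equations all have the same total, so the covariance form is
  degenerate on the full space. The coordinates of the redundant equations are not eliminated: each
  carries an independent standard Gaussian weight. The determinant on \<open>reduced_space\<close>
  is then an ordinary \<open>d\<close> by \<open>d\<close> determinant with an identity block, and
  every integral lives on one product measure. Normal coordinates come from Gram-Schmidt, hence are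
  triangular, and their Jacobian is found by integrating out one coordinate at a time.

  The cutoff \<open>L\<close> is subject to two demands: it must be of order \<open>d\<close>, hence
  up to order \<open>k\<close>, for the Gaussian tail in dimension \<open>d\<close> to be
  negligible, and \<open>L * k / n\<close> must be small for every linear form to be small on the
  ball. They are compatible because \<open>k\<^sup>2 / n\<close> is of order at most
  \<open>1 / k\<close> when \<nu> \<ge> 3. The error on the rest of the torus is absolute, so
  \<open>mass\<close> needs a lower bound; the loss \<open>exp (O (k ln k))\<close> is beaten by
  \<open>exp (- c k\<^sup>2)\<close>. Below the threshold for \<open>k\<close> the integral is
  bounded trivially, and \<Gamma> is chosen large enough.\<close>

lemma symmetric_scalar_prod_swap:
  fixes C :: "'a::comm_semiring_0 mat"
  assumes "C \<in> carrier_mat n n" "C\<^sup>T = C" "u \<in> carrier_vec n" "v \<in> carrier_vec n"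
  shows "(C *\<^sub>v u) \<bullet> v = u \<bullet> (C *\<^sub>v v)"
  using transpose_vec_mult_scalar[of C n n v u] assms
  by (metis comm_scalar_prod mult_mat_vec_carrier)

text \<open>Over \<complex> the polynomial splits anyway. Moving the symmetric real matrix across
  the product of an eigenvector with its conjugate shows that each root equals its conjugate, and
  injectivity of the coefficient embedding brings the factorization back to \<real>.\<close>

lemma char_poly_symmetric_splits:
  fixes C :: "real mat"
  assumes C: "C \<in> carrier_mat n n" and sym: "C\<^sup>T = C"
  shows "\<exists>as. char_poly C = (\<Prod>a\<leftarrow>as. [:- a, 1:])"
proof -
  let ?C = "map_mat complex_of_real C"
  have CC: "?C \<in> carrier_mat n n" using C by simp
  obtain as where as: "char_poly ?C = (\<Prod>a\<leftarrow>as. [:- a, 1:])"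
    using char_poly_factorized[OF CC] by blast
  have real: "a \<in> \<real>" if a: "a \<in> set as" for a
  proof -
    have "poly (char_poly ?C) a = 0"
      unfolding as poly_prod_list prod_list_zero_iff using a by force
    then have "eigenvalue ?C a" using eigenvalue_root_char_poly[OF CC] by blast
    then obtain v where v: "v \<in> carrier_vec n" "v \<noteq> 0\<^sub>v n" "?C *\<^sub>v v = a \<cdot>\<^sub>v v"
      using CC unfolding eigenvalue_def eigenvector_def by auto
    have symC: "?C\<^sup>T = ?C" using sym by (metis map_mat_transpose)
    have conjC: "conjugate (?C *\<^sub>v v) = ?C *\<^sub>v conjugate v"
      using C v(1) by (intro eq_vecI) (auto simp: scalar_prod_def)
    have cv: "conjugate v \<in> carrier_vec n" using v(1) by simp
    have "a * (v \<bullet> conjugate v) = (?C *\<^sub>v v) \<bullet> conjugate v"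
      unfolding v(3) using v(1) cv by simp
    also have "\<dots> = v \<bullet> (?C *\<^sub>v conjugate v)"
      using symmetric_scalar_prod_swap[OF CC symC v(1) cv] .
    also have "\<dots> = v \<bullet> (cnj a \<cdot>\<^sub>v conjugate v)"
      unfolding conjC[symmetric] v(3) by (simp add: conjugate_smult_vec)
    also have "\<dots> = cnj a * (v \<bullet> conjugate v)"
      using v(1) cv by simp
    finally have "a * (v \<bullet>c v) = cnj a * (v \<bullet>c v)" .
    moreover have "v \<bullet>c v \<noteq> 0" using v(2) conjugate_square_eq_0_vec[OF v(1)] by simp
    ultimately show ?thesis by (metis Reals_cnj_iff mult_cancel_right)
  qed
  define bs where "bs = map Re as"
  have bs: "as = map complex_of_real bs"
    unfolding bs_def map_map o_def by (rule map_idI[symmetric]) (use real in auto)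
  interpret mp: map_poly_inj_idom_hom complex_of_real ..
  have prod: "map_poly complex_of_real (\<Prod>a\<leftarrow>xs. [:- a, 1:]) =
      (\<Prod>a\<leftarrow>xs. [:- complex_of_real a, 1:])" for xs
    by (simp add: mp.hom_prod_list o_def)
  have "char_poly ?C = map_poly complex_of_real (char_poly C)"
    by (rule of_real_hom.char_poly_hom[OF C])
  then have "map_poly complex_of_real (char_poly C) = map_poly complex_of_real (\<Prod>a\<leftarrow>bs. [:- a, 1:])"
    unfolding prod using as bs by (simp add: o_def)
  then have "char_poly C = (\<Prod>a\<leftarrow>bs. [:- a, 1:])"
    by (rule mp.injectivity)
  then show ?thesis by blast
qed

text \<open>The squared length of \<open>N v\<close> is the product of \<open>v\<close> with
  \<open>N (N v)\<close>. Applied to \<open>C - a I\<close>, this excludes Jordan blocks of size at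
  least 2.\<close>

lemma mat_kernel_square_symmetric:
  fixes N :: "real mat"
  assumes N: "N \<in> carrier_mat n n" and sym: "N\<^sup>T = N"
  shows "mat_kernel (N * N) = mat_kernel N"
proof (intro subset_antisym subsetI)
  fix v assume "v \<in> mat_kernel (N * N)"
  then have v: "v \<in> carrier_vec n" "N *\<^sub>v (N *\<^sub>v v) = 0\<^sub>v n"
    using N by (auto simp: mat_kernel_def)
  have Nv: "N *\<^sub>v v \<in> carrier_vec n" using N v by simp
  have "(N *\<^sub>v v) \<bullet>c (N *\<^sub>v v) = (N *\<^sub>v v) \<bullet> (N *\<^sub>v v)"
    by (simp add: scalar_prod_def)
  also have "\<dots> = v \<bullet> (N *\<^sub>v (N *\<^sub>v v))"
    using symmetric_scalar_prod_swap[OF N sym v(1) Nv] .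
  also have "\<dots> = 0" using v by simp
  finally have "N *\<^sub>v v = 0\<^sub>v n" using conjugate_square_eq_0_vec[OF Nv] by simp
  then show "v \<in> mat_kernel N" using N v by (auto simp: mat_kernel_def)
next
  fix v assume "v \<in> mat_kernel N"
  then show "v \<in> mat_kernel (N * N)"
    using N by (auto simp: mat_kernel_def)
qed

text \<open>\<open>form_det_on\<close> counts geometric multiplicities, the determinant algebraic
  ones. The kernels of the first and second power of the characteristic matrix have as dimensions
  the sums of \<open>min 1\<close> and \<open>min 2\<close> of the block sizes; their equality
  leaves only blocks of size 1, and then the dimension is the sum of the block sizes.\<close>

lemma kernel_dim_symmetric_eq_order:
  fixes C :: "real mat"
  assumes C: "C \<in> carrier_mat n n" and sym: "C\<^sup>T = C"
  shows "kernel_dim (char_matrix C a) = order a (char_poly C)"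
proof -
  obtain nas where jnf: "jordan_nf C nas"
    using char_poly_symmetric_splits[OF C sym] jordan_nf_exists[OF C] by blast
  let ?N = "char_matrix C a"
  have cm: "?N \<in> carrier_mat n n" using C by simp
  have symcm: "?N\<^sup>T = ?N"
  proof (rule eq_matI)
    fix i j assume ij: "i < dim_row ?N" "j < dim_col ?N"
    have "C $$ (j, i) = C $$ (i, j)"
      using ij C by (subst sym[symmetric]) (auto simp: char_matrix_def)
    then show "?N\<^sup>T $$ (i, j) = ?N $$ (i, j)"
      using ij C by (auto simp: char_matrix_def)
  qed (use C in \<open>auto simp: char_matrix_def\<close>)
  let ?xs = "map fst [(n, e)\<leftarrow>nas . e = a]"
  have p1: "?N ^\<^sub>m 1 = ?N" and p2: "?N ^\<^sub>m 2 = ?N * ?N"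
    using cm by (auto simp: numeral_2_eq_2)
  have "kernel_dim (?N ^\<^sub>m 2) = kernel_dim (?N ^\<^sub>m 1)"
    unfolding p1 p2 kernel_dim_def
    using mat_kernel_square_symmetric[OF cm symcm] cm by auto
  then have "dim_gen_eigenspace C a 2 = dim_gen_eigenspace C a 1"
    by (simp add: dim_gen_eigenspace_def)
  then have eq: "(\<Sum>n\<leftarrow>?xs. min 2 n) = (\<Sum>n\<leftarrow>?xs. min 1 n)"
    unfolding dim_gen_eigenspace[OF jnf] by simp
  have "(\<Sum>n\<leftarrow>xs. min 2 n) = (\<Sum>n\<leftarrow>xs. min 1 n) \<Longrightarrow> sum_list xs = (\<Sum>n\<leftarrow>xs. min 1 n)" for xs :: "nat list"
  proof (induction xs)
    case (Cons x xs)
    have "(\<Sum>n\<leftarrow>xs. min 1 n) \<le> (\<Sum>n\<leftarrow>xs. min 2 n)" by (intro sum_list_mono) auto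
    with Cons show ?case by (auto simp: min_def split: if_splits)
  qed simp
  from this[OF eq] have "sum_list ?xs = kernel_dim ?N"
    using dim_gen_eigenspace[OF jnf, of a 1] p1 by (simp add: dim_gen_eigenspace_def)
  then show ?thesis
    unfolding jordan_nf_order[OF jnf] by (simp add: case_prod_beta')
qed

lemma prod_list_eq_prod_count_list:
  fixes xs :: "'a::comm_monoid_mult list"
  assumes "finite X" "set xs \<subseteq> X"
  shows "prod_list xs = (\<Prod>x\<in>X. x ^ count_list xs x)"
  using assms(2)
proof (induction xs)
  case (Cons a xs)
  have "(\<Prod>x\<in>X. x ^ count_list (a # xs) x) = (\<Prod>x\<in>X. (if x = a then a else 1) * x ^ count_list xs x)"
    by (intro prod.cong) auto
  also have "\<dots> = a * prod_list xs"
    using Cons assms(1) by (simp add: prod.distrib)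
  finally show ?case by simp
qed simp

text \<open>Schur triangularization puts the roots of the characteristic polynomial on the diagonal.
  Each occurs as often as its order, which for a symmetric matrix is the dimension of its
  eigenspace.\<close>

lemma det_symmetric_eq_prod_eigenvalues:
  fixes C :: "real mat"
  assumes C: "C \<in> carrier_mat n n" and sym: "C\<^sup>T = C"
  shows "Determinant.det C = (\<Prod>l\<in>{l. eigenvalue C l}. l ^ kernel_dim (char_matrix C l))"
proof -
  obtain as where as: "char_poly C = (\<Prod>a\<leftarrow>as. [:- a, 1:])"
    using char_poly_symmetric_splits[OF C sym] by blast
  obtain B P Q where BPQ: "schur_decomposition C as = (B, P, Q)" by (metis prod_cases3)
  have B: "similar_mat C B" "upper_triangular B" "diag_mat B = as"
    using schur_decomposition[OF C as BPQ] unfolding similar_mat_def by auto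
  have Bc: "B \<in> carrier_mat n n" using B(1) C by (auto simp: similar_mat_def similar_mat_wit_def Let_def)
  have ord: "order l (\<Prod>a\<leftarrow>xs. [:- a, 1:]) = count_list xs l" for l and xs :: "real list"
  proof (induction xs)
    case (Cons x xs)
    have "[:- x, 1:] * (\<Prod>a\<leftarrow>xs. [:- a, 1:]) \<noteq> 0"
      unfolding mult_eq_0_iff prod_list_zero_iff by auto
    then have "order l (\<Prod>a\<leftarrow>x # xs. [:- a, 1:]) = order l [:- x, 1:] + order l (\<Prod>a\<leftarrow>xs. [:- a, 1:])"
      unfolding list.map prod_list.Cons by (rule Polynomial.order_mult)
    also have "order l [:- x, 1:] = (if x = l then 1 else 0)"
      by (auto simp: order_linear' order_0I)
    finally show ?case using Cons by simp
  qed simp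
  have eig: "{l. eigenvalue C l} = set as"
    unfolding eigenvalue_root_char_poly[OF C] as poly_prod_list prod_list_zero_iff by (force simp: image_iff)
  have "Determinant.det C = prod_list as"
    using det_similar[OF B(1)] det_upper_triangular[OF B(2) Bc] B(3) by simp
  also have "\<dots> = (\<Prod>l\<in>set as. l ^ count_list as l)"
    by (rule prod_list_eq_prod_count_list) auto
  also have "\<dots> = (\<Prod>l\<in>{l. eigenvalue C l}. l ^ kernel_dim (char_matrix C l))"
    unfolding eig kernel_dim_symmetric_eq_order[OF C sym] as ord ..
  finally show ?thesis .
qed

text \<open>The matrix acts as \<open>Q B Q\<close> on the reduced space and as the identity on the
  coordinates in \<open>Z\<close>. The identity block adds only the eigenvalue 1, whose powers do
  not change a product. So the two spectra are compared away from 1, where every eigenvector lies in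
  the reduced space.\<close>

lemma form_det_on_reduced_space:
  fixes ks :: "nat list" and B :: "real mat"
  defines "d \<equiv> sum_list ks"
    and "Z \<equiv> {p. \<exists>j\<in>{2..length ks}. p = sum_list (take j ks) - 1}"
  assumes d: "0 < d" and B: "B \<in> carrier_mat d d" "B\<^sup>T = B" and q: "form_mat d q = B"
  shows "form_det_on d (reduced_space ks) q =
    Determinant.det (Matrix.mat d d (\<lambda>(p, p'). if p \<in> Z \<or> p' \<in> Z then (if p = p' then 1 else 0) else B $$ (p, p')))"
proof -
  define C where "C = Matrix.mat d d (\<lambda>(p, p'). if p \<in> Z \<or> p' \<in> Z then (if p = p' then 1 else 0) else B $$ (p, p'))"
  let ?L = "reduced_space ks" and ?Q = "orthogonal_projection (reduced_space ks)"
  define T where "T = (\<lambda>v. ?Q (B *\<^sub>v ?Q v))"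
  have C: "C \<in> carrier_mat d d" by (simp add: C_def)
  have Bsym: "B $$ (i, j) = B $$ (j, i)" if "i < d" "j < d" for i j
    using that B by (metis carrier_matD index_transpose_mat(1))
  have sym: "C\<^sup>T = C"
    by (rule eq_matI) (auto simp: C_def Bsym)
  have L: "v \<in> ?L \<longleftrightarrow> v \<in> carrier_vec d \<and> (\<forall>p\<in>Z. v $ p = 0)" for v
    by (auto simp: reduced_space_def d_def Z_def)
  have Q: "?Q v = Matrix.vec d (\<lambda>p. if p \<in> Z then 0 else v $ p)" if "v \<in> carrier_vec d" for v
    using orthogonal_projection_reduced_space[of v ks] that d by (simp add: d_def Z_def)
  have QL: "?Q v = v" if "v \<in> ?L" for v
    using that Q[of v] L[of v] by (auto intro!: eq_vecI)
  have CT: "C *\<^sub>v v = T v" if v: "v \<in> ?L" for v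
  proof (rule eq_vecI)
    have vc: "v \<in> carrier_vec d" and v0: "\<And>p. p \<in> Z \<Longrightarrow> v $ p = 0" using v L by auto
    have T: "T v = Matrix.vec d (\<lambda>p. if p \<in> Z then 0 else (B *\<^sub>v v) $ p)"
      unfolding T_def QL[OF v] using B vc by (intro Q) auto
    show "dim_vec (C *\<^sub>v v) = dim_vec (T v)" using C by (simp add: T)
    fix p assume "p < dim_vec (T v)"
    then have p: "p < d" by (simp add: T)
    have "(C *\<^sub>v v) $ p = (\<Sum>p'<d. C $$ (p, p') * v $ p')"
      using p vc C by (simp add: scalar_prod_def atLeast0LessThan)
    also have "\<dots> = (if p \<in> Z then 0 else (\<Sum>p'<d. B $$ (p, p') * v $ p'))"
      using p v0 by (auto simp: C_def intro!: sum.neutral sum.cong)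
    also have "\<dots> = T v $ p"
      using p vc B by (simp add: T scalar_prod_def atLeast0LessThan)
    finally show "(C *\<^sub>v v) $ p = T v $ p" .
  qed
  have eig: "eigenspace_on ?L T l = {v \<in> carrier_vec d. C *\<^sub>v v = l \<cdot>\<^sub>v v}" if l: "l \<noteq> 1" for l
  proof -
    have "v \<in> ?L" if v: "v \<in> carrier_vec d" "C *\<^sub>v v = l \<cdot>\<^sub>v v" for v
    proof -
      have "v $ p = 0" if p: "p \<in> Z" "p < d" for p
      proof -
        have "(C *\<^sub>v v) $ p = (\<Sum>p'<d. C $$ (p, p') * v $ p')"
          using p v(1) C by (simp add: scalar_prod_def atLeast0LessThan)
        also have "\<dots> = (\<Sum>p'<d. if p' = p then v $ p' else 0)"
          using p by (intro sum.cong) (auto simp: C_def)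
        also have "\<dots> = v $ p" using p by simp
        finally have "v $ p = l * v $ p" using v p by simp
        then show ?thesis using l by simp
      qed
      moreover have "p < d" if pZ: "p \<in> Z" for p
      proof -
        have le: "sum_list (take j ks) \<le> sum_list ks" for j
          by (metis append_take_drop_id le_add1 sum_list_append)
        obtain j where "p = sum_list (take j ks) - 1" using pZ by (auto simp: Z_def)
        then show ?thesis using le[of j] d by (simp add: d_def)
      qed
      ultimately show ?thesis using v L by blast
    qed
    then show ?thesis unfolding eigenspace_on_def by (intro Collect_cong) (metis CT L)
  qed
  have ker: "mat_kernel (char_matrix C l) = {v \<in> carrier_vec d. C *\<^sub>v v = l \<cdot>\<^sub>v v}" for l
  proof -
    have "char_matrix C l *\<^sub>v v = 0\<^sub>v d \<longleftrightarrow> C *\<^sub>v v = l \<cdot>\<^sub>v v" if v: "v \<in> carrier_vec d" for v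
    proof (cases "v = 0\<^sub>v d")
      case True
      have zero: "M *\<^sub>v 0\<^sub>v d = 0\<^sub>v d" if "M \<in> carrier_mat d d" for M :: "real mat"
        using that by (intro eq_vecI) (auto simp: scalar_prod_def)
      have "l \<cdot>\<^sub>v 0\<^sub>v d = 0\<^sub>v d" by (intro eq_vecI) auto
      then show ?thesis unfolding True zero[OF C] zero[OF char_matrix_closed[OF C]] by simp
    next
      case False
      then show ?thesis
        using eigenvector_char_matrix[OF C, of v l] v C by (simp add: eigenvector_def)
    qed
    moreover have "dim_row (char_matrix C l) = d" "dim_col (char_matrix C l) = d"
      using char_matrix_closed[OF C, of l] by (simp_all only: carrier_matD)
    ultimately show ?thesis unfolding mat_kernel_def by auto
  qed
  have dim: "subspace_dim d (eigenspace_on ?L T l) = kernel_dim (char_matrix C l)" if "l \<noteq> 1" for l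
    unfolding subspace_dim_def kernel_dim_def eig[OF that] ker carrier_matD(2)[OF char_matrix_closed[OF C]] ..
  have ev: "(\<exists>v\<in>eigenspace_on ?L T l. v \<noteq> 0\<^sub>v d) \<longleftrightarrow> eigenvalue C l" if "l \<noteq> 1" for l
    using C by (auto simp: eig[OF that] eigenvalue_def eigenvector_def)
  let ?S = "{l. \<exists>v\<in>eigenspace_on ?L T l. v \<noteq> 0\<^sub>v d}" and ?S' = "{l. eigenvalue C l}"
  have "finite ?S'"
    using card_finite_spectrum(1)[OF C] by (simp add: spectrum_def)
  moreover have S: "?S - {1} = ?S' - {1}" using ev by auto
  then have "?S \<subseteq> insert 1 ?S'" by blast
  ultimately have fin: "finite ?S" "finite ?S'"
    by (auto intro: finite_subset)
  have "form_det_on d ?L q = (\<Prod>l\<in>?S. l ^ subspace_dim d (eigenspace_on ?L T l))"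
    by (simp add: form_det_on_def Let_def q T_def)
  also have "\<dots> = (\<Prod>l\<in>?S - {1}. l ^ subspace_dim d (eigenspace_on ?L T l))"
    using fin by (intro prod.mono_neutral_right) auto
  also have "\<dots> = (\<Prod>l\<in>?S' - {1}. l ^ kernel_dim (char_matrix C l))"
    unfolding S by (intro prod.cong) (auto simp: dim)
  also have "\<dots> = (\<Prod>l\<in>?S'. l ^ kernel_dim (char_matrix C l))"
    using fin by (intro prod.mono_neutral_left) auto
  also have "\<dots> = Determinant.det C" using det_symmetric_eq_prod_eigenvalues[OF C sym] by simp
  finally show ?thesis by (simp add: C_def)
qed

section \<open>Linear changes of variables in product Lebesgue measure\<close>

abbreviation Leb :: "nat \<Rightarrow> (nat \<Rightarrow> real) measure" where
  "Leb d \<equiv> PiM {..<d} (\<lambda>_. lborel)"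

interpretation lborel_prod: product_sigma_finite "\<lambda>_::nat. lborel :: real measure"
  by standard

lemma nn_integral_Leb_Suc:
  assumes "f \<in> borel_measurable (Leb (Suc d))"
  shows "(\<integral>\<^sup>+x. f x \<partial>Leb (Suc d)) = (\<integral>\<^sup>+x. (\<integral>\<^sup>+y. f (x(d := y)) \<partial>lborel) \<partial>Leb d)"
  using lborel_prod.product_nn_integral_insert[of "{..<d}" d f] assms
  by (simp add: lessThan_Suc)

text \<open>Only entries on or below the diagonal are read, so a coordinate influences no earlier
  one. The restriction to \<open>{..<d}\<close> keeps the value in the space of the product measure,
  whose points are extensional functions.\<close>

definition lower_tri :: "nat \<Rightarrow> (nat \<Rightarrow> nat \<Rightarrow> real) \<Rightarrow> (nat \<Rightarrow> real) \<Rightarrow> nat \<Rightarrow> real" where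
  "lower_tri d T x = (\<lambda>p\<in>{..<d}. \<Sum>q\<le>p. T p q * x q)"

lemma measurable_lower_tri [measurable]: "lower_tri d T \<in> Leb d \<rightarrow>\<^sub>M Leb d"
  unfolding lower_tri_def
proof (rule measurable_restrict)
  fix p assume "p \<in> {..<d}"
  then have "(\<lambda>x. x q) \<in> borel_measurable (Leb d)" if "q \<in> {..p}" for q
    using that measurable_component_singleton[of q "{..<d}" "\<lambda>_. lborel :: real measure"] by simp
  then have "(\<lambda>x. \<Sum>q\<le>p. T p q * x q) \<in> borel_measurable (Leb d)"
    by (intro borel_measurable_sum borel_measurable_times borel_measurable_const)
  then show "(\<lambda>x. \<Sum>q\<le>p. T p q * x q) \<in> Leb d \<rightarrow>\<^sub>M lborel" by simp
qed

lemma lower_tri_Suc: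
  "lower_tri (Suc d) T (x(d := y)) = (lower_tri d T x)(d := (\<Sum>q<d. T d q * x q) + T d d * y)"
  by (auto simp: lower_tri_def fun_eq_iff restrict_def lessThan_Suc_atMost[symmetric] less_Suc_eq intro!: sum.cong)

text \<open>Induction with Fubini: for fixed earlier coordinates the innermost integral undergoes an
  affine substitution with slope \<open>T d d\<close>; the shift depends on the earlier coordinates
  and disappears by translation invariance.\<close>

lemma nn_integral_lower_tri:
  fixes f :: "(nat \<Rightarrow> real) \<Rightarrow> ennreal"
  assumes "\<And>p. p < d \<Longrightarrow> T p p \<noteq> 0" "f \<in> borel_measurable (Leb d)"
  shows "(\<integral>\<^sup>+x. f x \<partial>Leb d) = ennreal (\<Prod>p<d. \<bar>T p p\<bar>) * (\<integral>\<^sup>+x. f (lower_tri d T x) \<partial>Leb d)"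
  using assms
proof (induction d arbitrary: f)
  case 0
  then show ?case by (simp add: PiM_empty nn_integral_count_space_finite lower_tri_def restrict_def)
next
  case (Suc d)
  note [measurable] = Suc.prems(2)
  have ins: "{..<Suc d} = {..<d} \<union> {d}" by auto
  have upd [measurable]: "(\<lambda>y. x(d := y)) \<in> borel \<rightarrow>\<^sub>M Leb (Suc d)" if "x \<in> space (Leb d)" for x
    using that by (intro measurable_fun_upd[OF ins]) auto
  have upd2 [measurable]: "(\<lambda>(x, y). x(d := y)) \<in> Leb d \<Otimes>\<^sub>M lborel \<rightarrow>\<^sub>M Leb (Suc d)"
    unfolding case_prod_beta by (intro measurable_fun_upd[OF ins]) auto
  define F where "F = (\<lambda>x. \<integral>\<^sup>+y. f (x(d := y)) \<partial>lborel)"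
  have F [measurable]: "F \<in> borel_measurable (Leb d)"
    unfolding F_def by measurable
  have in_sp: "lower_tri d T x \<in> space (Leb d)" for x
    by (auto simp: space_PiM lower_tri_def)
  have inner: "ennreal \<bar>T d d\<bar> * (\<integral>\<^sup>+y. f (lower_tri (Suc d) T (x(d := y))) \<partial>lborel) = F (lower_tri d T x)"
    for x
  proof -
    have "F (lower_tri d T x) = ennreal \<bar>T d d\<bar> *
        (\<integral>\<^sup>+y. f ((lower_tri d T x)(d := (\<Sum>q<d. T d q * x q) + T d d * y)) \<partial>lborel)"
      unfolding F_def using Suc.prems(1)[of d] upd[OF in_sp]
      by (intro nn_integral_real_affine) auto
    then show ?thesis by (simp add: lower_tri_Suc)
  qed
  have "(\<integral>\<^sup>+x. f x \<partial>Leb (Suc d)) = (\<integral>\<^sup>+x. F x \<partial>Leb d)"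
    unfolding F_def by (rule nn_integral_Leb_Suc) fact
  also have "\<dots> = ennreal (\<Prod>p<d. \<bar>T p p\<bar>) * (\<integral>\<^sup>+x. F (lower_tri d T x) \<partial>Leb d)"
    using Suc.prems(1) F by (intro Suc.IH) auto
  also have "\<dots> = ennreal (\<Prod>p<d. \<bar>T p p\<bar>) * (ennreal \<bar>T d d\<bar> *
      (\<integral>\<^sup>+x. (\<integral>\<^sup>+y. f (lower_tri (Suc d) T (x(d := y))) \<partial>lborel) \<partial>Leb d))"
    unfolding inner[symmetric] by (subst nn_integral_cmult) measurable
  also have "(\<integral>\<^sup>+x. (\<integral>\<^sup>+y. f (lower_tri (Suc d) T (x(d := y))) \<partial>lborel) \<partial>Leb d) =
      (\<integral>\<^sup>+x. f (lower_tri (Suc d) T x) \<partial>Leb (Suc d))"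
    by (rule nn_integral_Leb_Suc[symmetric]) measurable
  finally show ?case
    by (simp add: ennreal_mult' prod_nonneg mult.assoc[symmetric])
qed

text \<open>As an identity of measures the substitution also reaches Bochner integrals and
  integrability, through the rules for densities and image measures.\<close>

lemma Leb_eq_density_lower_tri:
  assumes "\<And>p. p < d \<Longrightarrow> T p p \<noteq> 0"
  shows "Leb d = density (distr (Leb d) (Leb d) (lower_tri d T)) (\<lambda>_. ennreal (\<Prod>p<d. \<bar>T p p\<bar>))"
proof (rule measure_eqI)
  fix A assume A [measurable]: "A \<in> sets (Leb d)"
  have "emeasure (Leb d) A = (\<integral>\<^sup>+x. indicator A x \<partial>Leb d)" using A by simp
  also have "\<dots> = ennreal (\<Prod>p<d. \<bar>T p p\<bar>) * (\<integral>\<^sup>+x. indicator A (lower_tri d T x) \<partial>Leb d)"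
    using assms by (rule nn_integral_lower_tri) measurable
  also have "(\<integral>\<^sup>+x. indicator A (lower_tri d T x) \<partial>Leb d) = (\<integral>\<^sup>+x. indicator A x \<partial>distr (Leb d) (Leb d) (lower_tri d T))"
    by (subst nn_integral_distr) measurable
  finally show "emeasure (Leb d) A = emeasure (density (distr (Leb d) (Leb d) (lower_tri d T)) (\<lambda>_. ennreal (\<Prod>p<d. \<bar>T p p\<bar>))) A"
    by (simp add: emeasure_density nn_integral_cmult)
qed simp

lemma integral_lower_tri:
  fixes f :: "(nat \<Rightarrow> real) \<Rightarrow> 'a::{banach, second_countable_topology}"
  assumes T: "\<And>p. p < d \<Longrightarrow> T p p \<noteq> 0" and f [measurable]: "f \<in> borel_measurable (Leb d)"
  shows "(\<integral>x. f x \<partial>Leb d) = (\<Prod>p<d. \<bar>T p p\<bar>) *\<^sub>R (\<integral>x. f (lower_tri d T x) \<partial>Leb d)"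
    and "integrable (Leb d) f \<longleftrightarrow> integrable (Leb d) (\<lambda>x. f (lower_tri d T x))"
proof -
  let ?c = "\<Prod>p<d. \<bar>T p p\<bar>" and ?D = "distr (Leb d) (Leb d) (lower_tri d T)"
  have c: "?c > 0" using T by (intro prod_pos) auto
  have eq: "Leb d = density ?D (\<lambda>_. ennreal ?c)"
    using T by (rule Leb_eq_density_lower_tri)
  have "(\<integral>x. f x \<partial>Leb d) = (\<integral>x. f x \<partial>density ?D (\<lambda>_. ennreal ?c))" using eq by simp
  also have "\<dots> = (\<integral>x. ?c *\<^sub>R f x \<partial>?D)"
    using c by (intro integral_density) auto
  also have "\<dots> = ?c *\<^sub>R (\<integral>x. f (lower_tri d T x) \<partial>Leb d)"
    by (simp add: integral_distr)
  finally show "(\<integral>x. f x \<partial>Leb d) = ?c *\<^sub>R (\<integral>x. f (lower_tri d T x) \<partial>Leb d)" .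
  have "integrable (Leb d) f \<longleftrightarrow> integrable (density ?D (\<lambda>_. ennreal ?c)) f" using eq by simp
  also have "\<dots> \<longleftrightarrow> integrable ?D (\<lambda>x. ?c *\<^sub>R f x)"
    using c by (intro integrable_density) auto
  also have "\<dots> \<longleftrightarrow> integrable (Leb d) (\<lambda>x. f (lower_tri d T x))"
  proof
    assume "integrable ?D (\<lambda>x. ?c *\<^sub>R f x)"
    then have "integrable (Leb d) (\<lambda>x. ?c *\<^sub>R f (lower_tri d T x))"
      by (simp add: integrable_distr_eq)
    then have "integrable (Leb d) (\<lambda>x. (1 / ?c) *\<^sub>R (?c *\<^sub>R f (lower_tri d T x)))"
      by (rule integrable_scaleR_right)
    moreover have "(1 / ?c) *\<^sub>R (?c *\<^sub>R f (lower_tri d T x)) = f (lower_tri d T x)" for x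
      using c unfolding scaleR_scaleR by (metis less_irrefl nonzero_divide_eq_eq scaleR_one)
    ultimately show "integrable (Leb d) (\<lambda>x. f (lower_tri d T x))" by (simp only:)
  next
    assume "integrable (Leb d) (\<lambda>x. f (lower_tri d T x))"
    then show "integrable ?D (\<lambda>x. ?c *\<^sub>R f x)"
      by (intro integrable_scaleR_right) (simp add: integrable_distr_eq)
  qed
  finally show "integrable (Leb d) f \<longleftrightarrow> integrable (Leb d) (\<lambda>x. f (lower_tri d T x))" .
qed

section \<open>Orthogonalization with respect to a bilinear form\<close>

definition bilin :: "nat \<Rightarrow> (nat \<Rightarrow> nat \<Rightarrow> real) \<Rightarrow> (nat \<Rightarrow> real) \<Rightarrow> (nat \<Rightarrow> real) \<Rightarrow> real" where
  "bilin d B x y = (\<Sum>i<d. \<Sum>j<d. B i j * x i * y j)"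

lemma bilin_transpose: "bilin d (\<lambda>i j. B j i) x y = bilin d B y x"
  unfolding bilin_def by (subst sum.swap) (intro sum.cong refl, simp add: mult_ac)

lemma bilin_commute:
  assumes "\<And>i j. i < d \<Longrightarrow> j < d \<Longrightarrow> B i j = B j i"
  shows "bilin d B x y = bilin d B y x"
proof -
  have "bilin d B x y = bilin d (\<lambda>i j. B j i) x y"
    unfolding bilin_def by (intro sum.cong refl) (simp add: assms)
  then show ?thesis using bilin_transpose[of d B x y] by (rule trans)
qed

lemma bilin_linear_left:
  "bilin d B (\<lambda>i. a * x i + b * y i) w = a * bilin d B x w + b * bilin d B y w"
  unfolding bilin_def sum_distrib_left sum.distrib[symmetric]
  by (intro sum.cong refl) (simp add: algebra_simps)

lemma bilin_sum_left:
  "finite S \<Longrightarrow> bilin d B (\<lambda>i. \<Sum>p\<in>S. f p * x p i) w = (\<Sum>p\<in>S. f p * bilin d B (x p) w)"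
proof (induction S rule: finite_induct)
  case empty
  then show ?case by (simp add: bilin_def)
next
  case (insert p S)
  then show ?case using bilin_linear_left[of d B "f p" "x p" 1 "\<lambda>i. \<Sum>p\<in>S. f p * x p i" w] by simp
qed

lemma bilin_sum_right:
  "finite S \<Longrightarrow> bilin d B w (\<lambda>i. \<Sum>p\<in>S. f p * x p i) = (\<Sum>p\<in>S. f p * bilin d B w (x p))"
  using bilin_sum_left[of S d "\<lambda>i j. B j i" f x w] unfolding bilin_transpose[of d B] .

text \<open>Gram--Schmidt applied to the unit vectors in decreasing order.\<close>

lemma orthonormal_lower_triangular:
  assumes sym: "\<And>i j. i < d \<Longrightarrow> j < d \<Longrightarrow> B i j = B j i"
    and pos: "\<And>x. \<exists>i<d. x i \<noteq> 0 \<Longrightarrow> bilin d B x x > 0"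
  obtains T :: "nat \<Rightarrow> nat \<Rightarrow> real"
  where "\<And>p. p < d \<Longrightarrow> T p p > 0" "\<And>p q. p < q \<Longrightarrow> T p q = 0"
    "\<And>p q. p < d \<Longrightarrow> q < d \<Longrightarrow> bilin d B (\<lambda>i. T i p) (\<lambda>i. T i q) = (if p = q then 1 else 0)"
proof -
  have "\<exists>u :: nat \<Rightarrow> nat \<Rightarrow> real. (\<forall>p. d - m \<le> p \<and> p < d \<longrightarrow> u p p > 0) \<and>
      (\<forall>p i. i < p \<longrightarrow> u p i = 0) \<and>
      (\<forall>p q. d - m \<le> p \<and> p < d \<and> d - m \<le> q \<and> q < d \<longrightarrow> bilin d B (u p) (u q) = (if p = q then 1 else 0))"
    if "m \<le> d" for m
    using that
  proof (induction m)
    case 0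
    then show ?case by (intro exI[of _ "\<lambda>_ _. 0"]) auto
  next
    case (Suc m)
    then obtain u where u1: "\<And>p. d - m \<le> p \<Longrightarrow> p < d \<Longrightarrow> u p p > 0"
      and u2: "\<And>p i. i < p \<Longrightarrow> u p i = 0"
      and u3: "\<And>p q. d - m \<le> p \<Longrightarrow> p < d \<Longrightarrow> d - m \<le> q \<Longrightarrow> q < d \<Longrightarrow>
        bilin d B (u p) (u q) = (if p = q then 1 else 0)"
      by (metis Suc_leD)
    define p0 where "p0 = d - Suc m"
    have p0: "p0 < d" "Suc p0 = d - m" using Suc.prems by (auto simp: p0_def)
    let ?S = "{d - m..<d}"
    define e :: "nat \<Rightarrow> real" where "e = (\<lambda>i. if i = p0 then 1 else 0)"
    define w where "w = (\<lambda>i. \<Sum>p\<in>?S. bilin d B e (u p) * u p i)"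
    define v where "v = (\<lambda>i. 1 * e i + (-1) * w i)"
    \<comment> \<open>The earlier vectors are supported strictly above \<open>p0\<close>, so the
      correction leaves entry \<open>p0\<close> of \<open>v\<close> equal to 1. This keeps the
      system triangular and makes \<open>bilin d B v v\<close> positive.\<close>
    have w0: "w i = 0" if "i \<le> p0" for i
      unfolding w_def using that p0 by (intro sum.neutral) (auto intro!: u2)
    have vp: "v p0 = 1" "\<And>i. i < p0 \<Longrightarrow> v i = 0"
      using w0 by (auto simp: v_def e_def)
    have orth: "bilin d B v (u q) = 0" if q: "q \<in> ?S" for q
    proof -
      have "bilin d B w (u q) = (\<Sum>p\<in>?S. bilin d B e (u p) * bilin d B (u p) (u q))"
        unfolding w_def by (rule bilin_sum_left) simp
      also have "\<dots> = (\<Sum>p\<in>?S. if p = q then bilin d B e (u p) else 0)"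
        using q by (intro sum.cong) (auto simp: u3)
      also have "\<dots> = bilin d B e (u q)" using q by simp
      finally show ?thesis unfolding v_def bilin_linear_left by simp
    qed
    define c where "c = bilin d B v v"
    have c: "c > 0" unfolding c_def using vp p0 by (intro pos exI[of _ p0]) auto
    \<comment> \<open>The vacuous second summand gives the shape required by
      \<open>bilin_linear_left\<close>.\<close>
    define v' where "v' = (\<lambda>i. (1 / sqrt c) * v i + 0 * v i)"
    have v'v: "bilin d B v' y = (1 / sqrt c) * bilin d B v y" for y
      unfolding v'_def bilin_linear_left by simp
    have vv': "bilin d B x v' = bilin d B v' x" for x
      using sym by (rule bilin_commute)
    have "bilin d B v' v' = (1 / sqrt c) * ((1 / sqrt c) * c)"
      unfolding v'v[of v'] vv'[of v] v'v[of v] c_def ..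
    then have v'v': "bilin d B v' v' = 1" using c by (simp add: real_sqrt_mult_self)
    have v'u: "bilin d B v' (u q) = 0" "bilin d B (u q) v' = 0" if "q \<in> ?S" for q
      unfolding vv' v'v orth[OF that] by simp_all
    show ?case
    proof (intro exI[of _ "u(p0 := v')"] conjI allI impI)
      fix p assume "d - Suc m \<le> p \<and> p < d"
      then show "(u(p0 := v')) p p > 0"
        using u1[of p] c vp p0 by (cases "p = p0") (auto simp: v'_def)
    next
      fix p i :: nat assume "i < p"
      then show "(u(p0 := v')) p i = 0" using u2 vp by (auto simp: v'_def)
    next
      fix p q assume "d - Suc m \<le> p \<and> p < d \<and> d - Suc m \<le> q \<and> q < d"
      then have "p = p0 \<or> p \<in> ?S" "q = p0 \<or> q \<in> ?S" using p0 by (auto simp: p0_def)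
      moreover have "p0 \<notin> ?S" using p0 by auto
      ultimately show "bilin d B ((u(p0 := v')) p) ((u(p0 := v')) q) = (if p = q then 1 else 0)"
        using v'v' v'u u3 by auto
    qed
  qed
  from this[of d] obtain u where u: "\<forall>p. d - d \<le> p \<and> p < d \<longrightarrow> u p p > (0::real)" "\<forall>p i. i < p \<longrightarrow> u p i = 0"
    "\<forall>p q. d - d \<le> p \<and> p < d \<and> d - d \<le> q \<and> q < d \<longrightarrow> bilin d B (u p) (u q) = (if p = q then 1 else 0)"
    by blast
  \<comment> \<open>The vectors become the columns of \<open>T\<close>; a vector \<open>u p\<close>
    supported on indices from \<open>p\<close> on is then a column of a lower triangular
    matrix.\<close>
  show ?thesis by (rule that[of "\<lambda>i p. u p i"]) (use u in auto)
qed

section \<open>The standard Gaussian measure\<close>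

definition std_gauss :: "nat \<Rightarrow> (nat \<Rightarrow> real) measure" where
  "std_gauss d = PiM {..<d} (\<lambda>_. density lborel std_normal_density)"

interpretation gauss_prod: product_sigma_finite "\<lambda>_::nat. density lborel std_normal_density"
  unfolding product_sigma_finite_def by (intro allI prob_space_imp_sigma_finite prob_space_normal_density) simp

interpretation std_gauss: prob_space "std_gauss d" for d
  unfolding std_gauss_def by (rule prob_space_PiM) (rule prob_space_normal_density, simp)

lemma sets_std_gauss [measurable_cong, simp]: "sets (std_gauss d) = sets (Leb d)"
  unfolding std_gauss_def by (intro sets_PiM_cong) auto

lemma space_std_gauss [simp]: "space (std_gauss d) = space (Leb d)"
  by (rule sets_eq_imp_space_eq) simp

lemma measurable_Leb_component [measurable]: "p < d \<Longrightarrow> (\<lambda>x. x p) \<in> borel_measurable (Leb d)"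
  using measurable_component_singleton[of p "{..<d}" "\<lambda>_. lborel :: real measure"] by simp

lemma std_gauss_eq_density:
  "std_gauss d = density (Leb d) (\<lambda>x. ennreal (\<Prod>p<d. std_normal_density (x p)))"
proof -
  have [measurable]: "(\<lambda>x. \<Prod>p<d. std_normal_density (x p)) \<in> borel_measurable (Leb d)"
    by (intro borel_measurable_prod) measurable
  show ?thesis
    unfolding std_gauss_def
  proof (rule gauss_prod.PiM_eqI[symmetric])
    show "sets (density (Leb d) (\<lambda>x. ennreal (\<Prod>p<d. std_normal_density (x p)))) =
        sets (PiM {..<d} (\<lambda>_. density lborel std_normal_density))"
      by (simp, intro sets_PiM_cong) auto
    fix A :: "nat \<Rightarrow> real set" assume A: "\<And>i. i \<in> {..<d} \<Longrightarrow> A i \<in> sets (density lborel std_normal_density)"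
    have A' [measurable]: "Pi\<^sub>E {..<d} A \<in> sets (Leb d)"
      using A by (intro sets_PiM_I_finite) auto
    have "emeasure (density (Leb d) (\<lambda>x. ennreal (\<Prod>p<d. std_normal_density (x p)))) (Pi\<^sub>E {..<d} A)
      = (\<integral>\<^sup>+x. ennreal (\<Prod>p<d. std_normal_density (x p)) * indicator (Pi\<^sub>E {..<d} A) x \<partial>Leb d)"
      by (rule emeasure_density) measurable
    also have "\<dots> = (\<integral>\<^sup>+x. (\<Prod>p<d. ennreal (std_normal_density (x p)) * indicator (A p) (x p)) \<partial>Leb d)"
    proof (rule nn_integral_cong)
      fix x assume x: "x \<in> space (Leb d)"
      have "indicator (Pi\<^sub>E {..<d} A) x = (\<Prod>p<d. indicator (A p) (x p) :: ennreal)"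
      proof (cases "x \<in> Pi\<^sub>E {..<d} A")
        case True
        then show ?thesis by (auto simp: PiE_def Pi_def intro!: prod.neutral[symmetric])
      next
        case False
        then obtain p where "p < d" "x p \<notin> A p"
          using x by (auto simp: space_PiM PiE_def Pi_def)
        then have "(\<Prod>p<d. indicator (A p) (x p) :: ennreal) = 0"
          by (intro prod_zero bexI[of _ p]) auto
        then show ?thesis using False by simp
      qed
      then show "ennreal (\<Prod>p<d. std_normal_density (x p)) * indicator (Pi\<^sub>E {..<d} A) x =
          (\<Prod>p<d. ennreal (std_normal_density (x p)) * indicator (A p) (x p))"
        by (simp add: prod.distrib prod_ennreal)
    qed
    also have "\<dots> = (\<Prod>p<d. \<integral>\<^sup>+x. ennreal (std_normal_density x) * indicator (A p) x \<partial>lborel)"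
      using A by (intro lborel_prod.product_nn_integral_prod) (auto intro!: borel_measurable_times)
    also have "\<dots> = (\<Prod>p<d. emeasure (density lborel std_normal_density) (A p))"
      using A by (intro prod.cong refl) (subst emeasure_density, auto)
    finally show "emeasure (density (Leb d) (\<lambda>x. ennreal (\<Prod>p<d. std_normal_density (x p)))) (Pi\<^sub>E {..<d} A)
      = (\<Prod>p\<in>{..<d}. emeasure (density lborel std_normal_density) (A p))" .
  qed simp
qed

lemma prod_std_normal_density:
  "(\<Prod>p<d. std_normal_density (x p)) = exp (- (\<Sum>p<d. (x p)\<^sup>2) / 2) / sqrt (2 * pi) ^ d"
  by (simp add: std_normal_density_def prod_dividef exp_sum[symmetric] sum_negf sum_divide_distrib[symmetric])

lemma integral_std_gauss:
  fixes f :: "(nat \<Rightarrow> real) \<Rightarrow> 'a::{banach, second_countable_topology}"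
  assumes [measurable]: "f \<in> borel_measurable (Leb d)"
  shows "(\<integral>x. f x \<partial>std_gauss d) =
      (\<integral>x. (exp (- (\<Sum>p<d. (x p)\<^sup>2) / 2) / sqrt (2 * pi) ^ d) *\<^sub>R f x \<partial>Leb d)"
    and "integrable (std_gauss d) f \<longleftrightarrow>
      integrable (Leb d) (\<lambda>x. (exp (- (\<Sum>p<d. (x p)\<^sup>2) / 2) / sqrt (2 * pi) ^ d) *\<^sub>R f x)"
  unfolding std_gauss_eq_density prod_std_normal_density
  by (intro integral_density integrable_density; (measurable | simp))+

text \<open>Reflection is the triangular substitution with matrix \<open>- I\<close>, whose Jacobian
  is 1. It serves to remove the odd part of the integrand.\<close>

lemma integral_std_gauss_uminus:
  fixes f :: "(nat \<Rightarrow> real) \<Rightarrow> 'a::{banach, second_countable_topology}"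
  assumes [measurable]: "f \<in> borel_measurable (Leb d)"
  shows "(\<integral>x. f x \<partial>std_gauss d) = (\<integral>x. f (\<lambda>p\<in>{..<d}. - x p) \<partial>std_gauss d)"
proof -
  define T where "T = (\<lambda>p q :: nat. if p = q then -1 else (0::real))"
  have T: "lower_tri d T x = (\<lambda>p\<in>{..<d}. - x p)" for x
    by (auto simp: lower_tri_def T_def fun_eq_iff restrict_def if_distrib[of "\<lambda>u. u * _"] cong: if_cong)
  have [measurable]: "(\<lambda>x. f (\<lambda>p\<in>{..<d}. - x p)) \<in> borel_measurable (Leb d)"
    unfolding T[symmetric] by measurable
  have "(\<integral>x. f x \<partial>std_gauss d) =
      (\<integral>x. (exp (- (\<Sum>p<d. (x p)\<^sup>2) / 2) / sqrt (2 * pi) ^ d) *\<^sub>R f x \<partial>Leb d)"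
    by (rule integral_std_gauss) measurable
  also have "\<dots> = (\<Prod>p<d. \<bar>T p p\<bar>) *\<^sub>R
      (\<integral>x. (exp (- (\<Sum>p<d. (lower_tri d T x p)\<^sup>2) / 2) / sqrt (2 * pi) ^ d) *\<^sub>R f (lower_tri d T x) \<partial>Leb d)"
    by (rule integral_lower_tri(1)) (auto simp: T_def)
  also have "\<dots> = (\<integral>x. (exp (- (\<Sum>p<d. (x p)\<^sup>2) / 2) / sqrt (2 * pi) ^ d) *\<^sub>R f (\<lambda>p\<in>{..<d}. - x p) \<partial>Leb d)"
    unfolding T by (simp add: T_def)
  also have "\<dots> = (\<integral>x. f (\<lambda>p\<in>{..<d}. - x p) \<partial>std_gauss d)"
    by (rule integral_std_gauss(1)[symmetric]) measurable
  finally show ?thesis .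
qed

lemma std_gauss_component_distributed:
  assumes "p < d"
  shows "distributed (std_gauss d) lborel (\<lambda>x. x p) std_normal_density"
  unfolding distributed_def
proof (intro conjI)
  have "distr (std_gauss d) (density lborel std_normal_density) (\<lambda>x. x p) = density lborel std_normal_density"
    unfolding std_gauss_def using assms by (intro distr_PiM_component prob_space_normal_density) auto
  moreover have "distr (std_gauss d) (density lborel std_normal_density) (\<lambda>x. x p) = distr (std_gauss d) lborel (\<lambda>x. x p)"
    by (rule distr_cong) auto
  ultimately show "distr (std_gauss d) lborel (\<lambda>x. x p) = density lborel std_normal_density" by simp
  show "(\<lambda>x. x p) \<in> std_gauss d \<rightarrow>\<^sub>M lborel"
    using measurable_Leb_component[OF assms] by simp
qed simp

lemma std_gauss_indep_components:
  assumes "0 < d"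
  shows "std_gauss.indep_vars d (\<lambda>_. borel) (\<lambda>p x. x p) {..<d}"
proof (subst std_gauss.indep_vars_iff_distr_eq_PiM')
  show "{..<d} \<noteq> {}" using assms by auto
  show "(\<lambda>x. x i) \<in> std_gauss d \<rightarrow>\<^sub>M borel" if "i \<in> {..<d}" for i
    using measurable_Leb_component[of i d] that by simp
  have comp: "distr (std_gauss d) borel (\<lambda>x. x i) = density lborel std_normal_density" if "i < d" for i
  proof -
    have "distr (std_gauss d) borel (\<lambda>x. x i) = distr (std_gauss d) lborel (\<lambda>x. x i)"
      by (rule distr_cong) auto
    then show ?thesis using std_gauss_component_distributed[OF that] by (simp add: distributed_def)
  qed
  have "distr (std_gauss d) (PiM {..<d} (\<lambda>_. borel)) (\<lambda>x. \<lambda>i\<in>{..<d}. x i) = distr (std_gauss d) (std_gauss d) (\<lambda>x. x)"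
  proof (rule distr_cong)
    show "sets (PiM {..<d} (\<lambda>_. borel)) = sets (std_gauss d)"
      unfolding std_gauss_def by (intro sets_PiM_cong) auto
    fix x assume "x \<in> space (std_gauss d)"
    then show "(\<lambda>i\<in>{..<d}. x i) = x" by (auto simp: space_PiM PiE_def extensional_restrict)
  qed simp
  also have "\<dots> = PiM {..<d} (\<lambda>i. distr (std_gauss d) borel (\<lambda>x. x i))"
    unfolding std_gauss_def[of d, symmetric] distr_id2
    by (simp add: std_gauss_def, intro PiM_cong refl) (simp add: comp[unfolded std_gauss_def])
  finally show "distr (std_gauss d) (PiM {..<d} (\<lambda>_. borel)) (\<lambda>x. \<lambda>i\<in>{..<d}. x i) =
      PiM {..<d} (\<lambda>i. distr (std_gauss d) borel (\<lambda>x. x i))" .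
qed

section \<open>Moments of linear forms under the Gaussian measure\<close>

definition lin :: "nat \<Rightarrow> (nat \<Rightarrow> real) \<Rightarrow> (nat \<Rightarrow> real) \<Rightarrow> real" where
  "lin d a x = (\<Sum>p<d. a p * x p)"

lemma measurable_lin [measurable]: "lin d a \<in> borel_measurable (Leb d)"
  unfolding lin_def by measurable

lemma lin_commute: "lin d a b = lin d b a"
  by (simp add: lin_def mult.commute)

lemma lin_self: "lin d a a = (\<Sum>p<d. (a p)\<^sup>2)"
  by (simp add: lin_def power2_eq_square)

lemma lin_self_nonneg: "0 \<le> lin d a a"
  by (simp add: lin_self sum_nonneg)

lemma std_gauss_lin_distributed:
  assumes "lin d a a \<noteq> 0"
  shows "distributed (std_gauss d) lborel (lin d a) (normal_density 0 (sqrt (lin d a a)))"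
proof -
  \<comment> \<open>Zero coefficients are left out because the summands of an independent normal sum
    must have positive variance.\<close>
  let ?I = "{p\<in>{..<d}. a p \<noteq> 0}"
  have ne: "?I \<noteq> {}" and d: "0 < d"
    using assms by (auto simp: lin_self intro: ccontr)
  have "std_gauss.indep_vars d (\<lambda>_. borel) (\<lambda>p x. (\<lambda>y. a p * y) (x p)) {..<d}"
    by (intro std_gauss.indep_vars_compose2[OF std_gauss_indep_components[OF d]]) auto
  then have indep: "std_gauss.indep_vars d (\<lambda>_. borel) (\<lambda>p x. a p * x p) ?I"
    by (rule std_gauss.indep_vars_subset) auto
  have dist: "distributed (std_gauss d) lborel (\<lambda>x. a p * x p) (normal_density 0 \<bar>a p\<bar>)" if "p \<in> ?I" for p
    using std_gauss.normal_density_affine[OF std_gauss_component_distributed, of p d "a p" 0] that by simp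
  have "distributed (std_gauss d) lborel (\<lambda>x. \<Sum>p\<in>?I. a p * x p) (normal_density (\<Sum>p\<in>?I. 0) (sqrt (\<Sum>p\<in>?I. \<bar>a p\<bar>\<^sup>2)))"
    by (rule std_gauss.sum_indep_normal) (use ne indep dist in auto)
  also have "(\<lambda>x. \<Sum>p\<in>?I. a p * x p) = lin d a"
    unfolding lin_def fun_eq_iff by (intro allI sum.mono_neutral_left) auto
  also have "(\<Sum>p\<in>?I. \<bar>a p\<bar>\<^sup>2) = lin d a a"
    unfolding lin_self power2_abs by (intro sum.mono_neutral_left) auto
  finally show ?thesis by simp
qed

lemma std_gauss_lin_moment:
  shows "integrable (std_gauss d) (\<lambda>x. lin d a x ^ k)"
    and "(\<integral>x. lin d a x ^ (2 * m) \<partial>std_gauss d) = fact (2 * m) / (2 ^ m * fact m) * lin d a a ^ m"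
proof -
  have "integrable (std_gauss d) (\<lambda>x. lin d a x ^ k) \<and>
    (\<integral>x. lin d a x ^ (2 * m) \<partial>std_gauss d) = fact (2 * m) / (2 ^ m * fact m) * lin d a a ^ m"
  proof (cases "lin d a a = 0")
    \<comment> \<open>A form of variance 0 vanishes identically; with \<open>0 ^ 0 = 1\<close> the
      moment formula also holds for \<open>m = 0\<close>.\<close>
    case True
    then have "a p = 0" if "p < d" for p
      using that by (auto simp: lin_self sum_nonneg_eq_0_iff)
    then have "lin d a x = 0" for x by (simp add: lin_def)
    then show ?thesis using std_gauss.prob_space[of d] by (cases m) simp_all
  next
    case False
    let ?s = "sqrt (lin d a a)"
    have s: "?s > 0" using False lin_self_nonneg[of d a] by simp
    note dist = std_gauss_lin_distributed[OF False]
    have "integrable lborel (\<lambda>x. normal_density 0 ?s x * x ^ k)"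
      using integrable_normal_moment[OF s, of 0 k] by simp
    then have "integrable (std_gauss d) (\<lambda>x. lin d a x ^ k)"
      using distributed_integrable[OF dist, of "\<lambda>x. x ^ k"] by simp
    moreover have "(\<integral>x. lin d a x ^ (2 * m) \<partial>std_gauss d) = (\<integral>x. normal_density 0 ?s x * x ^ (2 * m) \<partial>lborel)"
      by (rule distributed_integral[OF dist, symmetric]) auto
    moreover have "\<dots> = fact (2 * m) / ((2 / ?s\<^sup>2) ^ m * fact m)"
      using integral_normal_moment_even[OF s, of 0 m] by simp
    moreover have "\<dots> = fact (2 * m) / (2 ^ m * fact m) * lin d a a ^ m"
      using s by (simp add: power_divide field_simps)
    ultimately show ?thesis by simp
  qed
  then show "integrable (std_gauss d) (\<lambda>x. lin d a x ^ k)"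
    "(\<integral>x. lin d a x ^ (2 * m) \<partial>std_gauss d) = fact (2 * m) / (2 ^ m * fact m) * lin d a a ^ m"
    by blast+
qed

lemma lin_add_scale: "lin d (\<lambda>p. a p + c * b p) x = lin d a x + c * lin d b x"
  unfolding lin_def sum_distrib_left sum.distrib[symmetric]
  by (intro sum.cong refl) (simp add: algebra_simps)

lemma std_gauss_lin4: "(\<integral>x. lin d a x ^ 4 \<partial>std_gauss d) = 3 * (lin d a a)\<^sup>2"
  using std_gauss_lin_moment(2)[of d a 2] by (simp add: fact_numeral)

lemma std_gauss_lin6: "(\<integral>x. lin d a x ^ 6 \<partial>std_gauss d) = 15 * lin d a a ^ 3"
  using std_gauss_lin_moment(2)[of d a 3] by (simp add: fact_numeral)

text \<open>Polarization of the sixth moment: \<open>f t\<close> is the polynomial \<open>E (U + t V)\<^sup>6\<close>, and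
  \<open>20 E (U\<^sup>3 V\<^sup>3)\<close> is its cubic coefficient.\<close>

lemma std_gauss_lin_cube_cube:
  shows "integrable (std_gauss d) (\<lambda>x. lin d a x ^ 3 * lin d b x ^ 3)"
    and "(\<integral>x. lin d a x ^ 3 * lin d b x ^ 3 \<partial>std_gauss d) =
      9 * lin d a a * lin d b b * lin d a b + 6 * lin d a b ^ 3"
proof -
  define f where "f = (\<lambda>t x. (lin d a x + t * lin d b x) ^ 6)"
  have f: "integrable (std_gauss d) (f t)"
    "(\<integral>x. f t x \<partial>std_gauss d) = 15 * (lin d a a + 2 * t * lin d a b + t\<^sup>2 * lin d b b) ^ 3" for t
  proof -
    let ?c = "\<lambda>p. a p + t * b p"
    have "f t = (\<lambda>x. lin d ?c x ^ 6)" by (simp add: f_def lin_add_scale)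
    moreover have "lin d ?c ?c = lin d a a + 2 * t * lin d a b + t\<^sup>2 * lin d b b"
      unfolding lin_add_scale lin_commute[of d a ?c] lin_commute[of d b ?c] lin_commute[of d b a]
      by (simp add: power2_eq_square algebra_simps)
    ultimately show "integrable (std_gauss d) (f t)"
      "(\<integral>x. f t x \<partial>std_gauss d) = 15 * (lin d a a + 2 * t * lin d a b + t\<^sup>2 * lin d b b) ^ 3"
      using std_gauss_lin_moment(1)[of d ?c 6] std_gauss_lin6[of d ?c] by simp_all
  qed
  \<comment> \<open>The difference of the sixth powers at \<open>t\<close> and \<open>- t\<close>
    contains only \<open>t\<close>, \<open>t ^ 3\<close> and \<open>t ^ 5\<close>. The weights 8,
    -13, -1 at \<open>t\<close> = 2, 1, 3 cancel the first and the last and leave 24 times the cubic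
    term 40 \<open>u ^ 3 * v ^ 3\<close>, that is, 960.\<close>
  have ring: "960 * (u ^ 3 * v ^ 3) = 8 * ((u + 2 * v) ^ 6 - (u - 2 * v) ^ 6)
      - 13 * ((u + v) ^ 6 - (u - v) ^ 6) - ((u + 3 * v) ^ 6 - (u - 3 * v) ^ 6)" for u v :: real
    by (simp add: eval_nat_numeral algebra_simps)
  have ring': "(8 * (15 * (A + 4 * B + 4 * C) ^ 3 - 15 * (A - 4 * B + 4 * C) ^ 3)
      - 13 * (15 * (A + 2 * B + C) ^ 3 - 15 * (A - 2 * B + C) ^ 3)
      - (15 * (A + 6 * B + 9 * C) ^ 3 - 15 * (A - 6 * B + 9 * C) ^ 3)) / 960 = 9 * A * C * B + 6 * B ^ 3"
    for A B C :: real
    by (simp add: eval_nat_numeral algebra_simps)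
  have eq: "lin d a x ^ 3 * lin d b x ^ 3 = (8 * (f 2 x - f (-2) x) - 13 * (f 1 x - f (-1) x)
      - (f 3 x - f (-3) x)) / 960" for x
    using ring[of "lin d a x" "lin d b x"] by (simp add: f_def)
  show "integrable (std_gauss d) (\<lambda>x. lin d a x ^ 3 * lin d b x ^ 3)"
    unfolding eq using f(1) by (intro integrable_divide integrable_mult_right Bochner_Integration.integrable_diff)
  have "(\<integral>x. lin d a x ^ 3 * lin d b x ^ 3 \<partial>std_gauss d) =
      (8 * ((\<integral>x. f 2 x \<partial>std_gauss d) - (\<integral>x. f (-2) x \<partial>std_gauss d))
       - 13 * ((\<integral>x. f 1 x \<partial>std_gauss d) - (\<integral>x. f (-1) x \<partial>std_gauss d))
       - ((\<integral>x. f 3 x \<partial>std_gauss d) - (\<integral>x. f (-3) x \<partial>std_gauss d))) / 960"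
    unfolding eq using f(1) by (simp add: Bochner_Integration.integral_diff)
  also have "\<dots> = 9 * lin d a a * lin d b b * lin d a b + 6 * lin d a b ^ 3"
    unfolding f(2) using ring'[of "lin d a a" "lin d a b" "lin d b b"] by simp
  finally show "(\<integral>x. lin d a x ^ 3 * lin d b x ^ 3 \<partial>std_gauss d) =
      9 * lin d a a * lin d b b * lin d a b + 6 * lin d a b ^ 3" .
qed

section \<open>Bernoulli characteristic functions\<close>

text \<open>The characteristic function of a centred Bernoulli variable. Centring removes the linear
  term of the exponent, so that no oscillating factor is left in the Gaussian comparison.\<close>

definition bern_char :: "real \<Rightarrow> real \<Rightarrow> complex" where
  "bern_char \<zeta> \<theta> = of_real (1 - \<zeta>) * iexp (- \<zeta> * \<theta>) + of_real \<zeta> * iexp ((1 - \<zeta>) * \<theta>)"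

lemma bern_char_eq: "bern_char \<zeta> \<theta> = (of_real (1 - \<zeta>) + of_real \<zeta> * iexp \<theta>) * iexp (- \<zeta> * \<theta>)"
proof -
  have "iexp ((1 - \<zeta>) * \<theta>) = iexp \<theta> * iexp (- \<zeta> * \<theta>)"
    by (simp add: exp_add[symmetric] algebra_simps)
  then show ?thesis by (simp add: bern_char_def distrib_right mult.assoc)
qed

text \<open>The squared modulus is exactly \<open>1 - 4 * (\<zeta> - \<zeta>\<^sup>2) * (sin
  (\<theta> / 2))\<^sup>2\<close>, and \<open>1 - x \<le> exp (- x)\<close>. The bound keeps the
  period 2\<pi> of the modulus and is therefore useful on the whole torus.\<close>

lemma norm_bern_char_le:
  assumes "0 \<le> \<zeta>" "\<zeta> \<le> 1"
  shows "norm (bern_char \<zeta> \<theta>) \<le> exp (- 2 * (\<zeta> - \<zeta>\<^sup>2) * (sin (\<theta> / 2))\<^sup>2)"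
proof -
  let ?x = "4 * (\<zeta> - \<zeta>\<^sup>2) * (sin (\<theta> / 2))\<^sup>2"
  have c: "cos \<theta> = 1 - 2 * (sin (\<theta> / 2))\<^sup>2" using cos_double_sin[of "\<theta> / 2"] by simp
  have expand: "(1 - \<zeta> + \<zeta> * a)\<^sup>2 + (\<zeta> * b)\<^sup>2 = (1 - \<zeta>)\<^sup>2 + 2 * (1 - \<zeta>) * \<zeta> * a + \<zeta>\<^sup>2 * (a\<^sup>2 + b\<^sup>2)"
    for a b :: real
    by (simp add: power2_eq_square algebra_simps)
  have "norm (bern_char \<zeta> \<theta>) = norm (of_real (1 - \<zeta>) + of_real \<zeta> * iexp \<theta>)"
    unfolding bern_char_eq norm_mult by (simp add: norm_exp_eq_Re)
  also have "\<dots> ^ 2 = (1 - \<zeta> + \<zeta> * cos \<theta>)\<^sup>2 + (\<zeta> * sin \<theta>)\<^sup>2"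
    by (simp add: cmod_power2 cis_conv_exp[symmetric])
  also have "\<dots> = (1 - \<zeta>)\<^sup>2 + 2 * (1 - \<zeta>) * \<zeta> * cos \<theta> + \<zeta>\<^sup>2 * ((cos \<theta>)\<^sup>2 + (sin \<theta>)\<^sup>2)"
    by (rule expand)
  also have "(cos \<theta>)\<^sup>2 + (sin \<theta>)\<^sup>2 = 1" by simp
  also have "(1 - \<zeta>)\<^sup>2 + 2 * (1 - \<zeta>) * \<zeta> * cos \<theta> + \<zeta>\<^sup>2 * 1 = 1 - ?x"
    unfolding c by (simp add: power2_eq_square algebra_simps)
  also have "\<dots> \<le> exp (- ?x)" using exp_ge_add_one_self[of "- ?x"] by simp
  also have "exp (- ?x) = (exp (- 2 * (\<zeta> - \<zeta>\<^sup>2) * (sin (\<theta> / 2))\<^sup>2))\<^sup>2"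
    by (simp add: exp_double[symmetric] algebra_simps)
  finally show ?thesis by (rule power2_le_imp_le) simp
qed

text \<open>The centred variable has the moments 0, \<open>s\<close> and
  \<open>s * (1 - 2 * \<zeta>)\<close>, which give the exponent up to third order. The error
  consists of the Taylor remainder \<open>\<theta> ^ 4 / 24\<close> and the quadratic error of the
  logarithm; since there is no linear term, \<open>w\<close> is of order
  \<open>\<theta>\<^sup>2\<close> and this second error is at most
  \<open>\<theta> ^ 4 / 2\<close>.\<close>

lemma bern_char_expansion:
  assumes z: "0 \<le> \<zeta>" "\<zeta> \<le> 1" and t: "\<bar>\<theta>\<bar> \<le> 1"
  defines "s \<equiv> \<zeta> - \<zeta>\<^sup>2"
  shows "\<exists>\<rho>. bern_char \<zeta> \<theta> = exp (of_real (- s / 2 * \<theta>\<^sup>2) - \<i> * of_real (s * (1 - 2 * \<zeta>) / 6 * \<theta> ^ 3) + \<rho>) \<and>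
    norm \<rho> \<le> \<theta> ^ 4"
proof -
  let ?a = "- \<zeta> * \<theta>" and ?b = "(1 - \<zeta>) * \<theta>"
  define w where "w = bern_char \<zeta> \<theta> - 1"
  define R where "R = w - of_real (- s / 2 * \<theta>\<^sup>2) + \<i> * of_real (s * (1 - 2 * \<zeta>) / 6 * \<theta> ^ 3)"
  have a: "\<bar>?a\<bar> \<le> \<bar>\<theta>\<bar>" "\<bar>?b\<bar> \<le> \<bar>\<theta>\<bar>"
    using z mult_left_le_one_le[of "\<bar>\<theta>\<bar>" "\<zeta>"] mult_left_le_one_le[of "\<bar>\<theta>\<bar>" "1 - \<zeta>"]
    by (auto simp: abs_mult)
  have conv: "norm (of_real (1 - \<zeta>) * A + of_real \<zeta> * B) \<le> M"
    if "norm A \<le> M" "norm B \<le> M" for A B :: complex and M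
  proof -
    have "norm (of_real (1 - \<zeta>) * A + of_real \<zeta> * B) \<le> (1 - \<zeta>) * norm A + \<zeta> * norm B"
      using z by (intro norm_triangle_le) (simp add: norm_mult del: of_real_diff)
    also have "\<dots> \<le> (1 - \<zeta>) * M + \<zeta> * M"
      using z that by (intro add_mono mult_left_mono) auto
    finally show ?thesis by (simp add: algebra_simps)
  qed
  have s1: "(\<Sum>k\<le>1. (\<i> * complex_of_real y) ^ k / fact k) = 1 + \<i> * of_real y" for y
    by (simp only: One_nat_def sum.atMost_Suc) simp
  have "w = of_real (1 - \<zeta>) * (iexp ?a - (\<Sum>k\<le>1. (\<i> * ?a) ^ k / fact k)) +
      of_real \<zeta> * (iexp ?b - (\<Sum>k\<le>1. (\<i> * ?b) ^ k / fact k))"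
    unfolding s1 by (simp add: w_def bern_char_def algebra_simps)
  also have "norm \<dots> \<le> \<theta>\<^sup>2 / 2"
  proof (rule conv)
    have "\<bar>y\<bar> ^ 2 / 2 \<le> \<theta>\<^sup>2 / 2" if "\<bar>y\<bar> \<le> \<bar>\<theta>\<bar>" for y :: real
      using power_mono[OF that, of 2] by simp
    then have "norm (iexp y - (\<Sum>k\<le>1. (\<i> * y) ^ k / fact k)) \<le> \<theta>\<^sup>2 / 2" if "\<bar>y\<bar> \<le> \<bar>\<theta>\<bar>" for y :: real
      using that iexp_approx1[of y 1] by (fastforce simp: numeral_2_eq_2)
    then show "norm (iexp ?a - (\<Sum>k\<le>1. (\<i> * ?a) ^ k / fact k)) \<le> \<theta>\<^sup>2 / 2"
      "norm (iexp ?b - (\<Sum>k\<le>1. (\<i> * ?b) ^ k / fact k)) \<le> \<theta>\<^sup>2 / 2"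
      using a by blast+
  qed
  finally have w: "norm w \<le> \<theta>\<^sup>2 / 2" .
  have R_eq: "R = of_real (1 - \<zeta>) * (iexp ?a - (\<Sum>k\<le>3. (\<i> * ?a) ^ k / fact k)) +
      of_real \<zeta> * (iexp ?b - (\<Sum>k\<le>3. (\<i> * ?b) ^ k / fact k))"
  proof -
    have i3: "\<i> ^ 3 = - \<i>" by (simp add: power3_eq_cube)
    have 1: "(\<Sum>k\<le>3. (\<i> * complex_of_real y) ^ k / fact k) =
        1 + \<i> * of_real y - of_real (y\<^sup>2 / 2) - \<i> * of_real (y ^ 3 / 6)" for y
      by (simp add: eval_nat_numeral field_simps)
    have lincomb: "of_real (1 - \<zeta>) * (1 + \<i> * of_real y - of_real (y\<^sup>2 / 2) - \<i> * of_real (y ^ 3 / 6)) +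
        of_real \<zeta> * (1 + \<i> * of_real y' - of_real (y'\<^sup>2 / 2) - \<i> * of_real (y' ^ 3 / 6)) =
        1 + \<i> * of_real ((1 - \<zeta>) * y + \<zeta> * y') - of_real (((1 - \<zeta>) * y\<^sup>2 + \<zeta> * y'\<^sup>2) / 2)
          - \<i> * of_real (((1 - \<zeta>) * y ^ 3 + \<zeta> * y' ^ 3) / 6)" for y y'
      by (simp add: complex_eq_iff field_simps)
    have 2: "(1 - \<zeta>) * ?a + \<zeta> * ?b = 0" "(1 - \<zeta>) * ?a\<^sup>2 + \<zeta> * ?b\<^sup>2 = s * \<theta>\<^sup>2"
      "(1 - \<zeta>) * ?a ^ 3 + \<zeta> * ?b ^ 3 = s * (1 - 2 * \<zeta>) * \<theta> ^ 3"
      by (simp_all add: s_def eval_nat_numeral algebra_simps)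
    have "of_real (1 - \<zeta>) * (\<Sum>k\<le>3. (\<i> * complex_of_real ?a) ^ k / fact k) + of_real \<zeta> * (\<Sum>k\<le>3. (\<i> * complex_of_real ?b) ^ k / fact k)
        = 1 + \<i> * of_real ((1 - \<zeta>) * ?a + \<zeta> * ?b) - of_real (((1 - \<zeta>) * ?a\<^sup>2 + \<zeta> * ?b\<^sup>2) / 2)
          - \<i> * of_real (((1 - \<zeta>) * ?a ^ 3 + \<zeta> * ?b ^ 3) / 6)"
      unfolding 1 by (rule lincomb)
    then show ?thesis
      unfolding 2 by (simp add: R_def w_def bern_char_def algebra_simps)
  qed
  have R: "norm R \<le> \<theta> ^ 4 / 24"
    unfolding R_eq
  proof (rule conv)
    have "\<bar>y\<bar> ^ 4 / 24 \<le> \<theta> ^ 4 / 24" if "\<bar>y\<bar> \<le> \<bar>\<theta>\<bar>" for y :: real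
      using power_mono[OF that, of 4] by simp
    moreover have "norm (iexp y - (\<Sum>k\<le>3. (\<i> * y) ^ k / fact k)) \<le> \<bar>y\<bar> ^ 4 / 24" for y :: real
      using iexp_approx1[of y 3] by (simp add: fact_numeral)
    ultimately have "norm (iexp y - (\<Sum>k\<le>3. (\<i> * y) ^ k / fact k)) \<le> \<theta> ^ 4 / 24" if "\<bar>y\<bar> \<le> \<bar>\<theta>\<bar>" for y :: real
      using that order_trans by blast
    then show "norm (iexp ?a - (\<Sum>k\<le>3. (\<i> * ?a) ^ k / fact k)) \<le> \<theta> ^ 4 / 24"
      "norm (iexp ?b - (\<Sum>k\<le>3. (\<i> * ?b) ^ k / fact k)) \<le> \<theta> ^ 4 / 24"
      using a by blast+
  qed
  have t2: "\<theta>\<^sup>2 \<le> 1" using t by (simp add: abs_square_le_1)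
  then have w1: "norm w \<le> 1 / 2" using w by simp
  have w0: "1 + w \<noteq> 0"
  proof
    assume "1 + w = 0"
    then have "w = - 1" by (simp add: eq_neg_iff_add_eq_0 add.commute)
    then show False using w1 by simp
  qed
  have "norm (ln (1 + w) - w) \<le> (norm w)\<^sup>2 / (1 - norm w)"
    using w1 by (intro Ln_approx_linear) simp
  also have "\<dots> \<le> (\<theta>\<^sup>2 / 2)\<^sup>2 / (1 / 2)"
    using w w1 by (intro frac_le power_mono) auto
  also have "\<dots> = \<theta> ^ 4 / 2" by (simp add: power_divide power_mult[symmetric])
  finally have ln: "norm (ln (1 + w) - w) \<le> \<theta> ^ 4 / 2" .
  show ?thesis
  proof (intro exI[of _ "ln (1 + w) - w + R"] conjI)
    have "of_real (- s / 2 * \<theta>\<^sup>2) - \<i> * of_real (s * (1 - 2 * \<zeta>) / 6 * \<theta> ^ 3) + (ln (1 + w) - w + R) = ln (1 + w)"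
      by (simp add: R_def)
    then show "bern_char \<zeta> \<theta> = exp (of_real (- s / 2 * \<theta>\<^sup>2) - \<i> * of_real (s * (1 - 2 * \<zeta>) / 6 * \<theta> ^ 3) + (ln (1 + w) - w + R))"
      using w0 by (simp only: exp_Ln) (simp add: w_def)
    have "norm (ln (1 + w) - w + R) \<le> \<theta> ^ 4 / 2 + \<theta> ^ 4 / 24"
      using ln R by (rule norm_triangle_mono)
    also have "\<dots> \<le> \<theta> ^ 4" by simp
    finally show "norm (ln (1 + w) - w + R) \<le> \<theta> ^ 4" .
  qed
qed

section \<open>Gaussian estimates near the origin\<close>

lemma lin_sum_left:
  "finite S \<Longrightarrow> lin d (\<lambda>p. \<Sum>i\<in>S. w i * a i p) x = (\<Sum>i\<in>S. w i * lin d (a i) x)"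
  unfolding lin_def sum_distrib_left sum_distrib_right
  by (subst sum.swap) (intro sum.cong refl, simp add: mult.assoc)

text \<open>The setting near the origin, in coordinates where the quadratic form is the squared
  length. The variance of the \<open>j\<close>-th form is \<open>lin d (al j) (al j)\<close>;
  \<open>bessel\<close> controls all forms together, \<open>single\<close> each one alone. In the
  application \<open>\<kappa>\<close> is of order \<open>k / n\<close>.\<close>

locale gaussian_forms =
  fixes d n :: nat and al :: "nat \<Rightarrow> nat \<Rightarrow> real" and \<zeta> :: "nat \<Rightarrow> real" and r \<kappa> :: real
  assumes r: "0 < r" and \<kappa>: "0 \<le> \<kappa>"
    and \<zeta>: "\<And>j. j < n \<Longrightarrow> 0 \<le> \<zeta> j" "\<And>j. j < n \<Longrightarrow> \<zeta> j \<le> 1"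
    and r_le: "\<And>j. j < n \<Longrightarrow> r \<le> \<zeta> j - (\<zeta> j)\<^sup>2"
    and bessel: "\<And>x. (\<Sum>j<n. (\<zeta> j - (\<zeta> j)\<^sup>2) * (lin d (al j) x)\<^sup>2) \<le> lin d x x"
    and single: "\<And>j x. j < n \<Longrightarrow> (lin d (al j) x)\<^sup>2 \<le> \<kappa> * lin d x x"
begin

abbreviation s :: "nat \<Rightarrow> real" where "s j \<equiv> \<zeta> j - (\<zeta> j)\<^sup>2"
abbreviation V :: "nat \<Rightarrow> (nat \<Rightarrow> real) \<Rightarrow> real" where "V j \<equiv> lin d (al j)"

lemma s_pos: "j < n \<Longrightarrow> 0 < s j"
  using r r_le by force

lemma s_le: "s j \<le> 1 / 4"
proof -
  have "0 \<le> (\<zeta> j - 1 / 2)\<^sup>2" by simp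
  then show ?thesis by (simp add: power2_eq_square algebra_simps)
qed

text \<open>Taking \<open>x = al j\<close> in \<open>single\<close> gives
  \<open>?a\<^sup>2 \<le> \<kappa> * ?a\<close> for the variance \<open>?a\<close>.\<close>

lemma lin_al_le: "j < n \<Longrightarrow> lin d (al j) (al j) \<le> \<kappa>"
proof -
  assume j: "j < n"
  let ?a = "lin d (al j) (al j)"
  show "?a \<le> \<kappa>"
  proof (cases "?a = 0")
    case False
    then have "0 < ?a" using lin_self_nonneg[of d "al j"] by simp
    moreover have "?a * ?a \<le> \<kappa> * ?a" using single[OF j, of "al j"] by (simp add: power2_eq_square)
    ultimately show ?thesis by simp
  qed (use \<kappa> in simp)
qed

lemma abs_lin_al_le: "i < n \<Longrightarrow> j < n \<Longrightarrow> \<bar>lin d (al i) (al j)\<bar> \<le> \<kappa>"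
proof -
  assume ij: "i < n" "j < n"
  have "(lin d (al i) (al j))\<^sup>2 \<le> \<kappa> * lin d (al j) (al j)" by (rule single) fact
  also have "\<dots> \<le> \<kappa> * \<kappa>" using lin_al_le[OF ij(2)] \<kappa> by (rule mult_left_mono)
  finally show ?thesis using \<kappa> by (metis abs_le_square_iff abs_of_nonneg power2_eq_square)
qed

lemma sum_lin_sq_le: "(\<Sum>j<n. (V j x)\<^sup>2) \<le> lin d x x / r"
proof -
  have "r * (\<Sum>j<n. (V j x)\<^sup>2) \<le> (\<Sum>j<n. s j * (V j x)\<^sup>2)"
    unfolding sum_distrib_left by (intro sum_mono mult_right_mono r_le) auto
  then show ?thesis using bessel[of x] r by (simp add: field_simps)
qed

text \<open>The dual of the Bessel inequality. Expanding one of the two factors of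
  \<open>lin d v v\<close> and applying Young's inequality to each term produces, by
  \<open>bessel\<close>, half of \<open>lin d v v\<close> again, which is absorbed on the
  left.\<close>

lemma lin_combination_le:
  assumes "\<And>j. j < n \<Longrightarrow> \<bar>w j\<bar> \<le> \<kappa>"
  defines "v \<equiv> (\<lambda>p. \<Sum>j<n. w j * al j p)"
  shows "lin d v v \<le> n * \<kappa>\<^sup>2 / r"
proof -
  have young: "w j * V j v \<le> (\<kappa>\<^sup>2 / r) / 2 + s j * (V j v)\<^sup>2 / 2" if j: "j < n" for j
  proof -
    have "0 \<le> (w j / sqrt (s j) - sqrt (s j) * V j v)\<^sup>2" by simp
    also have "\<dots> = (w j)\<^sup>2 / s j - 2 * (w j * V j v) + s j * (V j v)\<^sup>2"
      using s_pos[OF j] by (simp add: power2_diff power_divide power_mult_distrib less_imp_le)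
    finally have "2 * (w j * V j v) \<le> (w j)\<^sup>2 / s j + s j * (V j v)\<^sup>2" by simp
    moreover have "(w j)\<^sup>2 / s j \<le> \<kappa>\<^sup>2 / r"
      using assms(1)[OF j] \<kappa> r r_le[OF j] by (intro frac_le) (auto simp: abs_le_square_iff[symmetric])
    ultimately show ?thesis by simp
  qed
  have "lin d v v = (\<Sum>j<n. w j * V j v)"
    unfolding v_def by (rule lin_sum_left) simp
  also have "\<dots> \<le> (\<Sum>j<n. (\<kappa>\<^sup>2 / r) / 2 + s j * (V j v)\<^sup>2 / 2)"
    using young by (intro sum_mono) auto
  also have "\<dots> = n * (\<kappa>\<^sup>2 / r) / 2 + (\<Sum>j<n. s j * (V j v)\<^sup>2) / 2"
    by (simp add: sum.distrib sum_divide_distrib)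
  also have "\<dots> \<le> n * (\<kappa>\<^sup>2 / r) / 2 + lin d v v / 2"
    using bessel[of v] by simp
  finally have "lin d v v \<le> n * (\<kappa>\<^sup>2 / r) / 2 + lin d v v / 2" .
  moreover have "a \<le> X" if "a \<le> X / 2 + a / 2" for a X :: real using that by simp
  ultimately have "lin d v v \<le> n * (\<kappa>\<^sup>2 / r)" by blast
  then show ?thesis by simp
qed

definition quartic :: "(nat \<Rightarrow> real) \<Rightarrow> real" where
  "quartic x = (\<Sum>j<n. V j x ^ 4)"

text \<open>The coefficients are minus one sixth of the third cumulants of the Bernoulli variables;
  the sign comes from \<open>\<i> ^ 3 = - \<i>\<close>.\<close>

definition cubic :: "(nat \<Rightarrow> real) \<Rightarrow> real" where
  "cubic x = (\<Sum>j<n. - (s j * (1 - 2 * \<zeta> j) / 6) * V j x ^ 3)"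

lemma measurable_quartic [measurable]: "quartic \<in> borel_measurable (Leb d)"
  unfolding quartic_def by measurable

lemma measurable_cubic [measurable]: "cubic \<in> borel_measurable (Leb d)"
  unfolding cubic_def by measurable

lemma quartic_nonneg: "0 \<le> quartic x"
  by (simp add: quartic_def sum_nonneg)

lemma integral_quartic:
  shows "integrable (std_gauss d) quartic" and "(\<integral>x. quartic x \<partial>std_gauss d) \<le> 3 * n * \<kappa>\<^sup>2"
proof -
  show "integrable (std_gauss d) quartic"
    unfolding quartic_def by (intro Bochner_Integration.integrable_sum std_gauss_lin_moment(1))
  have "(\<integral>x. quartic x \<partial>std_gauss d) = (\<Sum>j<n. 3 * (lin d (al j) (al j))\<^sup>2)"
    unfolding quartic_def using std_gauss_lin_moment(1)[of d _ 4] by (simp add: std_gauss_lin4)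
  also have "\<dots> \<le> (\<Sum>j<n. 3 * \<kappa>\<^sup>2)"
    using lin_al_le by (intro sum_mono mult_left_mono power_mono lin_self_nonneg) auto
  finally show "(\<integral>x. quartic x \<partial>std_gauss d) \<le> 3 * n * \<kappa>\<^sup>2" by simp
qed

text \<open>Bounding each of the \<open>n\<^sup>2\<close> covariances by its maximum would give the
  order \<open>n\<^sup>2 * \<kappa> ^ 3\<close>, a factor \<open>k\<close> more than can be
  afforded. Instead, the part of the covariances linear in \<open>?b i j\<close> sums to the squared
  length of one combination of the \<open>al j\<close>. In the part cubic in \<open>?b i j\<close>
  one factor is bounded by \<open>\<kappa>\<close> and the remaining squares are summed by
  Bessel.\<close>

lemma integral_cubic_sq:
  shows "integrable (std_gauss d) (\<lambda>x. (cubic x)\<^sup>2)"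
    and "(\<integral>x. (cubic x)\<^sup>2 \<partial>std_gauss d) \<le> 15 * n * \<kappa>\<^sup>2 / r"
proof -
  define c where "c j = - (s j * (1 - 2 * \<zeta> j) / 6)" for j
  have c: "\<bar>c j\<bar> \<le> 1" if j: "j < n" for j
  proof -
    have "\<bar>s j * (1 - 2 * \<zeta> j)\<bar> \<le> 1 * 1"
      unfolding abs_mult using s_pos[OF j] s_le[of j] \<zeta>[OF j] by (intro mult_mono) auto
    then show ?thesis by (simp add: c_def)
  qed
  let ?b = "\<lambda>i j. lin d (al i) (al j)"
  have eq: "(cubic x)\<^sup>2 = (\<Sum>i<n. \<Sum>j<n. c i * c j * (V i x ^ 3 * V j x ^ 3))" for x
  proof -
    have "cubic x = (\<Sum>j<n. c j * V j x ^ 3)" by (simp add: cubic_def c_def)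
    then show ?thesis unfolding power2_eq_square by (simp only: sum_product) (simp add: mult_ac)
  qed
  show "integrable (std_gauss d) (\<lambda>x. (cubic x)\<^sup>2)"
    unfolding eq by (intro Bochner_Integration.integrable_sum integrable_mult_right std_gauss_lin_cube_cube(1))
  define w where "w j = c j * ?b j j" for j
  define v where "v = (\<lambda>p. \<Sum>j<n. w j * al j p)"
  have w: "\<bar>w j\<bar> \<le> \<kappa>" if j: "j < n" for j
  proof -
    have "\<bar>w j\<bar> \<le> 1 * \<kappa>"
      unfolding w_def abs_mult using c[OF j] abs_lin_al_le[OF j j] by (intro mult_mono) auto
    then show ?thesis by simp
  qed
  have "(\<integral>x. (cubic x)\<^sup>2 \<partial>std_gauss d) =
      (\<Sum>i<n. \<Sum>j<n. c i * c j * (9 * ?b i i * ?b j j * ?b i j + 6 * ?b i j ^ 3))"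
    unfolding eq using std_gauss_lin_cube_cube by simp
  also have "\<dots> = 9 * (\<Sum>i<n. \<Sum>j<n. w i * (w j * ?b i j)) + 6 * (\<Sum>i<n. \<Sum>j<n. c i * c j * ?b i j ^ 3)"
    unfolding sum_distrib_left sum.distrib[symmetric] w_def
    by (intro sum.cong refl) (simp add: algebra_simps)
  also have "(\<Sum>i<n. \<Sum>j<n. w i * (w j * ?b i j)) = lin d v v"
  proof -
    have "lin d v v = (\<Sum>i<n. w i * V i v)"
      unfolding v_def by (rule lin_sum_left) simp
    also have "\<dots> = (\<Sum>i<n. w i * (\<Sum>j<n. w j * ?b j i))"
    proof (intro sum.cong refl arg_cong2[of _ _ _ _ "(*)"])
      fix i
      show "V i v = (\<Sum>j<n. w j * ?b j i)"
        unfolding lin_commute[of d "al i" v] unfolding v_def by (rule lin_sum_left) simp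
    qed
    finally show ?thesis by (simp add: sum_distrib_left lin_commute)
  qed
  also have "(\<Sum>i<n. \<Sum>j<n. c i * c j * ?b i j ^ 3) \<le> (\<Sum>i<n. \<kappa> * (\<kappa> / r))"
  proof (rule sum_mono)
    fix i assume "i \<in> {..<n}"
    then have i: "i < n" by simp
    have "(\<Sum>j<n. c i * c j * ?b i j ^ 3) \<le> (\<Sum>j<n. \<kappa> * (?b j i)\<^sup>2)"
    proof (rule sum_mono)
      fix j assume "j \<in> {..<n}"
      then have j: "j < n" by simp
      have "c i * c j * ?b i j ^ 3 \<le> (\<bar>c i\<bar> * \<bar>c j\<bar>) * (\<bar>?b i j\<bar> * (?b i j)\<^sup>2)"
        by (rule order_trans[OF abs_ge_self]) (simp add: abs_mult power3_eq_cube power2_eq_square)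
      also have "\<dots> \<le> (1 * 1) * (\<kappa> * (?b i j)\<^sup>2)"
        using c[OF i] c[OF j] abs_lin_al_le[OF i j] \<kappa> by (intro mult_mono) auto
      finally show "c i * c j * ?b i j ^ 3 \<le> \<kappa> * (?b j i)\<^sup>2" by (simp add: lin_commute)
    qed
    also have "\<dots> = \<kappa> * (\<Sum>j<n. (V j (al i))\<^sup>2)" by (simp add: sum_distrib_left)
    also have "\<dots> \<le> \<kappa> * (\<kappa> / r)"
    proof (rule mult_left_mono[OF _ \<kappa>])
      show "(\<Sum>j<n. (V j (al i))\<^sup>2) \<le> \<kappa> / r"
        using sum_lin_sq_le[of "al i"] lin_al_le[OF i] r by (meson divide_right_mono less_imp_le order_trans)
    qed
    finally show "(\<Sum>j<n. c i * c j * ?b i j ^ 3) \<le> \<kappa> * (\<kappa> / r)" .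
  qed
  also have "lin d v v \<le> n * \<kappa>\<^sup>2 / r"
    unfolding v_def using w by (rule lin_combination_le)
  finally show "(\<integral>x. (cubic x)\<^sup>2 \<partial>std_gauss d) \<le> 15 * n * \<kappa>\<^sup>2 / r"
    by (simp add: power2_eq_square mult_ac)
qed


text \<open>The product of characteristic functions divided by its Gaussian approximation, so that
  integrals of it become expectations under \<open>std_gauss\<close>.\<close>

definition ratio :: "(nat \<Rightarrow> real) \<Rightarrow> complex" where
  "ratio x = (\<Prod>j<n. bern_char (\<zeta> j) (V j x)) * of_real (exp ((\<Sum>j<n. s j * (V j x)\<^sup>2) / 2))"

lemma measurable_ratio [measurable]: "ratio \<in> borel_measurable (Leb d)"
  unfolding ratio_def bern_char_def by measurable

lemma ratio_expansion:
  assumes "\<And>j. j < n \<Longrightarrow> \<bar>V j x\<bar> \<le> 1"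
  shows "norm (ratio x - 1 - \<i> * of_real (sin (cubic x))) \<le> exp (quartic x) * quartic x + (cubic x)\<^sup>2 / 2"
proof -
  have "\<forall>j\<in>{..<n}. \<exists>\<rho>. bern_char (\<zeta> j) (V j x) = exp (of_real (- s j / 2 * (V j x)\<^sup>2) -
      \<i> * of_real (s j * (1 - 2 * \<zeta> j) / 6 * V j x ^ 3) + \<rho>) \<and> norm \<rho> \<le> V j x ^ 4"
    using bern_char_expansion[OF \<zeta> assms] by blast
  then obtain \<rho> where \<rho>: "\<And>j. j < n \<Longrightarrow> bern_char (\<zeta> j) (V j x) = exp (of_real (- s j / 2 * (V j x)\<^sup>2) -
      \<i> * of_real (s j * (1 - 2 * \<zeta> j) / 6 * V j x ^ 3) + \<rho> j)" "\<And>j. j < n \<Longrightarrow> norm (\<rho> j) \<le> V j x ^ 4"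
    by (auto dest!: bchoice)
  define R where "R = (\<Sum>j<n. \<rho> j)"
  have R: "norm R \<le> quartic x"
    unfolding R_def quartic_def using \<rho>(2) by (intro sum_norm_le) auto
  have "(\<Prod>j<n. bern_char (\<zeta> j) (V j x)) = exp (\<Sum>j<n. of_real (- s j / 2 * (V j x)\<^sup>2) -
      \<i> * of_real (s j * (1 - 2 * \<zeta> j) / 6 * V j x ^ 3) + \<rho> j)"
    unfolding exp_sum[OF finite_lessThan] using \<rho>(1) by (intro prod.cong) auto
  also have "(\<Sum>j<n. of_real (- s j / 2 * (V j x)\<^sup>2) - \<i> * of_real (s j * (1 - 2 * \<zeta> j) / 6 * V j x ^ 3) + \<rho> j) =
      of_real (- (\<Sum>j<n. s j * (V j x)\<^sup>2) / 2) + \<i> * of_real (cubic x) + R"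
  proof -
    have e1: "(\<Sum>j<n. complex_of_real (- s j / 2 * (V j x)\<^sup>2)) = of_real (- (\<Sum>j<n. s j * (V j x)\<^sup>2) / 2)"
      unfolding of_real_sum[symmetric] unfolding sum_negf[symmetric] sum_divide_distrib
      by (intro arg_cong[of _ _ of_real] sum.cong refl) (simp add: algebra_simps)
    have "cubic x = - (\<Sum>j<n. s j * (1 - 2 * \<zeta> j) / 6 * V j x ^ 3)"
      unfolding cubic_def sum_negf[symmetric] by (intro sum.cong) auto
    then have e2: "(\<Sum>j<n. \<i> * complex_of_real (s j * (1 - 2 * \<zeta> j) / 6 * V j x ^ 3)) = - (\<i> * of_real (cubic x))"
      unfolding sum_distrib_left[symmetric] of_real_sum[symmetric] by simp
    show ?thesis unfolding sum.distrib sum_subtractf e1 e2 R_def by simp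
  qed
  finally have "ratio x = exp (of_real (- (\<Sum>j<n. s j * (V j x)\<^sup>2) / 2) + \<i> * of_real (cubic x) + R +
      of_real ((\<Sum>j<n. s j * (V j x)\<^sup>2) / 2))"
    unfolding ratio_def exp_of_real[symmetric] by (simp only: exp_add)
  also have "\<dots> = exp (\<i> * of_real (cubic x) + R)"
    by (rule arg_cong[of _ _ exp]) simp
  finally have ratio: "ratio x = iexp (cubic x) * exp R" by (simp add: exp_add)
  have "norm (exp R - 1) \<le> norm R * exp (norm R)"
  proof -
    have "norm (exp R - 1) \<le> norm R * exp \<bar>Re R\<bar>" using Taylor_exp[of R 0] by (simp add: mult.commute)
    also have "\<dots> \<le> norm R * exp (norm R)" using abs_Re_le_cmod[of R] by (intro mult_left_mono) auto
    finally show ?thesis .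
  qed
  then have 1: "norm (exp R - 1) \<le> exp (quartic x) * quartic x"
    using R by (smt (verit) exp_ge_zero exp_le_cancel_iff mult.commute mult_mono norm_ge_zero)
  have 2: "\<bar>cos y - 1\<bar> \<le> y\<^sup>2 / 2" for y :: real
  proof -
    have "1 - cos y = 2 * (sin (y / 2))\<^sup>2" using cos_double_sin[of "y / 2"] by simp
    also have "\<dots> \<le> 2 * (y / 2)\<^sup>2"
      using abs_le_square_iff[THEN iffD1, OF abs_sin_x_le_abs_x[of "y / 2"]] by simp
    finally show ?thesis using cos_le_one[of y] by (simp add: power_divide)
  qed
  have "ratio x - 1 - \<i> * of_real (sin (cubic x)) = iexp (cubic x) * (exp R - 1) + of_real (cos (cubic x) - 1)"
    unfolding ratio by (simp add: cis_conv_exp[symmetric] complex_eq_iff algebra_simps)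
  also have "norm \<dots> \<le> norm (exp R - 1) + \<bar>cos (cubic x) - 1\<bar>"
    by (rule norm_triangle_le) (simp add: norm_mult norm_exp_eq_Re del: of_real_diff)
  also have "\<dots> \<le> exp (quartic x) * quartic x + (cubic x)\<^sup>2 / 2"
    using 1 2[of "cubic x"] by simp
  finally show ?thesis .
qed

text \<open>\<open>\<kappa> * L \<le> 1\<close> keeps every form within \<open>[-1, 1]\<close> on
  the ball, where the expansion is valid, and the third condition bounds the quartic term there by
  \<open>B\<close>. Thus \<open>exp B\<close> is a constant and one factor \<open>quartic\<close> is
  left for the expectation, so \<open>L\<close> enters the bound only through \<open>B\<close>. The
  ball is invariant under reflection, hence the sine part integrates to 0.\<close>

lemma integral_ratio_near_zero:
  assumes L: "0 \<le> L" "\<kappa> * L \<le> 1" "\<kappa> * L\<^sup>2 / r \<le> B"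
  defines "Z \<equiv> {x \<in> space (Leb d). lin d x x \<le> L}"
  shows "integrable (std_gauss d) (\<lambda>x. indicator Z x *\<^sub>R ratio x)"
    and "norm ((\<integral>x. indicator Z x *\<^sub>R ratio x \<partial>std_gauss d) - of_real (measure (std_gauss d) Z))
      \<le> (3 * exp B + 8 / r) * n * \<kappa>\<^sup>2"
proof -
  have [measurable]: "(\<lambda>x. lin d x x) \<in> borel_measurable (Leb d)"
    unfolding lin_def by measurable
  have Z [measurable]: "Z \<in> sets (Leb d)" unfolding Z_def by measurable
  have B: "0 \<le> B" using L(3) \<kappa> r by (meson divide_nonneg_pos mult_nonneg_nonneg order_trans zero_le_power2)
  have V1: "\<bar>V j x\<bar> \<le> 1" if x: "lin d x x \<le> L" and j: "j < n" for j x
  proof -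
    have "(V j x)\<^sup>2 \<le> \<kappa> * lin d x x" by (rule single) fact
    also have "\<dots> \<le> 1" using mult_left_mono[OF x \<kappa>] L by simp
    finally show ?thesis by (simp add: abs_square_le_1)
  qed
  have q: "quartic x \<le> B" if x: "lin d x x \<le> L" for x
  proof -
    have "quartic x \<le> (\<Sum>j<n. (\<kappa> * L) * (V j x)\<^sup>2)"
      unfolding quartic_def
    proof (rule sum_mono)
      fix j assume "j \<in> {..<n}"
      then have "(V j x)\<^sup>2 \<le> \<kappa> * L"
        using single[of j x] mult_left_mono[OF x \<kappa>] by simp
      then show "V j x ^ 4 \<le> \<kappa> * L * (V j x)\<^sup>2"
        using mult_right_mono[of "(V j x)\<^sup>2" "\<kappa> * L" "(V j x)\<^sup>2"] by (simp add: power4_eq_xxxx power2_eq_square mult.assoc)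
    qed
    also have "\<dots> = \<kappa> * L * (\<Sum>j<n. (V j x)\<^sup>2)" by (simp add: sum_distrib_left)
    also have "\<dots> \<le> \<kappa> * L * (L / r)"
      using sum_lin_sq_le[of x] divide_right_mono[OF x, of r] r \<kappa> L(1)
      by (intro mult_left_mono) auto
    finally show ?thesis using L(3) by (simp add: power2_eq_square)
  qed
  let ?err = "\<lambda>x. indicator Z x *\<^sub>R (ratio x - 1 - \<i> * of_real (sin (cubic x)))"
  let ?bd = "\<lambda>x. exp B * quartic x + (cubic x)\<^sup>2 / 2"
  have err: "norm (?err x) \<le> ?bd x" for x
  proof (cases "x \<in> Z")
    case True
    then have x: "lin d x x \<le> L" by (simp add: Z_def)
    have "norm (?err x) \<le> exp (quartic x) * quartic x + (cubic x)\<^sup>2 / 2"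
      using True ratio_expansion[OF V1[OF x]] by simp
    also have "\<dots> \<le> ?bd x" using q[OF x] quartic_nonneg[of x] by (intro add_mono mult_right_mono) auto
    finally show ?thesis .
  qed (use quartic_nonneg[of x] in simp)
  have bd: "integrable (std_gauss d) ?bd"
    using integral_quartic(1) integral_cubic_sq(1) by (intro Bochner_Integration.integrable_add) simp_all
  have int_err: "integrable (std_gauss d) ?err"
    by (rule Bochner_Integration.integrable_bound[OF bd]) (use err quartic_nonneg in \<open>simp_all add: order_trans\<close>)
  have int_sin: "integrable (std_gauss d) (\<lambda>x. indicator Z x *\<^sub>R (\<i> * of_real (sin (cubic x))))"
    by (rule std_gauss.integrable_const_bound[where B = 1])
      (auto simp: norm_mult indicator_def split: if_splits)
  have int_one: "integrable (std_gauss d) (\<lambda>x. indicator Z x *\<^sub>R (1 :: complex))"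
    by (rule std_gauss.integrable_const_bound[where B = 1])
      (auto simp: indicator_def split: if_splits)
  have eq: "indicator Z x *\<^sub>R ratio x = ?err x + indicator Z x *\<^sub>R (\<i> * of_real (sin (cubic x))) + indicator Z x *\<^sub>R 1" for x
    by (simp add: algebra_simps)
  show "integrable (std_gauss d) (\<lambda>x. indicator Z x *\<^sub>R ratio x)"
    unfolding eq using int_err int_sin int_one by (intro Bochner_Integration.integrable_add)
  have sin0: "(\<integral>x. indicator Z x *\<^sub>R (\<i> * of_real (sin (cubic x))) \<partial>std_gauss d) = (0 :: complex)"
  proof -
    let ?f = "\<lambda>x. indicator Z x *\<^sub>R (\<i> * of_real (sin (cubic x)) :: complex)" and ?m = "\<lambda>x. \<lambda>p\<in>{..<d}. - x p"
    have V: "V j (?m x) = - V j x" for j x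
      by (simp add: lin_def sum_negf[symmetric])
    have "lin d (?m x) (?m x) = lin d x x" for x
      by (simp add: lin_def)
    then have "?f (?m x) = - ?f x" if "x \<in> space (Leb d)" for x
      using that by (auto simp: Z_def cubic_def V sum_negf space_PiM indicator_def)
    then have "(\<integral>x. ?f (?m x) \<partial>std_gauss d) = (\<integral>x. - ?f x \<partial>std_gauss d)"
      by (intro Bochner_Integration.integral_cong) simp_all
    moreover have "(\<integral>x. ?f x \<partial>std_gauss d) = (\<integral>x. ?f (?m x) \<partial>std_gauss d)"
      by (rule integral_std_gauss_uminus) measurable
    ultimately show ?thesis by simp
  qed
  have "(\<integral>x. indicator Z x *\<^sub>R ratio x \<partial>std_gauss d) = (\<integral>x. ?err x \<partial>std_gauss d) + 0 + of_real (measure (std_gauss d) Z)"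
    unfolding eq using int_err int_sin int_one sin0
    by (simp add: Bochner_Integration.integral_add scaleR_conv_of_real Z)
  then have "norm ((\<integral>x. indicator Z x *\<^sub>R ratio x \<partial>std_gauss d) - of_real (measure (std_gauss d) Z)) =
      norm (\<integral>x. ?err x \<partial>std_gauss d)" by simp
  also have "\<dots> \<le> (\<integral>x. norm (?err x) \<partial>std_gauss d)" by (rule integral_norm_bound)
  also have "\<dots> \<le> (\<integral>x. ?bd x \<partial>std_gauss d)"
    using err by (intro integral_mono integrable_norm[OF int_err] bd)
  also have "\<dots> = exp B * (\<integral>x. quartic x \<partial>std_gauss d) + (\<integral>x. (cubic x)\<^sup>2 \<partial>std_gauss d) / 2"
    using integral_quartic(1) integral_cubic_sq(1) by simp
  also have "\<dots> \<le> exp B * (3 * n * \<kappa>\<^sup>2) + (15 * n * \<kappa>\<^sup>2 / r) / 2"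
    using integral_quartic(2) integral_cubic_sq(2) by (intro add_mono mult_left_mono divide_right_mono) auto
  also have "\<dots> \<le> (3 * exp B + 8 / r) * n * \<kappa>\<^sup>2"
  proof -
    have "(15 * n * \<kappa>\<^sup>2 / r) / 2 \<le> 8 / r * (n * \<kappa>\<^sup>2)"
      using r by (simp add: field_simps)
    then show ?thesis by (simp add: algebra_simps)
  qed
  finally show "norm ((\<integral>x. indicator Z x *\<^sub>R ratio x \<partial>std_gauss d) - of_real (measure (std_gauss d) Z))
      \<le> (3 * exp B + 8 / r) * n * \<kappa>\<^sup>2" .
qed

end

section \<open>The integrand in lattice coordinates\<close>

lemma integral_gauss_kernel_Leb:
  assumes a: "0 < a"
  shows "integrable (Leb d) (\<lambda>x. exp (- a * (\<Sum>p<d. (x p)\<^sup>2) / 2))"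
    and "(\<integral>x. exp (- a * (\<Sum>p<d. (x p)\<^sup>2) / 2) \<partial>Leb d) = sqrt (2 * pi / a) ^ d"
proof -
  let ?\<sigma> = "1 / sqrt a"
  have eq1: "exp (- a * y\<^sup>2 / 2) = sqrt (2 * pi / a) * normal_density 0 ?\<sigma> y" for y
    using a by (simp add: normal_density_def power_divide real_sqrt_divide)
  have int1: "integrable lborel (\<lambda>y. exp (- a * y\<^sup>2 / 2))"
    unfolding eq1 using a by (intro integrable_mult_right integrable_normal_density) simp
  have val1: "(\<integral>y. exp (- a * y\<^sup>2 / 2) \<partial>lborel) = sqrt (2 * pi / a)"
    unfolding eq1 using a by (simp add: integral_normal_density)
  have eq: "exp (- a * (\<Sum>p<d. (x p)\<^sup>2) / 2) = (\<Prod>p<d. exp (- a * (x p)\<^sup>2 / 2))" for x :: "nat \<Rightarrow> real"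
    by (simp add: exp_sum[symmetric] sum_distrib_left sum_divide_distrib sum_negf)
  show "integrable (Leb d) (\<lambda>x. exp (- a * (\<Sum>p<d. (x p)\<^sup>2) / 2))"
    unfolding eq using int1 by (intro lborel_prod.product_integrable_prod) auto
  show "(\<integral>x. exp (- a * (\<Sum>p<d. (x p)\<^sup>2) / 2) \<partial>Leb d) = sqrt (2 * pi / a) ^ d"
    unfolding eq using lborel_prod.product_integral_prod[of "{..<d}" "\<lambda>_ y. exp (- a * y\<^sup>2 / 2)"] int1 val1 by simp
qed

lemma std_gauss_exp_square:
  assumes c: "c < 1 / 2"
  shows "integrable (std_gauss d) (\<lambda>x. exp (c * lin d x x))"
    and "(\<integral>x. exp (c * lin d x x) \<partial>std_gauss d) = (1 / sqrt (1 - 2 * c)) ^ d"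
proof -
  have [measurable]: "(\<lambda>x. exp (c * lin d x x)) \<in> borel_measurable (Leb d)"
    unfolding lin_def by measurable
  have eq: "(exp (- (\<Sum>p<d. (x p)\<^sup>2) / 2) / sqrt (2 * pi) ^ d) *\<^sub>R exp (c * lin d x x) =
      (1 / sqrt (2 * pi) ^ d) * exp (- (1 - 2 * c) * (\<Sum>p<d. (x p)\<^sup>2) / 2)" for x :: "nat \<Rightarrow> real"
  proof -
    have "exp (- (\<Sum>p<d. (x p)\<^sup>2) / 2) * exp (c * lin d x x) = exp (- (1 - 2 * c) * (\<Sum>p<d. (x p)\<^sup>2) / 2)"
      unfolding exp_add[symmetric] lin_self by (rule arg_cong[of _ _ exp]) (simp add: field_simps)
    then show ?thesis by (simp add: field_simps)
  qed
  have a: "0 < 1 - 2 * c" using c by simp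
  note G = integral_gauss_kernel_Leb[OF a, of d]
  show "integrable (std_gauss d) (\<lambda>x. exp (c * lin d x x))"
    by (subst integral_std_gauss(2)) (measurable, simp only: eq integrable_mult_right[OF G(1)])
  have "(\<integral>x. exp (c * lin d x x) \<partial>std_gauss d) = (1 / sqrt (2 * pi) ^ d) * sqrt (2 * pi / (1 - 2 * c)) ^ d"
    by (subst integral_std_gauss(1)) (measurable, simp only: eq integral_mult_right_zero G(2))
  also have "\<dots> = (1 / sqrt (1 - 2 * c)) ^ d"
    by (simp add: real_sqrt_divide power_divide)
  finally show "(\<integral>x. exp (c * lin d x x) \<partial>std_gauss d) = (1 / sqrt (1 - 2 * c)) ^ d" .
qed

text \<open>Exponential Markov inequality: where \<open>lin d x x\<close> exceeds \<open>L\<close>,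
  the function is at most \<open>exp (- (c' - c) * L)\<close> times
  \<open>exp (c' * lin d x x)\<close>, whose expectation is explicit as long as
  \<open>c' < 1 / 2\<close>.\<close>

lemma std_gauss_tail:
  assumes c: "c \<le> c'" "c' < 1 / 2"
  shows "integrable (std_gauss d) (\<lambda>x. indicator {x. L < lin d x x} x * exp (c * lin d x x))"
    and "(\<integral>x. indicator {x. L < lin d x x} x * exp (c * lin d x x) \<partial>std_gauss d) \<le>
      exp (- (c' - c) * L) * (1 / sqrt (1 - 2 * c')) ^ d"
proof -
  have [measurable]: "(\<lambda>x. lin d x x) \<in> borel_measurable (Leb d)"
    unfolding lin_def by measurable
  have meas: "(\<lambda>x. indicator {x. L < lin d x x} x * exp (c * lin d x x)) \<in> borel_measurable (std_gauss d)"
    unfolding indicator_def by measurable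
  have le: "indicator {x. L < lin d x x} x * exp (c * lin d x x) \<le> exp (- (c' - c) * L) * exp (c' * lin d x x)" for x
  proof -
    have "exp (c * lin d x x) \<le> exp (- (c' - c) * L + c' * lin d x x)" if "L < lin d x x"
      using mult_left_mono[of L "lin d x x" "c' - c"] that c by (simp add: algebra_simps)
    then show ?thesis by (auto simp: indicator_def exp_add[symmetric])
  qed
  have int: "integrable (std_gauss d) (\<lambda>x. exp (- (c' - c) * L) * exp (c' * lin d x x))"
    using std_gauss_exp_square(1)[OF c(2)] by (intro integrable_mult_right)
  show 1: "integrable (std_gauss d) (\<lambda>x. indicator {x. L < lin d x x} x * exp (c * lin d x x))"
    by (rule Bochner_Integration.integrable_bound[OF int meas]) (use le in \<open>auto simp: abs_mult\<close>)
  have "(\<integral>x. indicator {x. L < lin d x x} x * exp (c * lin d x x) \<partial>std_gauss d) \<le>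
      (\<integral>x. exp (- (c' - c) * L) * exp (c' * lin d x x) \<partial>std_gauss d)"
    using le by (intro integral_mono 1 int) auto
  then show "(\<integral>x. indicator {x. L < lin d x x} x * exp (c * lin d x x) \<partial>std_gauss d) \<le>
      exp (- (c' - c) * L) * (1 / sqrt (1 - 2 * c')) ^ d"
    using std_gauss_exp_square(2)[OF c(2)] by simp
qed

text \<open>In the application the \<open>a j\<close> are the columns of the reduced system and
  \<open>Z\<close> is the set of coordinates of the redundant equations. \<open>small_forms\<close>
  says that the region where all forms are small lies within one period; by scaling it also yields
  definiteness.\<close>

locale lattice_forms =
  fixes d n :: nat and a :: "nat \<Rightarrow> nat \<Rightarrow> real" and Z :: "nat set" and \<zeta> :: "nat \<Rightarrow> real" and r K :: real
  assumes r: "0 < r" and K: "0 \<le> K" and Z: "Z \<subseteq> {..<d}"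
    and \<zeta>: "\<And>j. j < n \<Longrightarrow> 0 \<le> \<zeta> j" "\<And>j. j < n \<Longrightarrow> \<zeta> j \<le> 1"
    and r_le: "\<And>j. j < n \<Longrightarrow> r \<le> \<zeta> j - (\<zeta> j)\<^sup>2"
    and single: "\<And>j t. j < n \<Longrightarrow> (lin d (a j) t)\<^sup>2 \<le> K * (\<Sum>i<n. (lin d (a i) t)\<^sup>2)"
    and small_forms: "\<And>t p. \<forall>j<n. \<bar>lin d (a j) t\<bar> \<le> 1 \<Longrightarrow> p < d \<Longrightarrow> p \<notin> Z \<Longrightarrow> \<bar>t p\<bar> \<le> pi"
begin

abbreviation s :: "nat \<Rightarrow> real" where "s j \<equiv> \<zeta> j - (\<zeta> j)\<^sup>2"
abbreviation U :: "nat \<Rightarrow> (nat \<Rightarrow> real) \<Rightarrow> real" where "U j \<equiv> lin d (a j)"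

text \<open>The squares over \<open>Z\<close> make the form definite in all \<open>d\<close>
  coordinates. There is no factor \<open>1 / 2\<close> here: the Gaussian weight is
  \<open>exp (- form t / 2)\<close>.\<close>

definition form :: "(nat \<Rightarrow> real) \<Rightarrow> real" where
  "form t = (\<Sum>j<n. s j * (U j t)\<^sup>2) + (\<Sum>p\<in>Z. (t p)\<^sup>2)"

definition form_coeff :: "nat \<Rightarrow> nat \<Rightarrow> real" where
  "form_coeff p q = (\<Sum>j<n. s j * a j p * a j q) + (if p = q \<and> p \<in> Z then 1 else 0)"

lemma s_pos: "j < n \<Longrightarrow> 0 < s j"
  using r r_le by force

lemma s_nonneg: "j < n \<Longrightarrow> 0 \<le> s j"
  using s_pos by (rule less_imp_le)

lemma bilin_form: "bilin d form_coeff t t = form t"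
proof -
  have "bilin d form_coeff t t = (\<Sum>p<d. \<Sum>q<d. \<Sum>j<n. s j * (a j p * t p) * (a j q * t q)) +
      (\<Sum>p<d. \<Sum>q<d. if q = p then (if p \<in> Z then t p * t p else 0) else 0)"
    unfolding bilin_def form_coeff_def sum.distrib[symmetric]
    by (intro sum.cong refl) (simp add: algebra_simps sum_distrib_left sum_distrib_right)
  also have "(\<Sum>p<d. \<Sum>q<d. \<Sum>j<n. s j * (a j p * t p) * (a j q * t q)) = (\<Sum>j<n. s j * (U j t)\<^sup>2)"
  proof -
    have sq: "(U j t)\<^sup>2 = (\<Sum>p<d. \<Sum>q<d. (a j p * t p) * (a j q * t q))" for j
      unfolding lin_def power2_eq_square by (rule sum_product)
    have "(\<Sum>p<d. \<Sum>q<d. \<Sum>j<n. s j * (a j p * t p) * (a j q * t q)) =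
        (\<Sum>p<d. \<Sum>j<n. \<Sum>q<d. s j * (a j p * t p) * (a j q * t q))"
      by (intro sum.cong refl sum.swap)
    also have "\<dots> = (\<Sum>j<n. \<Sum>p<d. \<Sum>q<d. s j * (a j p * t p) * (a j q * t q))"
      by (rule sum.swap)
    also have "\<dots> = (\<Sum>j<n. s j * (U j t)\<^sup>2)"
      by (simp only: sq sum_distrib_left mult.assoc)
    finally show ?thesis .
  qed
  also have "(\<Sum>p<d. \<Sum>q<d. if q = p then (if p \<in> Z then t p * t p else 0) else 0) = (\<Sum>p\<in>Z. (t p)\<^sup>2)"
    using Z by (simp add: sum.If_cases Int_absorb1 power2_eq_square)
  finally show ?thesis by (simp add: form_def)
qed

lemma form_nonneg: "0 \<le> form t"
  unfolding form_def by (intro add_nonneg_nonneg sum_nonneg mult_nonneg_nonneg) (simp_all add: s_nonneg[simplified])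

lemma form_pos:
  assumes "p < d" "t p \<noteq> 0"
  shows "0 < form t"
proof (rule ccontr)
  assume "\<not> 0 < form t"
  then have f0: "form t = 0" using form_nonneg[of t] by simp
  have finZ: "finite Z" using Z finite_subset by blast
  have nn: "0 \<le> (\<Sum>j<n. s j * (U j t)\<^sup>2)" "0 \<le> (\<Sum>p\<in>Z. (t p)\<^sup>2)"
    by (intro sum_nonneg mult_nonneg_nonneg; simp add: s_nonneg[simplified])+
  then have "(\<Sum>j<n. s j * (U j t)\<^sup>2) = 0" and z0: "(\<Sum>p\<in>Z. (t p)\<^sup>2) = 0"
    using f0 unfolding form_def by linarith+
  then have "\<forall>j\<in>{..<n}. s j * (U j t)\<^sup>2 = 0"
    by (subst (asm) sum_nonneg_eq_0_iff) (simp_all add: s_nonneg[simplified])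
  then have U0: "U j t = 0" if "j < n" for j using s_pos[OF that] that by force
  have "\<forall>q\<in>Z. (t q)\<^sup>2 = 0" using z0 finZ by (subst (asm) sum_nonneg_eq_0_iff) auto
  then have "p \<notin> Z" using assms by auto
  \<comment> \<open>The scaling gives coordinate \<open>p\<close> the absolute value 4, which
    exceeds \<pi>, while the vanishing forms stay small; this contradicts
    \<open>small_forms\<close>.\<close>
  define c where "c = 4 / \<bar>t p\<bar>"
  have "U j (\<lambda>q. c * t q) = c * U j t" for j
    by (simp add: lin_def sum_distrib_left mult.left_commute)
  then have "\<bar>c * t p\<bar> \<le> pi"
    using U0 assms \<open>p \<notin> Z\<close> by (intro small_forms[of "\<lambda>q. c * t q" p]) auto
  then show False using assms(2) pi_less_4 by (simp add: c_def abs_mult)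
qed

lemma ex_normal_coordinates:
  obtains T :: "nat \<Rightarrow> nat \<Rightarrow> real"
  where "\<And>p. p < d \<Longrightarrow> T p p > 0" "\<And>p q. p < q \<Longrightarrow> T p q = 0"
    "\<And>p q. p < d \<Longrightarrow> q < d \<Longrightarrow> bilin d form_coeff (\<lambda>i. T i p) (\<lambda>i. T i q) = (if p = q then 1 else 0)"
proof (rule orthonormal_lower_triangular[of d form_coeff])
  show "form_coeff i j = form_coeff j i" for i j
    by (auto simp: form_coeff_def mult_ac intro!: sum.cong)
  show "0 < bilin d form_coeff x x" if "\<exists>i<d. x i \<noteq> 0" for x
    using that form_pos by (auto simp: bilin_form)
qed (use that in blast)


lemma measurable_form [measurable]: "form \<in> borel_measurable (Leb d)"
  unfolding form_def
  by (intro borel_measurable_add borel_measurable_sum borel_measurable_times borel_measurable_const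
      borel_measurable_power measurable_lin measurable_Leb_component) (use Z in auto)

definition mass :: real where
  "mass = (\<integral>t. exp (- form t / 2) \<partial>Leb d)"

definition box :: "(nat \<Rightarrow> real) set" where
  "box = {t \<in> space (Leb d). \<forall>p<d. p \<notin> Z \<longrightarrow> \<bar>t p\<bar> \<le> pi}"

text \<open>One period in every coordinate outside \<open>Z\<close> and a Gaussian weight in every
  coordinate of \<open>Z\<close>. If the forms do not depend on the coordinates in \<open>Z\<close>,
  these contribute a factor \<open>sqrt (2 * pi)\<close> each and nothing else.\<close>

definition Psi :: "(nat \<Rightarrow> real) \<Rightarrow> complex" where
  "Psi t = indicator box t *\<^sub>R ((\<Prod>j<n. bern_char (\<zeta> j) (U j t)) * of_real (exp (- (\<Sum>p\<in>Z. (t p)\<^sup>2) / 2)))"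

lemma box_sets [measurable]: "box \<in> sets (Leb d)"
proof -
  have "{t \<in> space (Leb d). p \<notin> Z \<longrightarrow> \<bar>t p\<bar> \<le> pi} \<in> sets (Leb d)" if "p \<in> {..<d}" for p
  proof -
    have [measurable]: "(\<lambda>t. t p) \<in> borel_measurable (Leb d)"
      using that by (intro measurable_Leb_component) simp
    show ?thesis by measurable
  qed
  then have "{t \<in> space (Leb d). \<forall>p\<in>{..<d}. p \<notin> Z \<longrightarrow> \<bar>t p\<bar> \<le> pi} \<in> sets (Leb d)"
    by (intro sets.sets_Collect_finite_All) auto
  then show ?thesis by (simp add: box_def Ball_def)
qed

lemma measurable_Z [measurable]: "(\<lambda>t. \<Sum>p\<in>Z. (t p)\<^sup>2) \<in> borel_measurable (Leb d)"
  using Z by (auto intro!: borel_measurable_sum borel_measurable_power measurable_Leb_component)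

lemma measurable_Psi [measurable]: "Psi \<in> borel_measurable (Leb d)"
  unfolding Psi_def bern_char_def by measurable

lemma integral_box:
  shows "integrable (Leb d) (\<lambda>t. indicator box t * exp (- (\<Sum>p\<in>Z. (t p)\<^sup>2) / 2))"
    and "(\<integral>t. indicator box t * exp (- (\<Sum>p\<in>Z. (t p)\<^sup>2) / 2) \<partial>Leb d) \<le> (2 * pi) ^ d"
proof -
  define h where "h p y = (if p \<in> Z then exp (- 1 * y\<^sup>2 / 2) else indicator {- pi..pi} y)" for p and y :: real
  have eq: "indicator box t * exp (- (\<Sum>p\<in>Z. (t p)\<^sup>2) / 2) = (\<Prod>p<d. h p (t p))" if t: "t \<in> space (Leb d)" for t
  proof -
    have Zd: "{p. p < d \<and> p \<in> Z} = Z" using Z by auto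
    have "(\<Prod>p<d. h p (t p)) = (\<Prod>p\<in>Z. exp (- (t p)\<^sup>2 / 2)) * (\<Prod>p\<in>{..<d} - Z. indicator {- pi..pi} (t p))"
      unfolding h_def by (subst prod.If_cases) (auto simp: Zd Collect_conj_eq[symmetric] Int_def Diff_eq)
    also have "(\<Prod>p\<in>Z. exp (- (t p)\<^sup>2 / 2)) = exp (- (\<Sum>p\<in>Z. (t p)\<^sup>2) / 2)"
      using Z finite_subset by (subst exp_sum[symmetric]) (auto simp: sum_negf sum_divide_distrib)
    also have "(\<Prod>p\<in>{..<d} - Z. indicator {- pi..pi} (t p)) = (indicator box t :: real)"
    proof (cases "t \<in> box")
      case True
      then show ?thesis by (auto simp: box_def abs_le_iff intro!: prod.neutral)
    next
      case False
      then obtain p where "p \<in> {..<d} - Z" "t p \<notin> {- pi..pi}" using t by (auto simp: box_def abs_le_iff)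
      then have "(\<Prod>p\<in>{..<d} - Z. indicator {- pi..pi} (t p)) = (0::real)"
        by (intro prod_zero bexI[of _ p]) auto
      then show ?thesis using False by simp
    qed
    finally show ?thesis by (simp add: mult.commute)
  qed
  have e: "exp (- 1 * y\<^sup>2 / 2) = sqrt (2 * pi) * normal_density 0 1 y" for y :: real
    by (simp add: normal_density_def)
  have int: "integrable lborel (h p)" for p
  proof (cases "p \<in> Z")
    case True
    then show ?thesis unfolding h_def e by simp
  next
    case False
    then show ?thesis unfolding h_def by simp
  qed
  have val: "(\<integral>y. h p y \<partial>lborel) = (if p \<in> Z then sqrt (2 * pi) else 2 * pi)" for p
    unfolding h_def e by (simp add: integral_normal_density)
  have "integrable (Leb d) (\<lambda>t. \<Prod>p<d. h p (t p))"
    using int by (intro lborel_prod.product_integrable_prod) auto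
  then show "integrable (Leb d) (\<lambda>t. indicator box t * exp (- (\<Sum>p\<in>Z. (t p)\<^sup>2) / 2))"
    by (rule Bochner_Integration.integrable_cong[THEN iffD2, rotated -1]) (use eq in auto)
  have "(\<integral>t. indicator box t * exp (- (\<Sum>p\<in>Z. (t p)\<^sup>2) / 2) \<partial>Leb d) = (\<integral>t. (\<Prod>p<d. h p (t p)) \<partial>Leb d)"
    by (rule Bochner_Integration.integral_cong) (use eq in auto)
  also have "\<dots> = (\<Prod>p<d. if p \<in> Z then sqrt (2 * pi) else 2 * pi)"
    using lborel_prod.product_integral_prod[of "{..<d}" h] int val by simp
  also have "\<dots> \<le> (\<Prod>p<d. 2 * pi)"
  proof (rule prod_mono)
    have "2 * pi \<le> (2 * pi)\<^sup>2" using pi_gt3 by (intro self_le_power) auto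
    then have "sqrt (2 * pi) \<le> 2 * pi" by (intro real_le_lsqrt) auto
    then show "0 \<le> (if p \<in> Z then sqrt (2 * pi) else 2 * pi) \<and> (if p \<in> Z then sqrt (2 * pi) else 2 * pi) \<le> 2 * pi" for p
      by simp
  qed
  finally show "(\<integral>t. indicator box t * exp (- (\<Sum>p\<in>Z. (t p)\<^sup>2) / 2) \<partial>Leb d) \<le> (2 * pi) ^ d" by simp
qed

lemma norm_Psi_le: "norm (Psi t) \<le> indicator box t * exp (- (\<Sum>p\<in>Z. (t p)\<^sup>2) / 2)"
proof -
  have "norm (bern_char (\<zeta> j) (U j t)) \<le> 1" if "j < n" for j
  proof -
    have "0 \<le> s j * (sin (U j t / 2))\<^sup>2" using s_nonneg[OF that] by (intro mult_nonneg_nonneg) auto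
    then have "- 2 * s j * (sin (U j t / 2))\<^sup>2 \<le> 0" unfolding mult.assoc by linarith
    then have "exp (- 2 * s j * (sin (U j t / 2))\<^sup>2) \<le> 1" unfolding exp_le_one_iff .
    then show ?thesis using norm_bern_char_le[OF \<zeta>[OF that], of "U j t"] by linarith
  qed
  then have "(\<Prod>j<n. norm (bern_char (\<zeta> j) (U j t))) \<le> 1" by (intro prod_le_1) auto
  then show ?thesis
    by (auto simp: Psi_def norm_mult prod_norm indicator_def mult_le_cancel_right1)
qed

lemma integrable_Psi: "integrable (Leb d) Psi"
  by (rule Bochner_Integration.integrable_bound[OF integral_box(1)])
    (use norm_Psi_le in \<open>auto intro!: AE_I2 order_trans[OF norm_Psi_le]\<close>)

lemma norm_integral_Psi_le: "norm (\<integral>t. Psi t \<partial>Leb d) \<le> (2 * pi) ^ d"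
proof -
  have "norm (\<integral>t. Psi t \<partial>Leb d) \<le> (\<integral>t. norm (Psi t) \<partial>Leb d)" by (rule integral_norm_bound)
  also have "\<dots> \<le> (\<integral>t. indicator box t * exp (- (\<Sum>p\<in>Z. (t p)\<^sup>2) / 2) \<partial>Leb d)"
    by (intro integral_mono integrable_norm integrable_Psi integral_box norm_Psi_le)
  also have "\<dots> \<le> (2 * pi) ^ d" by (rule integral_box)
  finally show ?thesis .
qed

end

text \<open>The right-hand side is \<open>1 - cos y\<close>, which is at least
  \<open>y\<^sup>2 / 2 - y ^ 4 / 24\<close> and so at least \<open>11 / 24 * y\<^sup>2\<close>;
  \<open>1 / 5\<close> is a round value below \<open>11 / 24\<close>. Any positive constant keeps
  the later growth rate below \<open>1 / 2\<close>.\<close>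

lemma two_sin_half_sq_ge:
  fixes y :: real
  assumes "\<bar>y\<bar> \<le> 1"
  shows "y\<^sup>2 / 5 \<le> 2 * (sin (y / 2))\<^sup>2"
proof -
  have c: "cos y = 1 - 2 * (sin (y / 2))\<^sup>2" using cos_double_sin[of "y / 2"] by simp
  have "\<bar>Re (iexp y - (\<Sum>k\<le>3. (\<i> * y) ^ k / fact k))\<bar> \<le> \<bar>y\<bar> ^ 4 / 24"
    using order_trans[OF abs_Re_le_cmod iexp_approx1[of y 3]] by (simp add: fact_numeral)
  moreover have "Re (iexp y - (\<Sum>k\<le>3. (\<i> * y) ^ k / fact k)) = cos y - 1 + y\<^sup>2 / 2"
    by (simp add: cis_conv_exp[symmetric] eval_nat_numeral)
  ultimately have "cos y - 1 + y\<^sup>2 / 2 \<le> \<bar>y\<bar> ^ 4 / 24" by linarith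
  moreover have "\<bar>y\<bar> ^ 4 \<le> \<bar>y\<bar> ^ 2" using assms by (intro power_decreasing) auto
  ultimately show ?thesis unfolding c power2_abs using zero_le_power2[of y] by linarith
qed

context lattice_forms
begin

text \<open>Triangular coordinates in which \<open>form\<close> is the squared length. The
  determinant clause is the identity \<open>T\<^sup>T B T = 1\<close> after taking determinants; it
  ties the Jacobian to the determinant of the form.\<close>

definition normalizes :: "(nat \<Rightarrow> nat \<Rightarrow> real) \<Rightarrow> bool" where
  "normalizes T \<longleftrightarrow> (\<forall>p<d. T p p > 0) \<and>
    Determinant.det (Matrix.mat d d (\<lambda>(p, q). form_coeff p q)) * (\<Prod>p<d. T p p)\<^sup>2 = 1 \<and>
    (\<forall>x. form (lower_tri d T x) = lin d x x) \<and>
    (\<forall>j x. U j (lower_tri d T x) = lin d (\<lambda>q. \<Sum>p<d. a j p * T p q) x)"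

lemma normalizesD:
  assumes "normalizes T"
  shows "p < d \<Longrightarrow> T p p > 0"
    and "Determinant.det (Matrix.mat d d (\<lambda>(p, q). form_coeff p q)) * (\<Prod>p<d. T p p)\<^sup>2 = 1"
    and "form (lower_tri d T x) = lin d x x"
    and "U j (lower_tri d T x) = lin d (\<lambda>q. \<Sum>p<d. a j p * T p q) x"
  using assms by (auto simp: normalizes_def)

lemma normal_coordinates: "\<exists>T. normalizes T"
proof -
  obtain T :: "nat \<Rightarrow> nat \<Rightarrow> real" where T: "\<And>p. p < d \<Longrightarrow> T p p > 0" "\<And>p q. p < q \<Longrightarrow> T p q = 0"
    "\<And>p q. p < d \<Longrightarrow> q < d \<Longrightarrow> bilin d form_coeff (\<lambda>i. T i p) (\<lambda>i. T i q) = (if p = q then 1 else 0)"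
    using ex_normal_coordinates by blast
  have tri: "lower_tri d T x p = (\<Sum>q<d. x q * T p q)" if "p < d" for x p
  proof -
    have "lower_tri d T x p = (\<Sum>q\<le>p. x q * T p q)" using that by (simp add: lower_tri_def mult.commute)
    also have "\<dots> = (\<Sum>q<d. x q * T p q)" using that T(2) by (intro sum.mono_neutral_left) auto
    finally show ?thesis .
  qed
  have form: "form (lower_tri d T x) = lin d x x" for x
  proof -
    have "form (lower_tri d T x) = bilin d form_coeff (\<lambda>i. \<Sum>q<d. x q * T i q) (\<lambda>i. \<Sum>q<d. x q * T i q)"
      unfolding bilin_form[symmetric] bilin_def by (intro sum.cong refl) (simp add: tri)
    also have "\<dots> = (\<Sum>p<d. x p * (\<Sum>q<d. x q * bilin d form_coeff (\<lambda>i. T i p) (\<lambda>i. T i q)))"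
      by (subst bilin_sum_left, simp, subst bilin_sum_right, simp_all)
    also have "\<dots> = (\<Sum>p<d. x p * (\<Sum>q<d. if q = p then x q else 0))"
      by (intro sum.cong refl arg_cong2[of _ _ _ _ "(*)"]) (simp add: T(3))
    finally show ?thesis by (simp add: lin_def)
  qed
  have U: "U j (lower_tri d T x) = lin d (\<lambda>q. \<Sum>p<d. a j p * T p q) x" for j x
  proof -
    have "U j (lower_tri d T x) = (\<Sum>p<d. \<Sum>q<d. a j p * (x q * T p q))"
      unfolding lin_def by (intro sum.cong refl) (simp add: tri sum_distrib_left)
    also have "\<dots> = (\<Sum>q<d. \<Sum>p<d. a j p * (x q * T p q))" by (rule sum.swap)
    finally show ?thesis by (simp add: lin_def sum_distrib_right sum_distrib_left mult_ac)
  qed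
  define TM where "TM = Matrix.mat d d (\<lambda>(p, q). T p q)"
  define B where "B = Matrix.mat d d (\<lambda>(p, q). form_coeff p q)"
  have c: "TM \<in> carrier_mat d d" "B \<in> carrier_mat d d" by (simp_all add: TM_def B_def)
  have "TM\<^sup>T * B * TM = 1\<^sub>m d"
  proof (rule eq_matI)
    fix p q assume pq: "p < dim_row (1\<^sub>m d :: real mat)" "q < dim_col (1\<^sub>m d :: real mat)"
    have "(TM\<^sup>T * B * TM) $$ (p, q) = (\<Sum>j<d. (\<Sum>i<d. T i p * form_coeff i j) * T j q)"
      using pq c by (simp add: TM_def B_def scalar_prod_def atLeast0LessThan)
    also have "\<dots> = (\<Sum>j<d. \<Sum>i<d. form_coeff i j * T i p * T j q)"
      by (simp add: sum_distrib_right sum_distrib_left mult_ac)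
    also have "\<dots> = bilin d form_coeff (\<lambda>i. T i p) (\<lambda>i. T i q)"
      unfolding bilin_def by (rule sum.swap)
    finally show "(TM\<^sup>T * B * TM) $$ (p, q) = 1\<^sub>m d $$ (p, q)" using pq T(3) by simp
  qed (use c in auto)
  then have "Determinant.det (TM\<^sup>T * B * TM) = 1" by simp
  then have "Determinant.det TM * Determinant.det B * Determinant.det TM = 1"
    using c by (simp add: Determinant.det_mult[of _ d] Determinant.det_transpose[of _ d])
  moreover have "Determinant.det TM = (\<Prod>p<d. T p p)"
    using det_lower_triangular[of d TM] c(1) T(2)
    by (simp add: TM_def diag_mat_def prod.list_conv_set_nth atLeast0LessThan)
  ultimately have "Determinant.det B * (\<Prod>p<d. T p p)\<^sup>2 = 1" by (simp add: power2_eq_square mult_ac)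
  then show ?thesis using T(1) form U unfolding normalizes_def B_def by blast
qed

lemma integral_normal_coordinates:
  fixes f :: "(nat \<Rightarrow> real) \<Rightarrow> 'b::{banach, second_countable_topology}"
  assumes T: "\<And>p. p < d \<Longrightarrow> T p p > 0" "\<And>x. form (lower_tri d T x) = lin d x x"
    and f [measurable]: "f \<in> borel_measurable (Leb d)"
  shows "(\<integral>t. exp (- form t / 2) *\<^sub>R f t \<partial>Leb d) =
      ((\<Prod>p<d. T p p) * sqrt (2 * pi) ^ d) *\<^sub>R (\<integral>x. f (lower_tri d T x) \<partial>std_gauss d)"
    and "integrable (Leb d) (\<lambda>t. exp (- form t / 2) *\<^sub>R f t) \<longleftrightarrow>
      integrable (std_gauss d) (\<lambda>x. f (lower_tri d T x))"
proof -
  have T0: "\<And>p. p < d \<Longrightarrow> T p p \<noteq> 0" using T(1) by force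
  have abs: "(\<Prod>p<d. \<bar>T p p\<bar>) = (\<Prod>p<d. T p p)" using T(1) by (intro prod.cong) force+
  let ?c = "sqrt (2 * pi) ^ d"
  have c: "?c > 0" by simp
  have eq: "exp (- form (lower_tri d T x) / 2) *\<^sub>R f (lower_tri d T x) =
      ?c *\<^sub>R ((exp (- (\<Sum>p<d. (x p)\<^sup>2) / 2) / ?c) *\<^sub>R f (lower_tri d T x))" for x
    using c unfolding T(2) lin_self scaleR_scaleR by (simp del: real_sqrt_power_even)
  note I = integral_lower_tri[of d T "\<lambda>t. exp (- form t / 2) *\<^sub>R f t", OF T0]
  note S = integral_std_gauss[of "\<lambda>x. f (lower_tri d T x)" d]
  show "(\<integral>t. exp (- form t / 2) *\<^sub>R f t \<partial>Leb d) =
      ((\<Prod>p<d. T p p) * ?c) *\<^sub>R (\<integral>x. f (lower_tri d T x) \<partial>std_gauss d)"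
  proof -
    have "(\<integral>t. exp (- form t / 2) *\<^sub>R f t \<partial>Leb d) =
        (\<Prod>p<d. \<bar>T p p\<bar>) *\<^sub>R (\<integral>x. exp (- form (lower_tri d T x) / 2) *\<^sub>R f (lower_tri d T x) \<partial>Leb d)"
      by (rule I(1)) measurable
    also have "\<dots> = (\<Prod>p<d. T p p) *\<^sub>R (?c *\<^sub>R
        (\<integral>x. (exp (- (\<Sum>p<d. (x p)\<^sup>2) / 2) / ?c) *\<^sub>R f (lower_tri d T x) \<partial>Leb d))"
      unfolding abs eq integral_scaleR_right ..
    also have "(\<integral>x. (exp (- (\<Sum>p<d. (x p)\<^sup>2) / 2) / ?c) *\<^sub>R f (lower_tri d T x) \<partial>Leb d) =
        (\<integral>x. f (lower_tri d T x) \<partial>std_gauss d)"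
      by (rule S(1)[symmetric]) measurable
    finally show ?thesis by (simp only: scaleR_scaleR)
  qed
  have "integrable (Leb d) (\<lambda>t. exp (- form t / 2) *\<^sub>R f t) \<longleftrightarrow>
      integrable (Leb d) (\<lambda>x. ?c *\<^sub>R ((exp (- (\<Sum>p<d. (x p)\<^sup>2) / 2) / ?c) *\<^sub>R f (lower_tri d T x)))"
    by (subst I(2), simp, measurable) (simp only: eq)
  also have "\<dots> \<longleftrightarrow> integrable (Leb d) (\<lambda>x. (exp (- (\<Sum>p<d. (x p)\<^sup>2) / 2) / ?c) *\<^sub>R f (lower_tri d T x))"
  proof
    let ?g = "\<lambda>x. (exp (- (\<Sum>p<d. (x p)\<^sup>2) / 2) / ?c) *\<^sub>R f (lower_tri d T x)"
    assume "integrable (Leb d) (\<lambda>x. ?c *\<^sub>R ?g x)"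
    then have "integrable (Leb d) (\<lambda>x. (1 / ?c) *\<^sub>R (?c *\<^sub>R ?g x))" by (rule integrable_scaleR_right)
    moreover have "(1 / ?c) *\<^sub>R (?c *\<^sub>R ?g x) = ?g x" for x
      using c by (subst scaleR_scaleR) simp
    ultimately show "integrable (Leb d) ?g" by (simp only:)
  qed (rule integrable_scaleR_right)
  also have "\<dots> \<longleftrightarrow> integrable (std_gauss d) (\<lambda>x. f (lower_tri d T x))"
    by (subst S(2), measurable)
  finally show "integrable (Leb d) (\<lambda>t. exp (- form t / 2) *\<^sub>R f t) \<longleftrightarrow>
      integrable (std_gauss d) (\<lambda>x. f (lower_tri d T x))" .
qed


text \<open>The Gaussian integral in squared shape, so that positivity of the determinant is a
  consequence and need not be known beforehand.\<close>

lemma mass_sq: "0 < mass" "mass\<^sup>2 * Determinant.det (Matrix.mat d d (\<lambda>(p, q). form_coeff p q)) = (2 * pi) ^ d"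
proof -
  obtain T where nT: "normalizes T" using normal_coordinates by blast
  note T = normalizesD(1-3)[OF nT] and UT = normalizesD(4)[OF nT]
  have m: "mass = (\<Prod>p<d. T p p) * sqrt (2 * pi) ^ d"
    using integral_normal_coordinates(1)[OF T(1,3), of "\<lambda>_. 1 :: real"] std_gauss.prob_space[of d]
    by (simp add: mass_def)
  have "0 < (\<Prod>p<d. T p p)" using T(1) by (intro prod_pos) auto
  then show "0 < mass" by (simp add: m)
  have "(sqrt (2 * pi) ^ d)\<^sup>2 = (2 * pi) ^ d"
    by (simp add: power_mult[symmetric] mult.commute[of d]) (simp add: power_mult)
  then show "mass\<^sup>2 * Determinant.det (Matrix.mat d d (\<lambda>(p, q). form_coeff p q)) = (2 * pi) ^ d"
    using T(2) by (simp add: m power_mult_distrib mult_ac)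
qed

text \<open>Comparison with an isotropic Gaussian. A lower bound for \<open>mass\<close> is what
  turns the absolute error on the far part of the torus into a relative one.\<close>

lemma mass_ge:
  assumes A: "0 < A" and le: "\<And>t. form t \<le> A * (\<Sum>p<d. (t p)\<^sup>2)"
  shows "sqrt (2 * pi / A) ^ d \<le> mass"
proof -
  obtain T where nT: "normalizes T" using normal_coordinates by blast
  note T = normalizesD(1-3)[OF nT] and UT = normalizesD(4)[OF nT]
  have int: "integrable (Leb d) (\<lambda>t. exp (- form t / 2))"
    using integral_normal_coordinates(2)[OF T(1,3), of "\<lambda>_. 1 :: real"] by simp
  have "sqrt (2 * pi / A) ^ d = (\<integral>t. exp (- A * (\<Sum>p<d. (t p)\<^sup>2) / 2) \<partial>Leb d)"
    using integral_gauss_kernel_Leb(2)[OF A] by simp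
  also have "\<dots> \<le> mass"
    unfolding mass_def using le by (intro integral_mono integral_gauss_kernel_Leb(1)[OF A] int) auto
  finally show ?thesis .
qed

text \<open>Near the origin, i.e. for \<open>form t \<le> L\<close>, the integrand is compared with the Gaussian; far
  from it, it is dominated by \<open>exp (- form t / 5)\<close> or, near the boundary of the torus, by \<open>exp (- D)\<close>.\<close>

lemma integral_Psi:
  assumes L: "0 \<le> L" "K / r * L \<le> 1" "K / r * L\<^sup>2 / r \<le> B"
    and torus: "\<And>t. t \<in> box \<Longrightarrow> (\<forall>j<n. \<bar>U j t\<bar> \<le> 1) \<or> D \<le> (\<Sum>j<n. 2 * s j * (sin (U j t / 2))\<^sup>2)"
  shows "norm ((\<integral>t. Psi t \<partial>Leb d) - of_real mass) \<le>
    mass * ((3 * exp B + 8 / r) * n * (K / r)\<^sup>2 + 2 * exp (- L / 10) * sqrt 5 ^ d) + exp (- D) * (2 * pi) ^ d"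
proof -
  obtain T where nT: "normalizes T" using normal_coordinates by blast
  note T = normalizesD(1-3)[OF nT] and UT = normalizesD(4)[OF nT]
  define al where "al = (\<lambda>j q. \<Sum>p<d. a j p * T p q)"
  let ?S = "lower_tri d T"
  have US: "U j (?S x) = lin d (al j) x" for j x using UT by (simp add: al_def)
  have Ssp: "?S x \<in> space (Leb d)" for x by (auto simp: space_PiM lower_tri_def)
  have finZ: "finite Z" using Z finite_subset by blast
  have sumU_le: "(\<Sum>j<n. s j * (U j t)\<^sup>2) \<le> form t" for t
    by (simp add: form_def sum_nonneg)
  interpret gf: gaussian_forms d n al \<zeta> r "K / r"
  proof
    show "0 < r" "0 \<le> K / r" using r K by auto
    show "(\<Sum>j<n. s j * (lin d (al j) x)\<^sup>2) \<le> lin d x x" for x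
      using sumU_le[of "?S x"] by (simp add: US T(3))
    show "(lin d (al j) x)\<^sup>2 \<le> K / r * lin d x x" if "j < n" for j x
    proof -
      have "r * (\<Sum>i<n. (U i (?S x))\<^sup>2) \<le> (\<Sum>i<n. s i * (U i (?S x))\<^sup>2)"
        unfolding sum_distrib_left by (intro sum_mono mult_right_mono r_le) auto
      also have "\<dots> \<le> lin d x x" using sumU_le[of "?S x"] by (simp add: T(3))
      finally have "(\<Sum>i<n. (U i (?S x))\<^sup>2) \<le> lin d x x / r" using r by (simp add: field_simps)
      then have "K * (\<Sum>i<n. (U i (?S x))\<^sup>2) \<le> K * (lin d x x / r)" using K by (rule mult_left_mono)
      then show ?thesis using single[OF that, of "?S x"] by (simp add: US)
    qed
  qed (use \<zeta> r_le in auto)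
  define c where "c = (\<Prod>p<d. T p p) * sqrt (2 * pi) ^ d"
  have mass: "mass = c"
    using integral_normal_coordinates(1)[OF T(1,3), of "\<lambda>_. 1 :: real"] std_gauss.prob_space[of d]
    by (simp add: mass_def c_def)
  have c: "c > 0" using mass_sq(1) mass by simp
  \<comment> \<open>Both functions are taken relative to \<open>exp (- form t / 2)\<close>:
    \<open>H\<close> is the integrand, \<open>Hn\<close> a majorant for the region where only the
    factor \<open>exp (- D)\<close> is gained.\<close>
  define Hn where "Hn t = indicator box t * exp ((\<Sum>j<n. s j * (U j t)\<^sup>2) / 2)" for t
  define H where "H t = indicator box t *\<^sub>R ((\<Prod>j<n. bern_char (\<zeta> j) (U j t)) * of_real (exp ((\<Sum>j<n. s j * (U j t)\<^sup>2) / 2)))" for t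
  have [measurable]: "H \<in> borel_measurable (Leb d)" "Hn \<in> borel_measurable (Leb d)"
    unfolding H_def Hn_def bern_char_def by measurable
  have split: "exp (- form t / 2) * exp ((\<Sum>j<n. s j * (U j t)\<^sup>2) / 2) = exp (- (\<Sum>p\<in>Z. (t p)\<^sup>2) / 2)" for t
    unfolding exp_add[symmetric] form_def by (rule arg_cong[of _ _ exp]) (simp add: field_simps)
  have PsiH: "Psi t = exp (- form t / 2) *\<^sub>R H t" for t
    unfolding Psi_def H_def split[symmetric] by (simp add: scaleR_conv_of_real mult_ac)
  have HnE: "indicator box t * exp (- (\<Sum>p\<in>Z. (t p)\<^sup>2) / 2) = exp (- form t / 2) *\<^sub>R Hn t" for t
    unfolding Hn_def split[symmetric] by simp
  let ?r = "gf.ratio" and ?Z = "{x \<in> space (Leb d). lin d x x \<le> L}"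
  have HS: "H (?S x) = indicator box (?S x) *\<^sub>R ?r x" for x
    by (simp add: H_def gf.ratio_def US)
  have intPsi: "(\<integral>t. Psi t \<partial>Leb d) = c *\<^sub>R (\<integral>x. H (?S x) \<partial>std_gauss d)"
    unfolding PsiH c_def by (rule integral_normal_coordinates(1)[OF T(1,3)]) auto
  have intH: "integrable (std_gauss d) (\<lambda>x. H (?S x))"
    using integrable_Psi unfolding PsiH by (subst (asm) integral_normal_coordinates(2)[OF T(1,3)]) auto
  have intHn: "integrable (std_gauss d) (\<lambda>x. Hn (?S x))"
    using integral_box(1) unfolding HnE by (subst (asm) integral_normal_coordinates(2)[OF T(1,3)]) auto
  have valHn: "c * (\<integral>x. Hn (?S x) \<partial>std_gauss d) \<le> (2 * pi) ^ d"
    using integral_box(2) integral_normal_coordinates(1)[OF T(1,3), of Hn] unfolding HnE c_def by simp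
  have in_box: "?S x \<in> box" if x: "lin d x x \<le> L" for x
  proof -
    have "\<bar>U j (?S x)\<bar> \<le> 1" if j: "j < n" for j
    proof -
      have "(U j (?S x))\<^sup>2 \<le> K / r * lin d x x" unfolding US by (rule gf.single) fact
      also have "\<dots> \<le> 1" using mult_left_mono[OF x gf.\<kappa>] L by simp
      finally show ?thesis by (simp add: abs_square_le_1)
    qed
    then show ?thesis using small_forms[of "?S x"] Ssp by (auto simp: box_def)
  qed
  have sinsum: "norm (?r x) \<le> exp ((\<Sum>j<n. s j * (U j (?S x))\<^sup>2) / 2 - (\<Sum>j<n. 2 * s j * (sin (U j (?S x) / 2))\<^sup>2))" for x
  proof -
    have "(\<Prod>j<n. norm (bern_char (\<zeta> j) (U j (?S x)))) \<le> (\<Prod>j<n. exp (- 2 * s j * (sin (U j (?S x) / 2))\<^sup>2))"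
      using norm_bern_char_le[OF \<zeta>] by (intro prod_mono) auto
    also have "\<dots> = exp (- (\<Sum>j<n. 2 * s j * (sin (U j (?S x) / 2))\<^sup>2))"
      unfolding exp_sum[OF finite_lessThan, symmetric] sum_negf[symmetric]
      by (intro arg_cong[of _ _ exp] sum.cong refl) (simp add: algebra_simps)
    finally have "norm (?r x) \<le> exp (- (\<Sum>j<n. 2 * s j * (sin (U j (?S x) / 2))\<^sup>2)) * exp ((\<Sum>j<n. s j * (U j (?S x))\<^sup>2) / 2)"
      unfolding gf.ratio_def norm_mult US prod_norm[symmetric] norm_of_real abs_exp_cancel by (rule mult_right_mono) simp
    then show ?thesis by (simp add: exp_add[symmetric] algebra_simps)
  qed
  let ?R = "\<lambda>x. H (?S x) - indicator ?Z x *\<^sub>R ?r x"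
  let ?bd = "\<lambda>x. indicator {x. L < lin d x x} x * exp (3 / 10 * lin d x x) + exp (- D) * Hn (?S x)"
  have Rbd: "norm (?R x) \<le> ?bd x" if xsp: "x \<in> space (Leb d)" for x
  proof (cases "lin d x x \<le> L")
    case True
    then show ?thesis using in_box xsp by (simp add: HS Hn_def)
  next
    case F: False
    then have Req: "?R x = indicator box (?S x) *\<^sub>R ?r x" by (simp add: HS)
    show ?thesis
    proof (cases "?S x \<in> box")
      case False
      then show ?thesis using Req by (simp add: Hn_def)
    next
      case True
      from torus[OF this] show ?thesis
      proof
        assume small: "\<forall>j<n. \<bar>U j (?S x)\<bar> \<le> 1"
        have "(\<Sum>j<n. s j * (U j (?S x))\<^sup>2 / 5) \<le> (\<Sum>j<n. 2 * s j * (sin (U j (?S x) / 2))\<^sup>2)"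
        proof (rule sum_mono)
          fix j assume "j \<in> {..<n}"
          then have j: "j < n" by simp
          show "s j * (U j (?S x))\<^sup>2 / 5 \<le> 2 * s j * (sin (U j (?S x) / 2))\<^sup>2"
            using mult_left_mono[OF two_sin_half_sq_ge[of "U j (?S x)"] s_nonneg[OF j]] small j
            unfolding mult.assoc mult.left_commute[of 2 "s j"] times_divide_eq_right by blast
        qed
        \<comment> \<open>\<open>3 / 10 = 1 / 2 - 1 / 5\<close>: the growth from dividing by the
          Gaussian, reduced by the decay of the characteristic functions.\<close>
        then have "norm (?r x) \<le> exp (3 / 10 * (\<Sum>j<n. s j * (U j (?S x))\<^sup>2))"
          by (intro order_trans[OF sinsum]) (simp add: sum_divide_distrib[symmetric])
        also have "\<dots> \<le> exp (3 / 10 * lin d x x)"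
          using sumU_le[of "?S x"] by (simp add: T(3))
        finally show ?thesis using True F unfolding Req by (simp add: Hn_def add_increasing2)
      next
        assume "D \<le> (\<Sum>j<n. 2 * s j * (sin (U j (?S x) / 2))\<^sup>2)"
        then have "norm (?r x) \<le> exp (- D) * exp ((\<Sum>j<n. s j * (U j (?S x))\<^sup>2) / 2)"
          by (intro order_trans[OF sinsum]) (simp add: exp_add[symmetric])
        then show ?thesis using True F unfolding Req by (simp add: Hn_def add_increasing)
      qed
    qed
  qed
  note near = gf.integral_ratio_near_zero[OF L]
  \<comment> \<open>\<open>4 / 10\<close> lies between the growth rate \<open>3 / 10\<close> and the
    critical value \<open>1 / 2\<close>. The gap \<open>1 / 10\<close> is the decay rate in
    \<open>L\<close>, and \<open>1 - 8 / 10 = 1 / 5\<close> causes the factor \<open>sqrt 5\<close>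
    per coordinate.\<close>
  note tail = std_gauss_tail[of "3 / 10" "4 / 10" d L] std_gauss_tail[of 0 "4 / 10" d L]
  have sq5: "1 / sqrt (1 - 2 * (4 / 10)) = sqrt (5 :: real)" by (simp add: real_sqrt_divide)
  have intR: "integrable (std_gauss d) ?R" using intH near(1) by (intro Bochner_Integration.integrable_diff)
  have "norm (\<integral>x. ?R x \<partial>std_gauss d) \<le> (\<integral>x. norm (?R x) \<partial>std_gauss d)" by (rule integral_norm_bound)
  also have "\<dots> \<le> (\<integral>x. ?bd x \<partial>std_gauss d)"
    using tail(1) intHn Rbd by (intro integral_mono integrable_norm intR Bochner_Integration.integrable_add integrable_mult_right) auto
  also have "\<dots> = (\<integral>x. indicator {x. L < lin d x x} x * exp (3 / 10 * lin d x x) \<partial>std_gauss d) + exp (- D) * (\<integral>x. Hn (?S x) \<partial>std_gauss d)"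
    using tail(1) intHn by (subst Bochner_Integration.integral_add) (auto intro: integrable_mult_right)
  also have "\<dots> \<le> exp (- L / 10) * sqrt 5 ^ d + exp (- D) * (\<integral>x. Hn (?S x) \<partial>std_gauss d)"
    using tail(2) unfolding sq5 by simp
  finally have part1: "norm (\<integral>x. ?R x \<partial>std_gauss d) \<le> exp (- L / 10) * sqrt 5 ^ d + exp (- D) * (\<integral>x. Hn (?S x) \<partial>std_gauss d)" .
  have Zs: "?Z \<in> sets (std_gauss d)"
  proof -
    have [measurable]: "(\<lambda>x. lin d x x) \<in> borel_measurable (Leb d)" unfolding lin_def by measurable
    show ?thesis by simp
  qed
  have part2: "1 - measure (std_gauss d) ?Z \<le> exp (- L / 10) * sqrt 5 ^ d"
  proof -
    have "1 - measure (std_gauss d) ?Z = measure (std_gauss d) (space (std_gauss d) - ?Z)"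
      using std_gauss.prob_compl[OF Zs] by simp
    also have "space (std_gauss d) - ?Z = {x \<in> space (Leb d). L < lin d x x}" by auto
    also have "measure (std_gauss d) {x \<in> space (Leb d). L < lin d x x} =
        (\<integral>x. indicator {x. L < lin d x x} x * exp (0 * lin d x x) \<partial>std_gauss d)"
      by (subst Bochner_Integration.integral_cong[where g = "indicator {x \<in> space (Leb d). L < lin d x x}"])
        (auto simp: indicator_def Int_def intro!: arg_cong[of _ _ "measure (std_gauss d)"])
    also have "\<dots> \<le> exp (- (4 / 10 - 0) * L) * sqrt 5 ^ d"
      using tail(4) unfolding sq5 by simp
    also have "\<dots> \<le> exp (- L / 10) * sqrt 5 ^ d" using L(1) by (intro mult_right_mono) auto
    finally show ?thesis .
  qed
  have tri: "norm (A + B - C) \<le> a + b + c" if "norm A \<le> a" "norm B \<le> b" "norm C \<le> c" for A B C :: complex and a b c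
    using norm_triangle_ineq4[of "A + B" C] norm_triangle_ineq[of A B] that by linarith
  \<comment> \<open>The three errors are the part outside the ball, the expansion inside it, and the
    Gaussian probability of its complement.\<close>
  have dec: "(\<integral>x. H (?S x) \<partial>std_gauss d) - 1 = (\<integral>x. ?R x \<partial>std_gauss d) +
      ((\<integral>x. indicator ?Z x *\<^sub>R ?r x \<partial>std_gauss d) - of_real (measure (std_gauss d) ?Z)) -
      of_real (1 - measure (std_gauss d) ?Z)"
    using intH near(1) by (simp add: Bochner_Integration.integral_diff)
  have part3: "norm (complex_of_real (1 - measure (std_gauss d) ?Z)) \<le> exp (- L / 10) * sqrt 5 ^ d"
    using part2 std_gauss.prob_le_1[of d ?Z] by (simp del: of_real_diff)
  have regroup: "x + y + z + x = z + 2 * x + y" for x y z :: real by simp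
  have main: "norm ((\<integral>x. H (?S x) \<partial>std_gauss d) - 1) \<le>
      (3 * exp B + 8 / r) * n * (K / r)\<^sup>2 + 2 * exp (- L / 10) * sqrt 5 ^ d + exp (- D) * (\<integral>x. Hn (?S x) \<partial>std_gauss d)"
    using tri[OF part1 near(2) part3] unfolding dec[symmetric] regroup mult.assoc .
  have distrib: "a * (b + x * y) = a * b + x * (a * y)" for a b x y :: real
    by (simp add: algebra_simps)
  let ?I = "\<integral>x. H (?S x) \<partial>std_gauss d" and ?J = "\<integral>x. Hn (?S x) \<partial>std_gauss d"
    and ?e = "(3 * exp B + 8 / r) * n * (K / r)\<^sup>2 + 2 * exp (- L / 10) * sqrt 5 ^ d"
  have "(\<integral>t. Psi t \<partial>Leb d) - of_real mass = c *\<^sub>R (?I - 1)"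
    unfolding intPsi scaleR_diff_right by (simp add: mass scaleR_conv_of_real)
  then have 1: "norm ((\<integral>t. Psi t \<partial>Leb d) - of_real mass) = c * norm (?I - 1)"
    using c by (simp only: norm_scaleR abs_of_pos)
  have 2: "c * norm (?I - 1) \<le> c * (?e + exp (- D) * ?J)"
    using main less_imp_le[OF c] by (rule mult_left_mono)
  have 3: "c * (?e + exp (- D) * ?J) = c * ?e + exp (- D) * (c * ?J)"
    by (rule distrib)
  have 4: "c * ?e + exp (- D) * (c * ?J) \<le> c * ?e + exp (- D) * (2 * pi) ^ d"
    by (rule add_left_mono[OF mult_left_mono[OF valHn]]) simp
  show ?thesis
    unfolding 1 unfolding mass by (rule order_trans[OF 2[unfolded 3] 4])
qed

end

section \<open>Sums over multi-indices\<close>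

definition form_value :: "(nat \<Rightarrow> nat \<Rightarrow> real) \<Rightarrow> nat list \<Rightarrow> real" where
  "form_value x m = (\<Sum>j<length m. x j (m ! j))"

lemma form_value_update:
  "l < length m \<Longrightarrow> form_value x (m[l := c]) = form_value x m + x l c - x l (m ! l)"
  unfolding form_value_def length_list_update
  by (subst (1 2) sum.remove[of _ l]) (auto intro!: sum.cong)

text \<open>Because \<open>form_value\<close> is a sum of functions of single indices, replacing the
  indices of \<open>m'\<close> one at a time changes the value by amounts that add up to the full
  difference.\<close>

lemma form_value_decompose:
  assumes "length m = length m'"
  shows "form_value x m = (\<Sum>l<length m. form_value x (m'[l := m ! l])) - (real (length m) - 1) * form_value x m'"
proof -
  have "(\<Sum>l<length m. form_value x (m'[l := m ! l])) = (\<Sum>l<length m. form_value x m' + (x l (m ! l) - x l (m' ! l)))"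
    using assms by (intro sum.cong) (auto simp: form_value_update)
  also have "\<dots> = real (length m) * form_value x m' + (form_value x m - form_value x m')"
    using assms by (simp add: sum.distrib sum_subtractf form_value_def)
  finally show ?thesis by (simp add: algebra_simps)
qed

text \<open>On a slice with fixed \<open>l\<close>-th index the update is injective, so its
  contribution is at most the full sum; there are \<open>ks ! l\<close> slices.\<close>

lemma sum_update_le:
  fixes f :: "nat list \<Rightarrow> real"
  assumes l: "l < length ks" "c < ks ! l" and f: "\<And>m. 0 \<le> f m"
  shows "(\<Sum>m\<in>set (multi_indices ks). f (m[l := c])) \<le> real (ks ! l) * (\<Sum>m\<in>set (multi_indices ks). f m)"
proof -
  let ?M = "set (multi_indices ks)"
  have "(\<Sum>m\<in>?M. f (m[l := c])) = (\<Sum>e\<in>{..<ks ! l}. \<Sum>m\<in>{m \<in> ?M. m ! l = e}. f (m[l := c]))"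
  proof (rule sum.group[symmetric])
    show "(\<lambda>m. m ! l) ` ?M \<subseteq> {..<ks ! l}" using l by (auto simp: set_multi_indices)
  qed auto
  also have "\<dots> \<le> (\<Sum>e\<in>{..<ks ! l}. \<Sum>m\<in>?M. f m)"
  proof (rule sum_mono)
    fix e
    have inj: "inj_on (\<lambda>m. m[l := c]) {m \<in> ?M. m ! l = e}"
      by (rule inj_on_inverseI[of _ "\<lambda>m. m[l := e]"]) auto
    have "(\<Sum>m\<in>{m \<in> ?M. m ! l = e}. f (m[l := c])) = (\<Sum>m\<in>(\<lambda>m. m[l := c]) ` {m \<in> ?M. m ! l = e}. f m)"
      by (simp add: sum.reindex[OF inj] o_def)
    also have "\<dots> \<le> (\<Sum>m\<in>?M. f m)"
    proof (rule sum_mono2)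
      show "(\<lambda>m. m[l := c]) ` {m \<in> ?M. m ! l = e} \<subseteq> ?M"
        using l by (auto simp: set_multi_indices nth_list_update)
    qed (use f in auto)
    finally show "(\<Sum>m\<in>{m \<in> ?M. m ! l = e}. f (m[l := c])) \<le> (\<Sum>m\<in>?M. f m)" .
  qed
  finally show ?thesis by simp
qed

lemma prod_list_pos_nat:
  fixes ks :: "nat list"
  assumes "\<And>j. j < length ks \<Longrightarrow> 0 < ks ! j"
  shows "0 < prod_list ks"
proof (rule ccontr)
  assume "\<not> 0 < prod_list ks"
  then have "0 \<in> set ks" by (simp add: prod_list_zero_iff)
  then show False using assms by (metis in_set_conv_nth less_irrefl)
qed

lemma sum_multi_indices:
  "(\<Sum>i<prod_list ks. f (multi_indices ks ! i)) = (\<Sum>m\<in>set (multi_indices ks). f m)"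
  by (rule sum.reindex_bij_betw)
    (metis bij_betw_nth distinct_multi_indices length_multi_indices)

text \<open>Averaging the decomposition of \<open>form_value x m\<close> over all \<open>m'\<close>: each multi-index arises from
  at most \<open>ks ! l\<close> of the updates \<open>m'[l := m ! l]\<close>.\<close>

lemma form_value_sq_le:
  fixes h :: "real \<Rightarrow> real"
  assumes h0: "\<And>y. 0 \<le> h y" and hm: "\<And>y. h (- y) = h y" and hadd: "\<And>y z. h (y + z) \<le> h y + h z" and hz: "h 0 = 0"
    and ks: "length ks = \<nu>" "0 < \<nu>" "\<And>j. j < \<nu> \<Longrightarrow> real (ks ! j) \<le> k" "1 \<le> k"
    and m: "m \<in> set (multi_indices ks)"
  shows "real (prod_list ks) * (h (form_value x m))\<^sup>2 \<le>
    4 * (real \<nu>)\<^sup>2 * k * (\<Sum>m'\<in>set (multi_indices ks). (h (form_value x m'))\<^sup>2)"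
proof -
  let ?M = "set (multi_indices ks)" and ?u = "form_value x"
  have lenm: "length m = \<nu>" using m ks by (simp add: set_multi_indices)
  have hsum: "h (\<Sum>l\<in>A. y l) \<le> (\<Sum>l\<in>A. h (y l))" if "finite A" for A :: "nat set" and y
    using that by (induction A rule: finite_induct) (auto simp: hz intro: order_trans[OF hadd])
  have hmult: "h (real i * y) \<le> real i * h y" for i y
    using hsum[of "{..<i}" "\<lambda>_. y"] by simp
  have bound: "(h (?u m))\<^sup>2 \<le> 2 * real \<nu> * (\<Sum>l<\<nu>. (h (?u (m'[l := m ! l])))\<^sup>2) + 2 * (real \<nu>)\<^sup>2 * (h (?u m'))\<^sup>2"
    if m': "m' \<in> ?M" for m'
  proof -
    have len: "length m' = \<nu>" using m' ks by (simp add: set_multi_indices)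
    let ?A = "\<Sum>l<\<nu>. h (?u (m'[l := m ! l]))" and ?C = "real \<nu> * h (?u m')"
    have "?u m = (\<Sum>l<\<nu>. ?u (m'[l := m ! l])) + - (real (\<nu> - 1) * ?u m')"
      using form_value_decompose[of m m' x] len lenm ks(2) by (simp add: of_nat_diff)
    then have "h (?u m) \<le> h (\<Sum>l<\<nu>. ?u (m'[l := m ! l])) + h (real (\<nu> - 1) * ?u m')"
      using hadd hm by metis
    also have "\<dots> \<le> ?A + real (\<nu> - 1) * h (?u m')" by (intro add_mono hsum hmult) auto
    also have "\<dots> \<le> ?A + ?C" using h0 by (intro add_mono mult_right_mono) auto
    finally have "(h (?u m))\<^sup>2 \<le> (?A + ?C)\<^sup>2" using h0 by (intro power_mono) auto
    also have "\<dots> \<le> 2 * ?A\<^sup>2 + 2 * ?C\<^sup>2"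
      using sum_squares_bound[of ?A ?C] by (simp add: power2_sum)
    also have "?A\<^sup>2 \<le> real \<nu> * (\<Sum>l<\<nu>. (h (?u (m'[l := m ! l])))\<^sup>2)"
      using sum_squared_le_sum_of_squares[of "\<lambda>l. h (?u (m'[l := m ! l]))" "{..<\<nu>}"] by (simp add: mult.commute)
    finally show ?thesis by (simp add: power_mult_distrib)
  qed
  let ?S = "\<Sum>m'\<in>?M. (h (?u m'))\<^sup>2"
  have S0: "0 \<le> ?S" by (intro sum_nonneg) auto
  have sub: "(\<Sum>l<\<nu>. \<Sum>m'\<in>?M. (h (?u (m'[l := m ! l])))\<^sup>2) \<le> (\<Sum>l<\<nu>. k * ?S)"
  proof (rule sum_mono)
    fix l assume "l \<in> {..<\<nu>}"
    then have l: "l < length ks" "m ! l < ks ! l" "real (ks ! l) \<le> k" using m ks by (auto simp: set_multi_indices)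
    have "(\<Sum>m'\<in>?M. (h (?u (m'[l := m ! l])))\<^sup>2) \<le> real (ks ! l) * ?S"
      using l by (intro sum_update_le[where f = "\<lambda>m'. (h (?u m'))\<^sup>2"]) auto
    also have "\<dots> \<le> k * ?S" using l S0 by (intro mult_right_mono)
    finally show "(\<Sum>m'\<in>?M. (h (?u (m'[l := m ! l])))\<^sup>2) \<le> k * ?S" .
  qed
  have "real (prod_list ks) * (h (?u m))\<^sup>2 = (\<Sum>m'\<in>?M. (h (?u m))\<^sup>2)"
    using distinct_card[OF distinct_multi_indices[of ks]] by (simp add: length_multi_indices)
  also have "\<dots> \<le> (\<Sum>m'\<in>?M. 2 * real \<nu> * (\<Sum>l<\<nu>. (h (?u (m'[l := m ! l])))\<^sup>2) + 2 * (real \<nu>)\<^sup>2 * (h (?u m'))\<^sup>2)"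
    using bound by (rule sum_mono)
  also have "\<dots> = 2 * real \<nu> * (\<Sum>l<\<nu>. \<Sum>m'\<in>?M. (h (?u (m'[l := m ! l])))\<^sup>2) + 2 * (real \<nu>)\<^sup>2 * ?S"
    by (simp add: sum.distrib sum_distrib_left sum.swap[of _ ?M "{..<\<nu>}"])
  also have "\<dots> \<le> 2 * real \<nu> * (\<Sum>l<\<nu>. k * ?S) + 2 * (real \<nu>)\<^sup>2 * ?S"
    using sub by (intro add_right_mono mult_left_mono) auto
  \<comment> \<open>The updates contribute \<open>2 * \<nu>\<^sup>2 * k\<close> and the term at
    \<open>m'\<close> contributes \<open>2 * \<nu>\<^sup>2\<close>, which \<open>1 \<le> k\<close>
    makes comparable.\<close>
  also have "\<dots> \<le> 4 * (real \<nu>)\<^sup>2 * k * ?S"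
  proof -
    have "1 * ((real \<nu>)\<^sup>2 * ?S) \<le> k * ((real \<nu>)\<^sup>2 * ?S)"
      using ks(4) S0 by (intro mult_right_mono) auto
    then show ?thesis by (simp add: power2_eq_square mult_ac)
  qed
  finally show ?thesis .
qed

section \<open>Size modulo 2\<pi>\<close>

lemma abs_sin_half_add: "\<bar>sin ((y + z) / 2)\<bar> \<le> \<bar>sin (y / 2)\<bar> + \<bar>sin (z / 2)\<bar>" for y z :: real
proof -
  have "\<bar>sin ((y + z) / 2)\<bar> \<le> \<bar>sin (y / 2)\<bar> * \<bar>cos (z / 2)\<bar> + \<bar>cos (y / 2)\<bar> * \<bar>sin (z / 2)\<bar>"
    unfolding add_divide_distrib sin_add abs_mult[symmetric] by (rule abs_triangle_ineq)
  also have "\<dots> \<le> \<bar>sin (y / 2)\<bar> * 1 + 1 * \<bar>sin (z / 2)\<bar>"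
    by (intro add_mono mult_mono) auto
  finally show ?thesis by simp
qed

text \<open>The sine of \<open>y / 2\<close> is small near 0 and near 2\<pi>; the a priori bound on
  \<open>y\<close> excludes the second case.\<close>

lemma abs_le_of_abs_sin_half_le:
  fixes y \<delta> :: real
  assumes "0 < \<delta>" "\<delta> \<le> 1" "\<bar>y\<bar> < 2 * pi - \<delta>" "\<bar>sin (y / 2)\<bar> \<le> sin (\<delta> / 2)"
  shows "\<bar>y\<bar> \<le> \<delta>"
proof (rule ccontr)
  assume "\<not> \<bar>y\<bar> \<le> \<delta>"
  then have y: "\<delta> / 2 < \<bar>y\<bar> / 2" "\<bar>y\<bar> / 2 < pi - \<delta> / 2" using assms by auto
  have sy: "sin (\<bar>y\<bar> / 2) \<le> sin (\<delta> / 2)"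
    using assms(4) by (simp add: abs_if split: if_splits)
  have "sin (\<delta> / 2) < sin (\<bar>y\<bar> / 2)"
  proof (cases "\<bar>y\<bar> / 2 \<le> pi / 2")
    case True
    then show ?thesis using y assms pi_gt3 by (intro sin_monotone_2pi) auto
  next
    case False
    have "sin (\<delta> / 2) < sin (pi - \<bar>y\<bar> / 2)"
      using y assms pi_gt3 False by (intro sin_monotone_2pi) auto
    then show ?thesis by simp
  qed
  then show False using sy by simp
qed

text \<open>The last index of every block except the first: since all blocks of equations have the
  same total, one equation of each further block follows from the others.\<close>

definition dropped :: "nat list \<Rightarrow> nat set" where
  "dropped ks = {p. \<exists>j\<in>{2..length ks}. p = sum_list (take j ks) - 1}"

definition red_coeff :: "nat list \<Rightarrow> nat \<Rightarrow> nat \<Rightarrow> real" where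
  "red_coeff ks i p = (if p \<in> dropped ks then 0 else transportation_mat ks $$ (p, i))"

text \<open>Reading \<open>t\<close> as one function per direction turns the linear forms into
  values of \<open>form_value\<close>. Setting the last value of each further direction to 0 fixes
  the freedom of shifting constants between directions.\<close>

definition block_value :: "nat list \<Rightarrow> (nat \<Rightarrow> real) \<Rightarrow> nat \<Rightarrow> nat \<Rightarrow> real" where
  "block_value ks t j m = (let p = sum_list (take j ks) + m in if p \<in> dropped ks then 0 else t p)"

lemma sum_positions:
  fixes f :: "nat \<Rightarrow> 'a::comm_monoid_add"
  shows "(\<Sum>p<sum_list ks. f p) = (\<Sum>j<length ks. \<Sum>m<ks ! j. f (sum_list (take j ks) + m))"
proof -
  let ?g = "\<lambda>(j, m). sum_list (take j ks) + m"
  have bij: "bij_betw ?g (SIGMA j:{..<length ks}. {..<ks ! j}) {..<sum_list ks}"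
    unfolding bij_betw_def
  proof
    show "inj_on ?g (SIGMA j:{..<length ks}. {..<ks ! j})"
    proof (rule inj_onI; clarsimp)
      fix j m j' m' assume *: "j < length ks" "m < ks ! j" "j' < length ks" "m' < ks ! j'"
        "sum_list (take j ks) + m = sum_list (take j' ks) + m'"
      show "j = j' \<and> m = m'" using position_inj[OF *] by blast
    qed
    show "?g ` (SIGMA j:{..<length ks}. {..<ks ! j}) = {..<sum_list ks}"
      using position_bound[of _ ks] position_split[of _ ks] by (force simp: image_iff)
  qed
  show ?thesis
    unfolding sum.reindex_bij_betw[OF bij, symmetric]
    by (subst sum.Sigma) (auto simp: case_prod_beta)
qed

context
  fixes ks :: "nat list"
  assumes pos: "\<And>j. j < length ks \<Longrightarrow> 0 < ks ! j" and len: "0 < length ks"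
begin

lemma last_position:
  assumes "j \<in> {2..length ks}"
  shows "sum_list (take j ks) - 1 = sum_list (take (j - 1) ks) + (ks ! (j - 1) - 1)" "j - 1 < length ks" "0 < j - 1"
proof -
  show "j - 1 < length ks" "0 < j - 1" using assms by auto
  then have "take j ks = take (j - 1) ks @ [ks ! (j - 1)]"
    using take_Suc_conv_app_nth[of "j - 1" ks] by simp
  then show "sum_list (take j ks) - 1 = sum_list (take (j - 1) ks) + (ks ! (j - 1) - 1)"
    using pos[of "j - 1"] \<open>j - 1 < length ks\<close> by simp
qed

lemma position_dropped:
  assumes "j < length ks" "m < ks ! j"
  shows "sum_list (take j ks) + m \<in> dropped ks \<longleftrightarrow> 0 < j \<and> m = ks ! j - 1"
proof
  assume "sum_list (take j ks) + m \<in> dropped ks"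
  then obtain j' where j': "j' \<in> {2..length ks}" "sum_list (take j ks) + m = sum_list (take j' ks) - 1"
    by (auto simp: dropped_def)
  note lp = last_position[OF j'(1)]
  have lt: "ks ! (j' - 1) - 1 < ks ! (j' - 1)" using pos[OF lp(2)] by simp
  have "j = j' - 1" "m = ks ! (j' - 1) - 1"
    using position_inj[OF assms lp(2) lt j'(2)[unfolded lp(1)]] by blast+
  then show "0 < j \<and> m = ks ! j - 1" using lp by simp
next
  assume "0 < j \<and> m = ks ! j - 1"
  then show "sum_list (take j ks) + m \<in> dropped ks"
    using last_position(1)[of "Suc j"] assms by (auto simp: dropped_def intro!: bexI[of _ "Suc j"])
qed

lemma dropped_subset: "dropped ks \<subseteq> {..<sum_list ks}"
proof
  fix p assume "p \<in> dropped ks"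
  then obtain j where j: "j \<in> {2..length ks}" "p = sum_list (take j ks) - 1" by (auto simp: dropped_def)
  show "p \<in> {..<sum_list ks}"
    using last_position[OF j(1)] j(2) position_bound[of "j - 1" ks "ks ! (j - 1) - 1"] pos[of "j - 1"] by simp
qed

lemma card_dropped: "card (dropped ks) = length ks - 1"
proof -
  have "dropped ks = (\<lambda>j. sum_list (take j ks) - 1) ` {2..length ks}" by (auto simp: dropped_def)
  moreover have "inj_on (\<lambda>j. sum_list (take j ks) - 1) {2..length ks}"
  proof (rule inj_onI)
    fix i j assume ij: "i \<in> {2..length ks}" "j \<in> {2..length ks}" "sum_list (take i ks) - 1 = sum_list (take j ks) - 1"
    note li = last_position[OF ij(1)] and lj = last_position[OF ij(2)]
    have lt: "ks ! (i - 1) - 1 < ks ! (i - 1)" "ks ! (j - 1) - 1 < ks ! (j - 1)"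
      using pos[OF li(2)] pos[OF lj(2)] by simp_all
    have "i - 1 = j - 1"
      using position_inj(1)[OF li(2) lt(1) lj(2) lt(2) ij(3)[unfolded li(1) lj(1)]] .
    then show "i = j" using ij by auto
  qed
  ultimately show ?thesis by (simp add: card_image)
qed

lemma lin_red_coeff:
  assumes i: "i < prod_list ks"
  shows "lin (sum_list ks) (red_coeff ks i) t = form_value (block_value ks t) (multi_indices ks ! i)"
proof -
  let ?m = "multi_indices ks ! i"
  have lenm: "length ?m = length ks"
    using nth_mem[of i "multi_indices ks"] i length_multi_indices[of ks] by (auto simp: set_multi_indices)
  have "lin (sum_list ks) (red_coeff ks i) t = (\<Sum>j<length ks. \<Sum>m<ks ! j. if m = ?m ! j then block_value ks t j m else 0)"
    unfolding lin_def sum_positions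
    using i by (intro sum.cong refl) (auto simp: red_coeff_def block_value_def transportation_mat_nth Let_def)
  also have "\<dots> = (\<Sum>j<length ks. block_value ks t j (?m ! j))"
    using multi_indices_nth_less[OF i] by (intro sum.cong refl) simp
  finally show ?thesis by (simp add: form_value_def lenm)
qed

text \<open>A base point at which every direction but the first contributes 0. Changing one of its
  indices therefore isolates a single block value, up to the fixed contribution of direction 0 when
  another direction is changed.\<close>

definition last_index :: "nat list" where
  "last_index = map (\<lambda>k. k - 1) ks"

lemma last_index_mem: "last_index \<in> set (multi_indices ks)"
  using pos by (auto simp: last_index_def set_multi_indices)

lemma update_mem: "l < length ks \<Longrightarrow> c < ks ! l \<Longrightarrow> m \<in> set (multi_indices ks) \<Longrightarrow> m[l := c] \<in> set (multi_indices ks)"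
  by (auto simp: set_multi_indices nth_list_update)

lemma block_value_last: "0 < j \<Longrightarrow> j < length ks \<Longrightarrow> block_value ks t j (ks ! j - 1) = 0"
  using position_dropped[of j "ks ! j - 1"] pos[of j] by (simp add: block_value_def Let_def)

lemma form_value_last: "form_value (block_value ks t) last_index = block_value ks t 0 (ks ! 0 - 1)"
proof -
  have "form_value (block_value ks t) last_index = (\<Sum>j<length ks. if j = 0 then block_value ks t 0 (ks ! 0 - 1) else 0)"
    unfolding form_value_def last_index_def length_map
    by (intro sum.cong refl) (auto simp: block_value_last[simplified])
  then show ?thesis using len by simp
qed

lemma form_value_first:
  "c < ks ! 0 \<Longrightarrow> form_value (block_value ks t) (last_index[0 := c]) = block_value ks t 0 c"
  using form_value_update[of 0 last_index "block_value ks t" c] form_value_last[of t] len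
  by (simp add: last_index_def)

lemma form_value_other:
  "0 < l \<Longrightarrow> l < length ks \<Longrightarrow> form_value (block_value ks t) (last_index[l := c]) =
    block_value ks t 0 (ks ! 0 - 1) + block_value ks t l c"
  using form_value_update[of l last_index "block_value ks t" c] form_value_last[of t] block_value_last[of l t]
  by (simp add: last_index_def)

lemma block_value_le_of_form_value_le:
  assumes "\<And>m. m \<in> set (multi_indices ks) \<Longrightarrow> \<bar>form_value (block_value ks t) m\<bar> \<le> e"
    and "l < length ks" "c < ks ! l"
  shows "\<bar>block_value ks t l c\<bar> \<le> 2 * e"
proof (cases "l = 0")
  case True
  then show ?thesis
    using assms(1)[OF update_mem[OF _ _ last_index_mem, of 0 c]] form_value_first[of c t] assms len by force
next
  case False
  have "\<bar>block_value ks t 0 (ks ! 0 - 1)\<bar> \<le> e"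
    using assms(1)[OF last_index_mem] by (simp add: form_value_last)
  moreover have "\<bar>block_value ks t 0 (ks ! 0 - 1) + block_value ks t l c\<bar> \<le> e"
    using assms(1)[OF update_mem[OF assms(2,3) last_index_mem]] form_value_other[of l t c] assms(2) False by simp
  ultimately show ?thesis by linarith
qed

text \<open>The sines control the forms only modulo 2\<pi>, so winding must be excluded. A value of
  the first direction is itself a form and lies in \<open>[-pi, pi]\<close>, hence is at most
  \<open>\<delta>\<close>. A form isolating another direction is then a coordinate in
  \<open>[-pi, pi]\<close> plus at most \<open>\<delta>\<close>, again away from 2\<pi>. So every
  block value is at most \<open>2 * \<delta>\<close>.\<close>

lemma form_value_le_of_sin_le:
  assumes t: "\<And>p. p < sum_list ks \<Longrightarrow> p \<notin> dropped ks \<Longrightarrow> \<bar>t p\<bar> \<le> pi"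
    and \<delta>: "0 < \<delta>" "\<delta> \<le> 1"
    and small: "\<And>m. m \<in> set (multi_indices ks) \<Longrightarrow> \<bar>sin (form_value (block_value ks t) m / 2)\<bar> \<le> sin (\<delta> / 2)"
    and m: "m \<in> set (multi_indices ks)"
  shows "\<bar>form_value (block_value ks t) m\<bar> \<le> 2 * real (length ks) * \<delta>"
proof -
  have bv: "\<bar>block_value ks t l c\<bar> \<le> pi" if "l < length ks" "c < ks ! l" for l c
    using t position_bound[OF that] by (auto simp: block_value_def Let_def)
  have first: "\<bar>block_value ks t 0 c\<bar> \<le> \<delta>" if c: "c < ks ! 0" for c
  proof (rule abs_le_of_abs_sin_half_le[OF \<delta>])
    show "\<bar>block_value ks t 0 c\<bar> < 2 * pi - \<delta>" using bv[OF len c] pi_gt3 \<delta> by linarith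
    show "\<bar>sin (block_value ks t 0 c / 2)\<bar> \<le> sin (\<delta> / 2)"
      using small[OF update_mem[OF len c last_index_mem]] form_value_first[OF c, of t] by simp
  qed
  have all: "\<bar>block_value ks t l c\<bar> \<le> 2 * \<delta>" if l: "l < length ks" "c < ks ! l" for l c
  proof (cases "l = 0")
    case True
    then show ?thesis using first[of c] l \<delta> by simp
  next
    case False
    let ?v = "block_value ks t 0 (ks ! 0 - 1) + block_value ks t l c"
    have f: "\<bar>block_value ks t 0 (ks ! 0 - 1)\<bar> \<le> \<delta>" using first[of "ks ! 0 - 1"] pos[OF len] by simp
    have "\<bar>?v\<bar> \<le> \<delta>"
    proof (rule abs_le_of_abs_sin_half_le[OF \<delta>])
      show "\<bar>?v\<bar> < 2 * pi - \<delta>" using bv[OF l] f pi_gt3 \<delta> by linarith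
      show "\<bar>sin (?v / 2)\<bar> \<le> sin (\<delta> / 2)"
        using small[OF update_mem[OF l last_index_mem]] form_value_other[of l t c] l False by simp
    qed
    then show ?thesis using f by linarith
  qed
  have "\<bar>form_value (block_value ks t) m\<bar> \<le> (\<Sum>j<length m. \<bar>block_value ks t j (m ! j)\<bar>)"
    unfolding form_value_def by (rule sum_abs)
  also have "\<dots> \<le> (\<Sum>j<length m. 2 * \<delta>)"
    using m by (intro sum_mono all) (auto simp: set_multi_indices)
  finally show ?thesis using m by (simp add: set_multi_indices mult_ac)
qed

end

section \<open>Fourier inversion\<close>

lemma integral_iexp_int:
  fixes c :: real
  assumes "c \<in> \<int>"
  shows "integrable lborel (\<lambda>y. indicator {- pi..pi} y *\<^sub>R iexp (c * y))"
    and "(\<integral>y. indicator {- pi..pi} y *\<^sub>R iexp (c * y) \<partial>lborel) = (if c = 0 then 2 * pi else 0)"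
proof -
  have cont: "continuous_on {- pi..pi} (\<lambda>y. iexp (c * y))" by (intro continuous_intros)
  show "integrable lborel (\<lambda>y. indicator {- pi..pi} y *\<^sub>R iexp (c * y))"
    using borel_integrable_compact[OF compact_Icc cont] by simp
  show "(\<integral>y. indicator {- pi..pi} y *\<^sub>R iexp (c * y) \<partial>lborel) = (if c = 0 then 2 * pi else 0)"
  proof (cases "c = 0")
    case True
    then show ?thesis by (simp add: scaleR_conv_of_real)
  next
    case False
    let ?F = "\<lambda>y. iexp (c * y) / (\<i> * of_real c)"
    have "(\<integral>y. indicator {- pi..pi} y *\<^sub>R iexp (c * y) \<partial>lborel) = ?F pi - ?F (- pi)"
    proof (rule integral_FTC_Icc)
      fix y
      have "((\<lambda>z. exp (\<i> * of_real c * z) / (\<i> * of_real c)) has_field_derivative exp (\<i> * of_real c * of_real y))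
          (at (of_real y))"
        using False by (auto intro!: derivative_eq_intros)
      from has_vector_derivative_real_field[OF this, of "{- pi..pi}"]
      show "(?F has_vector_derivative iexp (c * y)) (at y within {- pi..pi})"
        by (simp add: mult.assoc)
    qed (use cont in auto)
    also have "iexp (c * pi) = iexp (c * (- pi))"
    proof -
      obtain k where "c = of_int k" using assms Ints_cases by blast
      then have "sin (c * pi) = 0" using sin_zero_iff_int2 by blast
      then have "cis (c * pi) = cis (c * (- pi))" by (simp add: complex_eq_iff)
      then show ?thesis by (simp only: cis_conv_exp)
    qed
    finally show ?thesis using False by simp
  qed
qed

context lattice_forms
begin

lemma integral_character:
  fixes c :: "nat \<Rightarrow> real"
  assumes "\<And>p. p < d \<Longrightarrow> p \<notin> Z \<Longrightarrow> c p \<in> \<int>"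
  defines "f \<equiv> (\<lambda>t. indicator box t *\<^sub>R (iexp (\<Sum>p\<in>{..<d} - Z. c p * t p) * of_real (exp (- (\<Sum>p\<in>Z. (t p)\<^sup>2) / 2))))"
  shows "integrable (Leb d) f"
    and "(\<integral>t. f t \<partial>Leb d) = (if \<forall>p<d. p \<notin> Z \<longrightarrow> c p = 0 then of_real ((2 * pi) ^ (d - card Z) * sqrt (2 * pi) ^ card Z) else 0)"
proof -
  define h :: "nat \<Rightarrow> real \<Rightarrow> complex" where
    "h p y = (if p \<in> Z then of_real (exp (- y\<^sup>2 / 2)) else indicator {- pi..pi} y *\<^sub>R iexp (c p * y))" for p y
  have finZ: "finite Z" using Z finite_subset by blast
  have Zd: "{..<d} \<inter> Z = Z" using Z by auto
  have split: "(\<Prod>p<d. if p \<in> Z then u p else v p) = prod u Z * prod v ({..<d} - Z)" for u v :: "nat \<Rightarrow> complex"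
  proof -
    have "{..<d} \<inter> - {p. p \<in> Z} = {..<d} - Z" by auto
    then show ?thesis using prod.If_cases[of "{..<d}" "\<lambda>p. p \<in> Z" u v] by (simp add: Zd)
  qed
  have eq: "f t = (\<Prod>p<d. h p (t p))" if t: "t \<in> space (Leb d)" for t
  proof -
    have "(\<Prod>p<d. h p (t p)) = (\<Prod>p\<in>Z. of_real (exp (- (t p)\<^sup>2 / 2))) *
        (\<Prod>p\<in>{..<d} - Z. indicator {- pi..pi} (t p) *\<^sub>R iexp (c p * t p))"
      unfolding h_def by (rule split)
    also have "(\<Prod>p\<in>Z. complex_of_real (exp (- (t p)\<^sup>2 / 2))) = of_real (exp (- (\<Sum>p\<in>Z. (t p)\<^sup>2) / 2))"
      unfolding of_real_prod[symmetric] using finZ by (simp add: exp_sum[symmetric] sum_negf sum_divide_distrib)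
    also have "(\<Prod>p\<in>{..<d} - Z. indicator {- pi..pi} (t p) *\<^sub>R iexp (c p * t p)) =
        indicator box t *\<^sub>R iexp (\<Sum>p\<in>{..<d} - Z. c p * t p)"
    proof (cases "t \<in> box")
      case True
      then have "(\<Prod>p\<in>{..<d} - Z. indicator {- pi..pi} (t p) *\<^sub>R iexp (c p * t p)) = (\<Prod>p\<in>{..<d} - Z. iexp (c p * t p))"
        by (intro prod.cong) (auto simp: box_def abs_le_iff)
      also have "\<dots> = iexp (\<Sum>p\<in>{..<d} - Z. c p * t p)"
        by (simp add: exp_sum[symmetric] sum_distrib_left)
      finally show ?thesis using True by simp
    next
      case False
      then obtain p where p: "p \<in> {..<d} - Z" "t p \<notin> {- pi..pi}" using t by (auto simp: box_def abs_le_iff)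
      have "(\<Prod>p\<in>{..<d} - Z. indicator {- pi..pi} (t p) *\<^sub>R iexp (c p * t p)) = 0"
        by (rule prod_zero, simp, rule bexI[of _ p]) (use p in auto)
      then show ?thesis using False by simp
    qed
    finally show ?thesis by (simp add: f_def mult.commute)
  qed
  have e: "exp (- y\<^sup>2 / 2) = sqrt (2 * pi) * normal_density 0 1 y" for y :: real
    by (simp add: normal_density_def)
  have int: "integrable lborel (h p)" if "p < d" for p
  proof (cases "p \<in> Z")
    case True
    then show ?thesis unfolding h_def e by simp
  next
    case False
    then show ?thesis unfolding h_def using integral_iexp_int(1)[OF assms(1)[OF that False]] by simp
  qed
  have val: "(\<integral>y. h p y \<partial>lborel) = (if p \<in> Z then of_real (sqrt (2 * pi)) else if c p = 0 then of_real (2 * pi) else 0)" if "p < d" for p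
  proof (cases "p \<in> Z")
    case True
    then show ?thesis unfolding h_def e by (simp add: integral_normal_density)
  next
    case False
    then show ?thesis unfolding h_def using integral_iexp_int(2)[OF assms(1)[OF that False]] by simp
  qed
  have "integrable (Leb d) (\<lambda>t. \<Prod>p<d. h p (t p))"
    using int by (intro lborel_prod.product_integrable_prod) auto
  then show "integrable (Leb d) f"
    by (rule Bochner_Integration.integrable_cong[THEN iffD2, rotated -1]) (use eq in auto)
  have "(\<integral>t. f t \<partial>Leb d) = (\<integral>t. (\<Prod>p<d. h p (t p)) \<partial>Leb d)"
    by (rule Bochner_Integration.integral_cong) (use eq in auto)
  also have "\<dots> = (\<Prod>p<d. integral\<^sup>L lborel (h p))"
    using int by (intro lborel_prod.product_integral_prod) auto
  also have "\<dots> = (\<Prod>p<d. if p \<in> Z then of_real (sqrt (2 * pi)) else if c p = 0 then of_real (2 * pi) else 0)"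
    using val by (intro prod.cong) auto
  also have "\<dots> = (\<Prod>p\<in>Z. of_real (sqrt (2 * pi))) * (\<Prod>p\<in>{..<d} - Z. if c p = 0 then of_real (2 * pi) else (0::complex))"
    by (rule split)
  also have "(\<Prod>p\<in>{..<d} - Z. if c p = 0 then of_real (2 * pi) else (0::complex)) =
      (if \<forall>p<d. p \<notin> Z \<longrightarrow> c p = 0 then of_real (2 * pi) ^ (d - card Z) else 0)"
  proof (cases "\<forall>p<d. p \<notin> Z \<longrightarrow> c p = 0")
    case True
    then have "(\<Prod>p\<in>{..<d} - Z. if c p = 0 then of_real (2 * pi) else (0::complex)) = (\<Prod>p\<in>{..<d} - Z. of_real (2 * pi))"
      by (intro prod.cong) auto
    also have "\<dots> = of_real (2 * pi) ^ (d - card Z)" using Z finZ by (simp add: card_Diff_subset)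
    finally show ?thesis using True by simp
  next
    case False
    then obtain p where p: "p \<in> {..<d} - Z" "c p \<noteq> 0" by auto
    have zero: "(\<Prod>p\<in>{..<d} - Z. if c p = 0 then of_real (2 * pi) else (0::complex)) = 0"
      by (rule prod_zero, simp, rule bexI[of _ p]) (use p in auto)
    show ?thesis unfolding zero using False by (simp only: if_False)
  qed
  finally have val_f: "(\<integral>t. f t \<partial>Leb d) = (\<Prod>p\<in>Z. of_real (sqrt (2 * pi))) *
      (if \<forall>p<d. p \<notin> Z \<longrightarrow> c p = 0 then of_real (2 * pi) ^ (d - card Z) else 0)" .
  show "(\<integral>t. f t \<partial>Leb d) = (if \<forall>p<d. p \<notin> Z \<longrightarrow> c p = 0 then of_real ((2 * pi) ^ (d - card Z) * sqrt (2 * pi) ^ card Z) else 0)"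
  proof (cases "\<forall>p<d. p \<notin> Z \<longrightarrow> c p = 0")
    case True
    show ?thesis unfolding val_f if_P[OF True] by (simp add: mult.commute)
  next
    case False
    show ?thesis unfolding val_f if_not_P[OF False] by simp
  qed
qed

text \<open>Expanding the product of characteristic functions over the set \<open>X\<close> of successes turns \<open>Psi\<close> into
  a combination of characters, of which only those with zero frequency survive.\<close>

lemma integral_Psi_eq_probability:
  assumes a0: "\<And>j p. j < n \<Longrightarrow> p \<in> Z \<Longrightarrow> a j p = 0"
    and ints: "\<And>X p. X \<subseteq> {..<n} \<Longrightarrow> p < d \<Longrightarrow> p \<notin> Z \<Longrightarrow> (\<Sum>j\<in>X. a j p) - (\<Sum>j<n. \<zeta> j * a j p) \<in> \<int>"
  shows "(\<integral>t. Psi t \<partial>Leb d) = of_real ((2 * pi) ^ (d - card Z) * sqrt (2 * pi) ^ card Z *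
    (\<Sum>X\<in>{X. X \<subseteq> {..<n} \<and> (\<forall>p<d. p \<notin> Z \<longrightarrow> (\<Sum>j\<in>X. a j p) = (\<Sum>j<n. \<zeta> j * a j p))}.
      (\<Prod>j\<in>X. \<zeta> j) * (\<Prod>j\<in>{..<n} - X. 1 - \<zeta> j)))"
proof -
  define c where "c X p = (\<Sum>j\<in>X. a j p) - (\<Sum>j<n. \<zeta> j * a j p)" for X p
  define w where "w X = (\<Prod>j\<in>X. \<zeta> j) * (\<Prod>j\<in>{..<n} - X. 1 - \<zeta> j)" for X
  define f where "f X t = indicator box t *\<^sub>R (iexp (\<Sum>p\<in>{..<d} - Z. c X p * t p) * of_real (exp (- (\<Sum>p\<in>Z. (t p)\<^sup>2) / 2)))" for X t
  have U: "U j t = (\<Sum>p\<in>{..<d} - Z. a j p * t p)" if "j < n" for j t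
    unfolding lin_def using a0[OF that] by (intro sum.mono_neutral_right) auto
  have freq: "(\<Sum>j\<in>X. U j t) - (\<Sum>j<n. \<zeta> j * U j t) = (\<Sum>p\<in>{..<d} - Z. c X p * t p)" if X: "X \<subseteq> {..<n}" for X t
  proof -
    have "(\<Sum>j\<in>X. U j t) = (\<Sum>j\<in>X. \<Sum>p\<in>{..<d} - Z. a j p * t p)" using X U by (intro sum.cong) auto
    also have "\<dots> = (\<Sum>p\<in>{..<d} - Z. (\<Sum>j\<in>X. a j p) * t p)"
      by (subst sum.swap) (simp add: sum_distrib_right)
    finally have 1: "(\<Sum>j\<in>X. U j t) = (\<Sum>p\<in>{..<d} - Z. (\<Sum>j\<in>X. a j p) * t p)" .
    have "(\<Sum>j<n. \<zeta> j * U j t) = (\<Sum>j<n. \<Sum>p\<in>{..<d} - Z. \<zeta> j * a j p * t p)"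
      using U by (intro sum.cong) (auto simp: sum_distrib_left mult.assoc)
    also have "\<dots> = (\<Sum>p\<in>{..<d} - Z. (\<Sum>j<n. \<zeta> j * a j p) * t p)"
      by (subst sum.swap) (simp add: sum_distrib_right)
    finally show ?thesis unfolding 1 c_def by (simp add: sum_subtractf left_diff_distrib)
  qed
  have expand: "(\<Prod>j<n. bern_char (\<zeta> j) (U j t)) = (\<Sum>X\<in>Pow {..<n}. of_real (w X) * iexp (\<Sum>p\<in>{..<d} - Z. c X p * t p))" for t
  proof -
    have "(\<Prod>j<n. bern_char (\<zeta> j) (U j t)) =
        (\<Prod>j<n. of_real (\<zeta> j) * iexp (U j t) + of_real (1 - \<zeta> j)) * (\<Prod>j<n. iexp (- \<zeta> j * U j t))"
      unfolding bern_char_eq prod.distrib[symmetric] by (simp only: add.commute)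
    also have "(\<Prod>j<n. of_real (\<zeta> j) * iexp (U j t) + of_real (1 - \<zeta> j)) =
        (\<Sum>X\<in>Pow {..<n}. (\<Prod>j\<in>X. of_real (\<zeta> j) * iexp (U j t)) * (\<Prod>j\<in>{..<n} - X. of_real (1 - \<zeta> j)))"
      by (rule prod_add) simp
    also have "(\<Prod>j<n. iexp (- \<zeta> j * U j t)) = iexp (- (\<Sum>j<n. \<zeta> j * U j t))"
      by (simp add: exp_sum[symmetric] sum_distrib_left sum_negf)
    also have "(\<Sum>X\<in>Pow {..<n}. (\<Prod>j\<in>X. of_real (\<zeta> j) * iexp (U j t)) * (\<Prod>j\<in>{..<n} - X. of_real (1 - \<zeta> j))) *
        iexp (- (\<Sum>j<n. \<zeta> j * U j t)) = (\<Sum>X\<in>Pow {..<n}. of_real (w X) * iexp (\<Sum>p\<in>{..<d} - Z. c X p * t p))"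
      unfolding sum_distrib_right
    proof (rule sum.cong[OF refl])
      fix X assume "X \<in> Pow {..<n}"
      then have X: "X \<subseteq> {..<n}" and finX: "finite X" by (auto intro: finite_subset)
      have "(\<Prod>j\<in>X. iexp (U j t)) * iexp (- (\<Sum>j<n. \<zeta> j * U j t)) = iexp (\<Sum>p\<in>{..<d} - Z. c X p * t p)"
        unfolding freq[OF X, symmetric] exp_sum[OF finX, symmetric] exp_add[symmetric]
        by (rule arg_cong[of _ _ exp]) (simp add: sum_distrib_left algebra_simps)
      moreover have "(\<Prod>j\<in>X. of_real (\<zeta> j) * iexp (U j t)) = of_real (\<Prod>j\<in>X. \<zeta> j) * (\<Prod>j\<in>X. iexp (U j t))"
        by (simp add: prod.distrib)
      ultimately show "(\<Prod>j\<in>X. of_real (\<zeta> j) * iexp (U j t)) * (\<Prod>j\<in>{..<n} - X. of_real (1 - \<zeta> j)) *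
          iexp (- (\<Sum>j<n. \<zeta> j * U j t)) = of_real (w X) * iexp (\<Sum>p\<in>{..<d} - Z. c X p * t p)"
        by (simp add: w_def mult_ac)
    qed
    finally show ?thesis .
  qed
  have Psi: "Psi t = (\<Sum>X\<in>Pow {..<n}. of_real (w X) * f X t)" for t
    unfolding Psi_def expand f_def by (simp add: sum_distrib_right scaleR_sum_right mult.assoc)
  have ints': "c X p \<in> \<int>" if "X \<in> Pow {..<n}" "p < d" "p \<notin> Z" for X p
    using ints[of X p] that by (simp add: c_def)
  have fX: "integrable (Leb d) (f X)" "(\<integral>t. f X t \<partial>Leb d) =
      (if \<forall>p<d. p \<notin> Z \<longrightarrow> c X p = 0 then of_real ((2 * pi) ^ (d - card Z) * sqrt (2 * pi) ^ card Z) else 0)"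
    if "X \<in> Pow {..<n}" for X
    using integral_character[of "c X"] ints'[OF that] unfolding f_def by blast+
  have "(\<integral>t. Psi t \<partial>Leb d) = (\<Sum>X\<in>Pow {..<n}. of_real (w X) * (\<integral>t. f X t \<partial>Leb d))"
    unfolding Psi using fX(1) by (subst Bochner_Integration.integral_sum) (auto intro!: integrable_mult_right)
  also have "\<dots> = (\<Sum>X\<in>Pow {..<n}. if \<forall>p<d. p \<notin> Z \<longrightarrow> c X p = 0 then of_real (w X * ((2 * pi) ^ (d - card Z) * sqrt (2 * pi) ^ card Z)) else 0)"
    using fX(2) by (intro sum.cong) auto
  also have "\<dots> = (\<Sum>X\<in>{X. X \<subseteq> {..<n} \<and> (\<forall>p<d. p \<notin> Z \<longrightarrow> c X p = 0)}. of_real (w X * ((2 * pi) ^ (d - card Z) * sqrt (2 * pi) ^ card Z)))"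
    by (subst sum.inter_filter[symmetric]) (auto simp: Pow_def intro!: sum.cong)
  finally show ?thesis
    unfolding of_real_sum[symmetric] sum_distrib_right[symmetric] by (simp add: c_def w_def mult.commute)
qed

end

section \<open>Maximum entropy\<close>

text \<open>The derivative of the entropy along \<open>x - z\<close> vanishes at an interior maximizer \<open>z\<close>, which is the
  statement that a product of Bernoulli variables with means \<open>z\<close> is uniform on the 0-1 points.\<close>

lemma bernoulli_weight_eq_exp_entropy:
  fixes P :: "real Matrix.vec set" and z x :: "real Matrix.vec"
  assumes z: "z \<in> carrier_vec n" and x: "x \<in> carrier_vec n"
    and z01: "\<And>i. i < n \<Longrightarrow> 0 < z $ i" "\<And>i. i < n \<Longrightarrow> z $ i < 1"
    and x01: "\<And>i. i < n \<Longrightarrow> x $ i \<in> {0, 1}"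
    and max: "\<And>e. (\<forall>i<n. 0 \<le> z $ i + e * (x $ i - z $ i) \<and> z $ i + e * (x $ i - z $ i) \<le> 1) \<Longrightarrow>
      entropy (z + e \<cdot>\<^sub>v (x - z)) \<le> entropy z"
  shows "(\<Prod>j\<in>{j. j < n \<and> x $ j = 1}. z $ j) * (\<Prod>j\<in>{..<n} - {j. j < n \<and> x $ j = 1}. 1 - z $ j) = exp (- entropy z)"
proof -
  define y where "y i e = z $ i + e * (x $ i - z $ i)" for i e
  define g where "g e = (\<Sum>i<n. - (y i e * ln (y i e)) - (1 - y i e) * ln (1 - y i e))" for e
  have ent: "entropy v = (\<Sum>i<n. - (v $ i * ln (v $ i)) - (1 - v $ i) * ln (1 - v $ i))"
    if "v \<in> carrier_vec n" "\<And>i. i < n \<Longrightarrow> 0 \<le> v $ i \<and> v $ i \<le> 1" for v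
  proof -
    have "u * ln (1 / u) = - (u * ln u)" if "0 \<le> u" for u :: real
      using that by (cases "u = 0") (auto simp: ln_div)
    then show ?thesis using that unfolding entropy_def by (intro sum.cong) auto
  qed
  have abs_le: "\<bar>x $ i - z $ i\<bar> \<le> 1" if "i < n" for i
    using x01[OF that] z01[OF that] by auto
  \<comment> \<open>The distance of \<open>z\<close> from the faces of the cube allows steps of both
    signs along \<open>x - z\<close>; this gives a vanishing derivative and not merely an
    inequality.\<close>
  obtain \<delta> where \<delta>: "0 < \<delta>" "\<And>i. i < n \<Longrightarrow> \<delta> \<le> z $ i" "\<And>i. i < n \<Longrightarrow> \<delta> \<le> 1 - z $ i"
  proof -
    let ?S = "insert 1 ((\<lambda>i. min (z $ i) (1 - z $ i)) ` {..<n})"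
    have "0 < Min ?S" using z01 by (subst Min_gr_iff) auto
    moreover have "Min ?S \<le> min (z $ i) (1 - z $ i)" if "i < n" for i using that by (intro Min_le) auto
    ultimately show ?thesis using that[of "Min ?S"] by force
  qed
  have in01: "0 \<le> y i e \<and> y i e \<le> 1" if e: "\<bar>e\<bar> < \<delta>" and i: "i < n" for e i
  proof -
    have "\<bar>e * (x $ i - z $ i)\<bar> \<le> \<bar>e\<bar> * 1" unfolding abs_mult using abs_le[OF i] by (intro mult_left_mono) auto
    then show ?thesis using e \<delta>(2,3)[OF i] unfolding y_def by linarith
  qed
  have le: "g e \<le> g 0" if e: "\<bar>0 - e\<bar> < \<delta>" for e
  proof -
    have "entropy (z + e \<cdot>\<^sub>v (x - z)) \<le> entropy z" using in01[of e] e by (intro max) (auto simp: y_def)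
    moreover have "entropy (z + e \<cdot>\<^sub>v (x - z)) = g e"
      using in01[of e] e x z by (subst ent) (auto simp: g_def y_def)
    moreover have "entropy z = g 0"
      using z01 z by (subst ent) (auto simp: g_def y_def less_imp_le)
    ultimately show ?thesis by simp
  qed
  have deriv: "(g has_real_derivative (\<Sum>i<n. (x $ i - z $ i) * (ln (1 - z $ i) - ln (z $ i)))) (at 0)"
    unfolding g_def
  proof (intro DERIV_sum)
    fix i assume "i \<in> {..<n}"
    then have i: "0 < z $ i" "z $ i < 1" using z01 by auto
    have "((\<lambda>v. - (v * ln v) - (1 - v) * ln (1 - v)) has_real_derivative ln (1 - z $ i) - ln (z $ i)) (at (y i 0))"
      unfolding y_def using i by (auto intro!: derivative_eq_intros)
    moreover have "(y i has_real_derivative x $ i - z $ i) (at 0)"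
      unfolding y_def by (auto intro!: derivative_eq_intros)
    ultimately show "((\<lambda>e. - (y i e * ln (y i e)) - (1 - y i e) * ln (1 - y i e)) has_real_derivative
        (x $ i - z $ i) * (ln (1 - z $ i) - ln (z $ i))) (at 0)"
      unfolding mult.commute[of "x $ i - z $ i"] by (rule DERIV_chain2)
  qed
  have zero: "(\<Sum>i<n. (x $ i - z $ i) * (ln (1 - z $ i) - ln (z $ i))) = 0"
    by (rule DERIV_local_max[OF deriv \<delta>(1)]) (use le in blast)
  let ?X = "{j. j < n \<and> x $ j = 1}"
  have "(\<Prod>j\<in>?X. z $ j) * (\<Prod>j\<in>{..<n} - ?X. 1 - z $ j) = exp (\<Sum>i<n. x $ i * ln (z $ i) + (1 - x $ i) * ln (1 - z $ i))"
  proof -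
    have "exp (\<Sum>i<n. x $ i * ln (z $ i) + (1 - x $ i) * ln (1 - z $ i)) = (\<Prod>i<n. if i \<in> ?X then z $ i else 1 - z $ i)"
      unfolding exp_sum[OF finite_lessThan] using x01 z01 by (intro prod.cong) force+
    also have "\<dots> = (\<Prod>j\<in>?X. z $ j) * (\<Prod>j\<in>{..<n} - ?X. 1 - z $ j)"
    proof -
      have "{..<n} \<inter> {i. i \<in> ?X} = ?X" "{..<n} \<inter> - {i. i \<in> ?X} = {..<n} - ?X" by auto
      then show ?thesis using prod.If_cases[of "{..<n}" "\<lambda>i. i \<in> ?X" "\<lambda>i. z $ i" "\<lambda>i. 1 - z $ i"] by simp
    qed
    finally show ?thesis by simp
  qed
  \<comment> \<open>The log-likelihood is affine in \<open>x\<close>, and its change from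
    \<open>z\<close> to \<open>x\<close> is minus the derivative that has just been shown to vanish;
    at \<open>z\<close> it is minus the entropy.\<close>
  also have "(\<Sum>i<n. x $ i * ln (z $ i) + (1 - x $ i) * ln (1 - z $ i)) =
      (\<Sum>i<n. z $ i * ln (z $ i) + (1 - z $ i) * ln (1 - z $ i)) - (\<Sum>i<n. (x $ i - z $ i) * (ln (1 - z $ i) - ln (z $ i)))"
    unfolding sum_subtractf[symmetric] by (intro sum.cong refl) (simp add: algebra_simps)
  also have "\<dots> = - entropy z"
    using z01 z unfolding zero by (subst ent) (auto simp: sum_negf[symmetric] less_imp_le intro!: sum.cong)
  finally show ?thesis .
qed

section \<open>Transportation polytopes\<close>

lemma rescale_error:
  fixes C G G' m w e :: real
  assumes C: "0 < C" and le: "\<bar>C * (G' * m) - w\<bar> \<le> e * w" and G: "0 < G" "G * G' = 1"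
  shows "\<bar>m - G * w / C\<bar> \<le> e * (G * w / C)"
proof -
  have "m - G * w / C = (G / C) * (C * (G' * m) - w)"
  proof -
    have "(G / C) * (C * (G' * m) - w) = (G * G') * m - G * w / C" using C by (simp add: field_simps)
    then show ?thesis using G by simp
  qed
  then have "\<bar>m - G * w / C\<bar> = (G / C) * \<bar>C * (G' * m) - w\<bar>"
    using C G by (simp only: abs_mult abs_of_pos[OF divide_pos_pos[OF G(1) C]])
  also have "\<dots> \<le> (G / C) * (e * w)" using le C G by (intro mult_left_mono) auto
  finally show ?thesis by (simp add: mult_ac)
qed

locale transportation =
  fixes ks :: "nat list" and z :: "real Matrix.vec" and r k :: real and \<nu> n d :: nat
  defines "\<nu> \<equiv> length ks" and "n \<equiv> prod_list ks" and "d \<equiv> sum_list ks"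
  assumes len: "3 \<le> length ks" and pos: "\<And>j. j < length ks \<Longrightarrow> 0 < ks ! j"
    and le_k: "\<And>j. j < length ks \<Longrightarrow> real (ks ! j) \<le> k"
    and r: "0 < r" and z: "z \<in> carrier_vec n"
    and z01: "\<And>i. i < n \<Longrightarrow> 0 \<le> z $ i" "\<And>i. i < n \<Longrightarrow> z $ i \<le> 1"
    and r_le: "\<And>i. i < n \<Longrightarrow> r \<le> z $ i - (z $ i)\<^sup>2"
begin

lemma len0: "0 < length ks"
  using len by linarith

lemma n_pos: "0 < n"
  unfolding n_def using pos by (rule prod_list_pos_nat)

lemma k_ge_1: "1 \<le> k"
  using pos[OF len0] le_k[OF len0] by linarith

lemma z_strict: "i < n \<Longrightarrow> 0 < z $ i" "i < n \<Longrightarrow> z $ i < 1"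
proof -
  assume i: "i < n"
  then have "0 < z $ i - (z $ i)\<^sup>2" using r r_le by force
  then have "z $ i \<noteq> 0" "z $ i \<noteq> 1" by auto
  then show "0 < z $ i" "z $ i < 1" using z01[OF i] by linarith+
qed

lemma d_pos: "0 < d"
  using position_bound[OF len0 pos[OF len0]] by (simp add: d_def)

abbreviation mi :: "nat \<Rightarrow> nat list" where "mi i \<equiv> multi_indices ks ! i"

lemma mi_mem: "i < n \<Longrightarrow> mi i \<in> set (multi_indices ks)"
  by (simp add: n_def length_multi_indices)

lemma mi_surj: "m \<in> set (multi_indices ks) \<Longrightarrow> \<exists>i<n. m = mi i"
  by (metis in_set_conv_nth length_multi_indices n_def)

lemma lin_eq: "i < n \<Longrightarrow> lin d (red_coeff ks i) t = form_value (block_value ks t) (mi i)"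
  unfolding d_def n_def by (rule lin_red_coeff[OF pos len0])

text \<open>The function \<open>h\<close> is left general for two uses: the absolute value gives the
  variance bound for single forms, and \<open>\<bar>sin (y / 2)\<bar>\<close> measures distance from
  multiples of 2\<pi> on the torus.\<close>

lemma lin_sq_le:
  fixes h :: "real \<Rightarrow> real"
  assumes h: "\<And>y. 0 \<le> h y" "\<And>y. h (- y) = h y" "\<And>y z. h (y + z) \<le> h y + h z" "h 0 = 0" and i: "i < n"
  shows "(h (lin d (red_coeff ks i) t))\<^sup>2 \<le> 4 * (real \<nu>)\<^sup>2 * k / real n * (\<Sum>j<n. (h (lin d (red_coeff ks j) t))\<^sup>2)"
proof -
  have "real n * (h (form_value (block_value ks t) (mi i)))\<^sup>2 \<le>
      4 * (real \<nu>)\<^sup>2 * k * (\<Sum>m'\<in>set (multi_indices ks). (h (form_value (block_value ks t) m'))\<^sup>2)"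
    unfolding n_def
    by (rule form_value_sq_le) (use h len0 le_k k_ge_1 mi_mem[OF i] in \<open>simp_all add: \<nu>_def\<close>)
  also have "(\<Sum>m'\<in>set (multi_indices ks). (h (form_value (block_value ks t) m'))\<^sup>2) = (\<Sum>j<n. (h (lin d (red_coeff ks j) t))\<^sup>2)"
    unfolding sum_multi_indices[symmetric] n_def[symmetric] by (intro sum.cong) (auto simp: lin_eq)
  finally show ?thesis using n_pos by (simp add: lin_eq[OF i] field_simps)
qed

text \<open>If all forms are at most 1, every block value is at most 2, being a form or a difference
  of two forms; since 2 < \<pi> this gives \<open>small_forms\<close>.\<close>

sublocale lattice_forms d n "red_coeff ks" "dropped ks" "\<lambda>i. z $ i" r "4 * (real \<nu>)\<^sup>2 * k / real n"
proof
  show "0 \<le> 4 * (real \<nu>)\<^sup>2 * k / real n" using k_ge_1 by simp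
  show "dropped ks \<subseteq> {..<d}" unfolding d_def using pos len0 by (rule dropped_subset)
  show "(lin d (red_coeff ks j) t)\<^sup>2 \<le> 4 * (real \<nu>)\<^sup>2 * k / real n * (\<Sum>i<n. (lin d (red_coeff ks i) t)\<^sup>2)"
    if "j < n" for j t
    using lin_sq_le[of abs j t] that by (simp add: abs_triangle_ineq)
  show "\<bar>t p\<bar> \<le> pi" if small: "\<forall>j<n. \<bar>lin d (red_coeff ks j) t\<bar> \<le> 1" and p: "p < d" "p \<notin> dropped ks" for t p
  proof -
    obtain l c where lc: "l < length ks" "c < ks ! l" "p = sum_list (take l ks) + c"
      using position_split[of p ks] p by (auto simp: d_def)
    have "\<bar>block_value ks t l c\<bar> \<le> 2 * 1"
    proof (rule block_value_le_of_form_value_le[OF pos len0 _ lc(1,2)])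
      fix m assume "m \<in> set (multi_indices ks)"
      then obtain i where i: "i < n" "m = mi i" using mi_surj by blast
      have "\<bar>lin d (red_coeff ks i) t\<bar> \<le> 1" using small i(1) by blast
      then show "\<bar>form_value (block_value ks t) m\<bar> \<le> 1" by (simp only: i(2) lin_eq[OF i(1)])
    qed
    then show ?thesis using p lc pi_gt3 by (simp add: block_value_def Let_def)
  qed
qed (use r z01 r_le in auto)

text \<open>The scale \<open>\<delta> = 1 / (2 * \<nu>)\<close> is chosen so that
  \<open>2 * \<nu> * \<delta> = 1\<close> bounds the forms when all sines are at most
  \<open>sin (\<delta> / 2)\<close>. Otherwise one sine is larger, and \<open>lin_sq_le\<close>
  spreads it over the whole array: the sum of all squared sines is at least of order
  \<open>n / k\<close>.\<close>

lemma torus_dichotomy: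
  fixes \<eta> :: real
  defines "\<eta> \<equiv> (sin (1 / (4 * real \<nu>)))\<^sup>2"
  assumes t: "t \<in> box"
  shows "(\<forall>j<n. \<bar>U j t\<bar> \<le> 1) \<or> r * \<eta> * real n / (2 * (real \<nu>)\<^sup>2 * k) \<le> (\<Sum>j<n. 2 * s j * (sin (U j t / 2))\<^sup>2)"
proof (cases "\<forall>j<n. \<bar>sin (U j t / 2)\<bar> \<le> sin ((1 / (2 * real \<nu>)) / 2)")
  case True
  have \<nu>: "3 \<le> real \<nu>" using len by (simp add: \<nu>_def)
  have "\<bar>U j t\<bar> \<le> 1" if j: "j < n" for j
  proof -
    have "\<bar>form_value (block_value ks t) (mi j)\<bar> \<le> 2 * real (length ks) * (1 / (2 * real \<nu>))"
    proof (rule form_value_le_of_sin_le[OF pos len0])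
      show "\<bar>t p\<bar> \<le> pi" if "p < sum_list ks" "p \<notin> dropped ks" for p
        using t that unfolding box_def d_def[symmetric] by simp
      fix m assume "m \<in> set (multi_indices ks)"
      then obtain i where i: "i < n" "m = mi i" using mi_surj by blast
      have "\<bar>sin (U i t / 2)\<bar> \<le> sin ((1 / (2 * real \<nu>)) / 2)" using True i(1) by blast
      then show "\<bar>sin (form_value (block_value ks t) m / 2)\<bar> \<le> sin ((1 / (2 * real \<nu>)) / 2)"
        by (simp only: i(2) lin_eq[OF i(1)])
    qed (use \<nu> mi_mem[OF j] in auto)
    then show ?thesis using \<nu> by (simp add: lin_eq[OF j] \<nu>_def split: if_splits)
  qed
  then show ?thesis by blast
next
  case False
  have \<nu>: "3 \<le> real \<nu>" using len by (simp add: \<nu>_def)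
  obtain i where i: "i < n" "sin (1 / (4 * real \<nu>)) < \<bar>sin (U i t / 2)\<bar>" using False by (auto simp: not_le)
  have "1 / (4 * real \<nu>) \<le> 1" using \<nu> by simp
  then have "0 \<le> sin (1 / (4 * real \<nu>))" using pi_gt3 by (intro sin_ge_zero) auto
  then have "\<eta> \<le> (\<bar>sin (U i t / 2)\<bar>)\<^sup>2" unfolding \<eta>_def using i(2) by (intro power_mono) auto
  also have "\<dots> \<le> 4 * (real \<nu>)\<^sup>2 * k / real n * (\<Sum>j<n. (\<bar>sin (U j t / 2)\<bar>)\<^sup>2)"
    by (rule lin_sq_le[of "\<lambda>y. \<bar>sin (y / 2)\<bar>"]) (use abs_sin_half_add i in \<open>auto simp: minus_divide_left[symmetric]\<close>)
  finally have 1: "\<eta> * real n / (4 * (real \<nu>)\<^sup>2 * k) \<le> (\<Sum>j<n. (sin (U j t / 2))\<^sup>2)"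
    using n_pos k_ge_1 \<nu> by (simp add: field_simps)
  have "r * \<eta> * real n / (2 * (real \<nu>)\<^sup>2 * k) = 2 * r * (\<eta> * real n / (4 * (real \<nu>)\<^sup>2 * k))" by (simp add: mult_ac)
  also have "\<dots> \<le> 2 * r * (\<Sum>j<n. (sin (U j t / 2))\<^sup>2)" using 1 r by (intro mult_left_mono) auto
  also have "\<dots> \<le> (\<Sum>j<n. 2 * s j * (sin (U j t / 2))\<^sup>2)"
    unfolding sum_distrib_left using r_le by (intro sum_mono mult_right_mono mult_left_mono) auto
  finally show ?thesis by blast
qed

text \<open>Cauchy-Schwarz over the \<nu> directions, with every coordinate bounded by the full
  norm. A polynomial bound suffices, because it only enters the lower bound for \<open>mass\<close>
  through a logarithm.\<close>

lemma form_le: "form t \<le> (real n * (real \<nu>)\<^sup>2 + 1) * (\<Sum>p<d. (t p)\<^sup>2)"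
proof -
  let ?N = "\<Sum>p<d. (t p)\<^sup>2"
  have N0: "0 \<le> ?N" by (intro sum_nonneg) auto
  have U2: "(U i t)\<^sup>2 \<le> (real \<nu>)\<^sup>2 * ?N" if i: "i < n" for i
  proof -
    have lenm: "length (mi i) = \<nu>" using mi_mem[OF i] by (simp add: set_multi_indices \<nu>_def)
    have "(block_value ks t j (mi i ! j))\<^sup>2 \<le> ?N" if j: "j < \<nu>" for j
    proof -
      have "sum_list (take j ks) + mi i ! j < d"
        unfolding d_def using j i multi_indices_nth_less[of i ks j] by (intro position_bound) (auto simp: \<nu>_def n_def)
      then have "(t (sum_list (take j ks) + mi i ! j))\<^sup>2 \<le> ?N" by (intro member_le_sum) auto
      then show ?thesis using N0 by (simp add: block_value_def Let_def)
    qed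
    then have "(\<Sum>j<\<nu>. (block_value ks t j (mi i ! j))\<^sup>2) \<le> (\<Sum>j<\<nu>. ?N)" by (intro sum_mono) auto
    also have "\<dots> = real \<nu> * ?N" by (subst sum_constant) simp
    finally have "(\<Sum>j<\<nu>. (block_value ks t j (mi i ! j))\<^sup>2) * real \<nu> \<le> (real \<nu> * ?N) * real \<nu>"
      by (rule mult_right_mono) simp
    moreover have "(U i t)\<^sup>2 \<le> (\<Sum>j<\<nu>. (block_value ks t j (mi i ! j))\<^sup>2) * real \<nu>"
      using sum_squared_le_sum_of_squares[of "\<lambda>j. block_value ks t j (mi i ! j)" "{..<\<nu>}"]
      by (simp add: lin_eq[OF i] form_value_def lenm)
    ultimately have "(U i t)\<^sup>2 \<le> (real \<nu> * ?N) * real \<nu>" by (rule order_trans[rotated])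
    then show ?thesis by (simp add: power2_eq_square mult_ac)
  qed
  have "(\<Sum>j<n. s j * (U j t)\<^sup>2) \<le> (\<Sum>j<n. 1 * ((real \<nu>)\<^sup>2 * ?N))"
  proof (intro sum_mono mult_mono)
    fix i assume "i \<in> {..<n}"
    then have i: "i < n" by simp
    show "s i \<le> 1" using z01(2)[OF i] zero_le_power2[of "z $ i"] by linarith
    show "(U i t)\<^sup>2 \<le> (real \<nu>)\<^sup>2 * ?N" using U2[OF i] .
  qed auto
  moreover have "(\<Sum>p\<in>dropped ks. (t p)\<^sup>2) \<le> ?N" using Z by (intro sum_mono2) auto
  ultimately show ?thesis unfolding form_def by (simp add: algebra_simps)
qed


abbreviation det_reduced :: real where
  "det_reduced \<equiv> Determinant.det (Matrix.mat d d (\<lambda>(p, q). form_coeff p q))"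

lemma form_det_on_eq:
  "form_det_on d (reduced_space ks) (covariance_form (transportation_mat ks) z) = det_reduced"
proof -
  let ?A = "transportation_mat ks"
  let ?B = "Matrix.mat d d (\<lambda>(p, p'). \<Sum>i<n. (z $ i - (z $ i)\<^sup>2) * ?A $$ (p, i) * ?A $$ (p', i))"
  have A: "?A \<in> carrier_mat d n" by (simp add: transportation_mat_def d_def n_def)
  have q: "form_mat d (covariance_form ?A z) = ?B"
    using s_nonneg by (rule form_mat_covariance_form[OF A])
  have sym: "?B\<^sup>T = ?B" by (rule eq_matI) (auto simp: mult_ac intro!: sum.cong)
  have "form_det_on d (reduced_space ks) (covariance_form ?A z) =
    Determinant.det (Matrix.mat d d (\<lambda>(p, p'). if p \<in> dropped ks \<or> p' \<in> dropped ks then (if p = p' then 1 else 0) else ?B $$ (p, p')))"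
    unfolding dropped_def d_def
    by (rule form_det_on_reduced_space) (use d_pos sym q in \<open>simp_all add: d_def\<close>)
  also have "Matrix.mat d d (\<lambda>(p, p'). if p \<in> dropped ks \<or> p' \<in> dropped ks then (if p = p' then 1 else 0) else ?B $$ (p, p')) =
      Matrix.mat d d (\<lambda>(p, q). form_coeff p q)"
    by (rule eq_matI) (auto simp: form_coeff_def red_coeff_def)
  finally show ?thesis .
qed

text \<open>A full period for each free coordinate and a Gaussian integral for each dropped
  one.\<close>

abbreviation norm_const :: real where
  "norm_const \<equiv> (2 * pi) ^ (d - card (dropped ks)) * sqrt (2 * pi) ^ card (dropped ks)"

lemma det_reduced_pos: "0 < det_reduced"
  using mass_sq by (metis mult_pos_pos not_less pi_gt_zero rel_simps(51) zero_less_mult_pos zero_less_power)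

text \<open>With \<nu> - 1 dropped coordinates the exponent of 2\<pi> is
  \<open>d / 2 - (d - (\<nu> - 1) / 2)\<close>, that is, \<open>- (d - \<nu> + 1) / 2\<close>: the
  Gaussian factors of the dropped coordinates cancel.\<close>

lemma estimate_eq:
  "exp (entropy z) / (2 * pi) powr ((real d - real \<nu> + 1) / 2) *
     form_det_on d (reduced_space ks) (covariance_form (transportation_mat ks) z) powr (- 1 / 2) =
   exp (entropy z) * mass / norm_const"
proof -
  let ?D = det_reduced and ?c = "card (dropped ks)"
  have c: "?c = \<nu> - 1" using card_dropped[OF pos len0] by (simp add: \<nu>_def)
  have cd: "?c \<le> d" using card_mono[OF _ Z] by simp
  have D: "0 < ?D" by (rule det_reduced_pos)
  have pow: "(2 * pi) ^ m = (2 * pi) powr real m" "sqrt (2 * pi) ^ m = (2 * pi) powr (real m / 2)" for m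
  proof -
    show "(2 * pi) ^ m = (2 * pi) powr real m" by (simp add: powr_realpow)
    have "sqrt (2 * pi) = (2 * pi) powr (1 / 2)" by (simp add: powr_half_sqrt)
    then show "sqrt (2 * pi) ^ m = (2 * pi) powr (real m / 2)" by (simp add: powr_power)
  qed
  have massE: "mass = (2 * pi) powr (real d / 2) * ?D powr (- 1 / 2)"
  proof (rule power2_eq_imp_eq)
    have X: "(?D powr (- 1 / 2))\<^sup>2 = 1 / ?D" 
    proof -
      have "(?D powr (- 1 / 2))\<^sup>2 = ?D powr (- 1 / 2 + - 1 / 2)" by (simp only: power2_eq_square powr_add)
      also have "\<dots> = 1 / ?D" using D by (simp add: powr_minus_divide)
      finally show ?thesis .
    qed
    have Y: "((2 * pi) powr (real d / 2))\<^sup>2 = (2 * pi) ^ d" 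
    proof -
      have "((2 * pi) powr (real d / 2))\<^sup>2 = (2 * pi) powr (real d / 2 + real d / 2)"
        by (simp only: power2_eq_square powr_add)
      then show ?thesis by (simp only: field_sum_of_halves pow(1))
    qed
    show "mass\<^sup>2 = ((2 * pi) powr (real d / 2) * ?D powr (- 1 / 2))\<^sup>2"
      unfolding power_mult_distrib[of "(2 * pi) powr (real d / 2)"] X Y mass_sq(2)[symmetric] using D by simp
  qed (use mass_sq(1) in auto)
  have constE: "norm_const = (2 * pi) powr (real d - real ?c / 2)"
    unfolding pow powr_add[symmetric] using cd by (intro arg_cong[of _ _ "(powr) (2 * pi)"]) (simp add: of_nat_diff)
  have "mass / norm_const = (2 * pi) powr (real d / 2 - (real d - real ?c / 2)) * ?D powr (- 1 / 2)"
    by (simp only: massE constE powr_diff[of _ "real d / 2" "real d - real ?c / 2"] times_divide_eq_left)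
  also have "real d / 2 - (real d - real ?c / 2) = - ((real d - real \<nu> + 1) / 2)"
    unfolding c using len by (simp add: \<nu>_def of_nat_diff field_simps)
  finally have "mass / norm_const = ?D powr (- 1 / 2) / (2 * pi) powr ((real d - real \<nu> + 1) / 2)"
    by (simp only: powr_minus_divide times_divide_eq_left mult_1)
  then show ?thesis unfolding form_det_on_eq by (simp only: times_divide_eq_right[symmetric]) simp
qed

section \<open>Margins and the count of 0-1 points\<close>

definition marginal :: "real Matrix.vec \<Rightarrow> nat \<Rightarrow> nat \<Rightarrow> real" where
  "marginal v j m = (\<Sum>i\<in>{i. i < n \<and> mi i ! j = m}. v $ i)"

lemma sum_marginal: "j < length ks \<Longrightarrow> (\<Sum>m<ks ! j. marginal v j m) = (\<Sum>i<n. v $ i)"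
proof -
  assume j: "j < length ks"
  have "(\<Sum>m\<in>{..<ks ! j}. \<Sum>i\<in>{i \<in> {..<n}. mi i ! j = m}. v $ i) = (\<Sum>i<n. v $ i)"
    using multi_indices_nth_less[of _ ks j] j by (intro sum.group) (auto simp: n_def)
  then show ?thesis by (simp add: marginal_def)
qed

lemma sum_red_coeff:
  assumes "j < length ks" "m < ks ! j" "sum_list (take j ks) + m \<notin> dropped ks"
  shows "(\<Sum>i<n. v $ i * red_coeff ks i (sum_list (take j ks) + m)) = marginal v j m"
proof -
  have "(\<Sum>i<n. v $ i * red_coeff ks i (sum_list (take j ks) + m)) = (\<Sum>i<n. if mi i ! j = m then v $ i else 0)"
    using assms by (intro sum.cong) (auto simp: red_coeff_def transportation_mat_nth n_def)
  also have "\<dots> = (\<Sum>i\<in>{i \<in> {..<n}. mi i ! j = m}. v $ i)" by (rule sum.inter_filter[symmetric]) simp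
  finally show ?thesis by (simp add: marginal_def)
qed

text \<open>The first block loses no equation and so determines the total. In every other block the
  single dropped margin is the total minus the remaining margins.\<close>

lemma marginals_eq_iff:
  "(\<forall>p<d. p \<notin> dropped ks \<longrightarrow> (\<Sum>i<n. v $ i * red_coeff ks i p) = (\<Sum>i<n. w $ i * red_coeff ks i p)) \<longleftrightarrow>
    (\<forall>j<length ks. \<forall>m<ks ! j. marginal v j m = marginal w j m)" (is "?L \<longleftrightarrow> ?R")
proof
  assume R: ?R
  show ?L
  proof (intro allI impI)
    fix p assume p: "p < d" "p \<notin> dropped ks"
    then obtain j m where "j < length ks" "m < ks ! j" "p = sum_list (take j ks) + m"
      using position_split[of p ks] by (auto simp: d_def)
    then show "(\<Sum>i<n. v $ i * red_coeff ks i p) = (\<Sum>i<n. w $ i * red_coeff ks i p)"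
      using R p sum_red_coeff by simp
  qed
next
  assume L: ?L
  have free: "marginal v j m = marginal w j m"
    if "j < length ks" "m < ks ! j" "sum_list (take j ks) + m \<notin> dropped ks" for j m
  proof -
    have "(\<Sum>i<n. v $ i * red_coeff ks i (sum_list (take j ks) + m)) = (\<Sum>i<n. w $ i * red_coeff ks i (sum_list (take j ks) + m))"
      using L that(3) position_bound[OF that(1,2)] unfolding d_def by blast
    then show ?thesis unfolding sum_red_coeff[OF that] .
  qed
  have total: "(\<Sum>i<n. v $ i) = (\<Sum>i<n. w $ i)"
    unfolding sum_marginal[OF len0, symmetric]
    using position_dropped[OF pos len0 len0] len0 by (intro sum.cong free) auto
  show ?R
  proof (intro allI impI)
    fix j m assume jm: "j < length ks" "m < ks ! j"
    show "marginal v j m = marginal w j m"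
    proof (cases "sum_list (take j ks) + m \<in> dropped ks")
      case True
      have "(\<Sum>m'\<in>{..<ks ! j} - {m}. marginal v j m') = (\<Sum>m'\<in>{..<ks ! j} - {m}. marginal w j m')"
        using True jm position_dropped[OF pos len0 jm(1)] by (intro sum.cong free) auto
      moreover have "marginal u j m + (\<Sum>m'\<in>{..<ks ! j} - {m}. marginal u j m') = (\<Sum>i<n. u $ i)" for u
        using sum.remove[of "{..<ks ! j}" m "marginal u j"] jm sum_marginal[OF jm(1), of u] by simp
      ultimately show ?thesis using total by (metis add_right_cancel)
    qed (use jm free in auto)
  qed
qed


definition success_set :: "real Matrix.vec \<Rightarrow> nat set" where
  "success_set x = {i. i < n \<and> x $ i = 1}"

lemma sum_success_set:
  assumes "x \<in> binary_vecs n"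
  shows "(\<Sum>i\<in>success_set x. f i) = (\<Sum>i<n. x $ i * f i)"
proof -
  have "(\<Sum>i<n. x $ i * f i) = (\<Sum>i<n. if x $ i = 1 then f i else 0)"
    using assms by (intro sum.cong) (auto simp: binary_vecs_def)
  also have "\<dots> = (\<Sum>i\<in>{i \<in> {..<n}. x $ i = 1}. f i)" by (rule sum.inter_filter[symmetric]) simp
  finally show ?thesis by (simp add: success_set_def)
qed

lemma bij_success_set: "bij_betw success_set (binary_vecs n) {X. X \<subseteq> {..<n}}"
proof (rule bij_betw_byWitness[where f' = "\<lambda>X. Matrix.vec n (\<lambda>i. if i \<in> X then 1 else 0)"])
  show "\<forall>x\<in>binary_vecs n. Matrix.vec n (\<lambda>i. if i \<in> success_set x then 1 else 0) = x"
    by (auto simp: binary_vecs_def success_set_def intro!: eq_vecI)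
  show "\<forall>X\<in>{X. X \<subseteq> {..<n}}. success_set (Matrix.vec n (\<lambda>i. if i \<in> X then 1 else 0)) = X"
    by (auto simp: success_set_def split: if_splits)
qed (auto simp: binary_vecs_def success_set_def)

text \<open>The point \<open>z\<close> lies in the polytope, so its margins are integers and the
  frequencies in the Fourier expansion are integers as well. The surviving sets of successes are
  exactly the 0-1 points of the polytope, all with the weight
  \<open>exp (- entropy z)\<close>.\<close>

lemma count_eq:
  fixes S :: "nat \<Rightarrow> nat \<Rightarrow> real"
  defines "P \<equiv> transportation_polytope ks S"
  assumes ints: "\<And>j m. j < length ks \<Longrightarrow> m < ks ! j \<Longrightarrow> S j m \<in> \<int>"
    and max: "is_arg_max entropy (\<lambda>x. x \<in> P \<inter> cube01 n) z"
  shows "(\<integral>t. Psi t \<partial>Leb d) = of_real (norm_const * (exp (- entropy z) * real (card (P \<inter> binary_vecs n))))"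
proof -
  have P: "x \<in> P \<longleftrightarrow> x \<in> carrier_vec n \<and> (\<forall>i<n. 0 \<le> x $ i) \<and> (\<forall>j<length ks. \<forall>m<ks ! j. marginal x j m = S j m)" for x
  proof -
    have "0\<^sub>v n \<le> x \<longleftrightarrow> (\<forall>i<n. 0 \<le> x $ i)" if "x \<in> carrier_vec n"
      using that by (auto simp: Matrix.less_eq_vec_def)
    then show ?thesis by (auto simp: P_def transportation_polytope_def marginal_def n_def[symmetric])
  qed
  have zP: "z \<in> P" using max by (simp add: is_arg_max_def)
  have zS: "marginal z j m = S j m" if "j < length ks" "m < ks ! j" for j m
    using zP that by (simp add: P)
  have z_row: "(\<Sum>i<n. z $ i * red_coeff ks i p) \<in> \<int>" if p: "p < d" "p \<notin> dropped ks" for p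
  proof -
    obtain j m where jm: "j < length ks" "m < ks ! j" "p = sum_list (take j ks) + m"
      using position_split[of p ks] p by (auto simp: d_def)
    then have "(\<Sum>i<n. z $ i * red_coeff ks i p) = S j m" using p sum_red_coeff zS by simp
    then show ?thesis using ints jm by simp
  qed
  have red_int: "red_coeff ks i p \<in> \<int>" if "i < n" "p < d" for i p
    using that by (simp add: red_coeff_def transportation_mat_def n_def d_def)
  have weight: "(\<Prod>j\<in>success_set x. z $ j) * (\<Prod>j\<in>{..<n} - success_set x. 1 - z $ j) = exp (- entropy z)"
    if x: "x \<in> P \<inter> binary_vecs n" for x
    unfolding success_set_def
  proof (rule bernoulli_weight_eq_exp_entropy[OF z])
    show xc: "x \<in> carrier_vec n" and "\<And>i. i < n \<Longrightarrow> x $ i \<in> {0, 1}" using x by (auto simp: binary_vecs_def)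
    show "entropy (z + e \<cdot>\<^sub>v (x - z)) \<le> entropy z"
      if e: "\<forall>i<n. 0 \<le> z $ i + e * (x $ i - z $ i) \<and> z $ i + e * (x $ i - z $ i) \<le> 1" for e
    proof -
      let ?y = "z + e \<cdot>\<^sub>v (x - z)"
      have y: "?y \<in> carrier_vec n" "\<And>i. i < n \<Longrightarrow> ?y $ i = z $ i + e * (x $ i - z $ i)" using xc z by auto
      have "marginal ?y j m = S j m" if jm: "j < length ks" "m < ks ! j" for j m
      proof -
        have "marginal ?y j m = marginal z j m + e * (marginal x j m - marginal z j m)"
          unfolding marginal_def sum_subtractf[symmetric] sum_distrib_left sum.distrib[symmetric]
          using y(2) by (intro sum.cong) auto
        then show ?thesis using x zS[OF jm] jm by (simp add: P)
      qed
      then have "?y \<in> P \<inter> cube01 n" using y e by (auto simp: P cube01_def)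
      then show ?thesis using max by (auto simp: is_arg_max_def not_less)
    qed
  qed (use z_strict in auto)
  let ?F = "{X. X \<subseteq> {..<n} \<and> (\<forall>p<d. p \<notin> dropped ks \<longrightarrow> (\<Sum>j\<in>X. red_coeff ks j p) = (\<Sum>j<n. z $ j * red_coeff ks j p))}"
  have inF: "success_set x \<in> ?F \<longleftrightarrow> x \<in> P" if x: "x \<in> binary_vecs n" for x
  proof -
    have "success_set x \<in> ?F \<longleftrightarrow> (\<forall>j<length ks. \<forall>m<ks ! j. marginal x j m = marginal z j m)"
      unfolding marginals_eq_iff[symmetric] sum_success_set[OF x, symmetric] by (auto simp: success_set_def)
    also have "\<dots> \<longleftrightarrow> x \<in> P" using x zS by (auto simp: P binary_vecs_def)
    finally show ?thesis .
  qed
  have bij: "bij_betw success_set (P \<inter> binary_vecs n) ?F"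
  proof (rule bij_betw_subset[OF bij_success_set])
    show "success_set ` (P \<inter> binary_vecs n) = ?F"
    proof (intro Set.set_eqI iffI)
      fix X assume "X \<in> success_set ` (P \<inter> binary_vecs n)"
      then obtain x where "x \<in> P" "x \<in> binary_vecs n" "X = success_set x" by blast
      then show "X \<in> ?F" using inF by simp
    next
      fix X assume X: "X \<in> ?F"
      then have "X \<in> success_set ` binary_vecs n" using bij_betw_imp_surj_on[OF bij_success_set] by simp
      then obtain x where "x \<in> binary_vecs n" "X = success_set x" by blast
      then show "X \<in> success_set ` (P \<inter> binary_vecs n)" using X inF by simp
    qed
  qed simp
  have "(\<integral>t. Psi t \<partial>Leb d) = of_real (norm_const * (\<Sum>X\<in>?F. (\<Prod>j\<in>X. z $ j) * (\<Prod>j\<in>{..<n} - X. 1 - z $ j)))"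
  proof (rule integral_Psi_eq_probability)
    show "red_coeff ks j p = 0" if "p \<in> dropped ks" for j p using that by (simp add: red_coeff_def)
    show "(\<Sum>j\<in>X. red_coeff ks j p) - (\<Sum>j<n. z $ j * red_coeff ks j p) \<in> \<int>"
      if "X \<subseteq> {..<n}" "p < d" "p \<notin> dropped ks" for X p
      by (rule Ints_diff[OF Ints_sum z_row]) (use that red_int in auto)
  qed
  also have "(\<Sum>X\<in>?F. (\<Prod>j\<in>X. z $ j) * (\<Prod>j\<in>{..<n} - X. 1 - z $ j)) =
      (\<Sum>x\<in>P \<inter> binary_vecs n. (\<Prod>j\<in>success_set x. z $ j) * (\<Prod>j\<in>{..<n} - success_set x. 1 - z $ j))"
    by (rule sum.reindex_bij_betw[OF bij, symmetric])
  also have "\<dots> = exp (- entropy z) * real (card (P \<inter> binary_vecs n))"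
    using weight by simp
  finally show ?thesis .
qed

lemma approximates_within_estimate:
  fixes S :: "nat \<Rightarrow> nat \<Rightarrow> real"
  defines "P \<equiv> transportation_polytope ks S"
  assumes ints: "\<And>j m. j < length ks \<Longrightarrow> m < ks ! j \<Longrightarrow> S j m \<in> \<int>"
    and max: "is_arg_max entropy (\<lambda>x. x \<in> P \<inter> cube01 n) z"
    and err: "norm ((\<integral>t. Psi t \<partial>Leb d) - of_real mass) \<le> e * mass"
  shows "approximates_within (real (card (P \<inter> binary_vecs n)))
    (exp (entropy z) / (2 * pi) powr ((real d - real \<nu> + 1) / 2) *
     form_det_on d (reduced_space ks) (covariance_form (transportation_mat ks) z) powr (- 1 / 2)) e"
proof -
  let ?M = "real (card (P \<inter> binary_vecs n))" and ?g = "exp (entropy z)"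
  have c: "0 < norm_const" by simp
  have M: "(\<integral>t. Psi t \<partial>Leb d) = of_real (norm_const * (exp (- entropy z) * ?M))"
    unfolding P_def by (rule count_eq) (use ints max in \<open>auto simp: P_def\<close>)
  have "norm ((\<integral>t. Psi t \<partial>Leb d) - of_real mass) = \<bar>norm_const * (exp (- entropy z) * ?M) - mass\<bar>"
    unfolding M of_real_diff[symmetric] norm_of_real ..
  then have "\<bar>norm_const * (exp (- entropy z) * ?M) - mass\<bar> \<le> e * mass" using err by (simp only:)
  then have "\<bar>?M - ?g * mass / norm_const\<bar> \<le> e * (?g * mass / norm_const)"
    by (rule rescale_error[OF c]) (simp_all add: exp_minus_inverse)
  then show ?thesis unfolding approximates_within_def estimate_eq .
qed

end

section \<open>Error bounds in terms of \<open>k\<close>\<close>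

lemma exponential_threshold:
  fixes c c1 :: real and \<nu> :: nat
  assumes "0 < c"
  obtains N where "1 \<le> N" "\<And>k. N \<le> k \<Longrightarrow> exp (- (c * k\<^sup>2)) * exp (real \<nu> * k / 2 * (c1 + real \<nu> * ln k)) \<le> 1 / k ^ \<nu>"
proof -
  have "eventually (\<lambda>k. exp (- (c * k\<^sup>2)) * exp (real \<nu> * k / 2 * (c1 + real \<nu> * ln k)) \<le> 1 / k ^ \<nu>) at_top"
  proof -
    \<comment> \<open>The quadratic exponent gained on the far part of the torus outgrows the loss
      of order \<open>k * ln k\<close> in \<open>two_pi_power_le\<close>.\<close>
    have "filterlim (\<lambda>k. c * k\<^sup>2 - real \<nu> * k / 2 * (c1 + real \<nu> * ln k) - real \<nu> * ln k) at_top at_top"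
      using assms by real_asymp
    then have "eventually (\<lambda>k. 0 \<le> c * k\<^sup>2 - real \<nu> * k / 2 * (c1 + real \<nu> * ln k) - real \<nu> * ln k) at_top"
      unfolding filterlim_at_top by (rule spec)
    then show ?thesis using eventually_gt_at_top[of 0]
    proof eventually_elim
      case (elim k)
      have "exp (- (c * k\<^sup>2)) * exp (real \<nu> * k / 2 * (c1 + real \<nu> * ln k)) \<le> exp (- (real \<nu> * ln k))"
        unfolding exp_add[symmetric] using elim by simp
      also have "\<dots> = 1 / k ^ \<nu>" using elim by (simp add: exp_minus exp_of_nat_mult field_simps)
      finally show ?case .
    qed
  qed
  then obtain N where "\<And>k. N \<le> k \<Longrightarrow> exp (- (c * k\<^sup>2)) * exp (real \<nu> * k / 2 * (c1 + real \<nu> * ln k)) \<le> 1 / k ^ \<nu>"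
    by (auto simp: eventually_at_top_linorder)
  then show ?thesis using that[of "max 1 N"] by simp
qed

lemma prod_list_bounds:
  fixes ks :: "nat list" and a b :: real
  assumes "0 \<le> a" "\<And>x. x \<in> set ks \<Longrightarrow> a \<le> real x" "\<And>x. x \<in> set ks \<Longrightarrow> real x \<le> b"
  shows "a ^ length ks \<le> real (prod_list ks)" "real (prod_list ks) \<le> b ^ length ks"
proof -
  have "a ^ length ks \<le> real (prod_list ks) \<and> real (prod_list ks) \<le> b ^ length ks"
    using assms(2,3)
  proof (induction ks)
    case (Cons x xs)
    have "0 \<le> b" using Cons.prems(2)[of x] by simp
    with Cons assms(1) show ?case by (auto intro!: mult_mono)
  qed simp
  then show "a ^ length ks \<le> real (prod_list ks)" "real (prod_list ks) \<le> b ^ length ks" by blast+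
qed

lemma sum_list_le:
  fixes ks :: "nat list" and b :: real
  assumes "\<And>x. x \<in> set ks \<Longrightarrow> real x \<le> b"
  shows "real (sum_list ks) \<le> real (length ks) * b"
  using assms by (induction ks) (auto simp: algebra_simps intro: add_mono)

context transportation
begin

lemma n_le: "real n \<le> k ^ \<nu>"
  unfolding n_def \<nu>_def using le_k by (intro prod_list_bounds(2)[of 0]) (auto simp: in_set_conv_nth)

lemma d_le: "real d \<le> real \<nu> * k"
  unfolding d_def \<nu>_def using le_k by (intro sum_list_le) (auto simp: in_set_conv_nth)

text \<open>The volume bound for the box measured against \<open>mass\<close>. Its logarithm is of
  order \<open>d * ln n\<close>, hence at most of order \<open>k * ln k\<close>.\<close>

lemma two_pi_power_le:
  "(2 * pi) ^ d \<le> mass * exp (real \<nu> * k / 2 * (ln (4 * pi * (real \<nu>)\<^sup>2) + real \<nu> * ln k))"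
proof -
  let ?A = "real n * (real \<nu>)\<^sup>2 + 1"
  have \<nu>: "3 \<le> real \<nu>" using len by (simp add: \<nu>_def)
  have n1: "1 \<le> real n" using n_pos by simp
  have A: "1 \<le> ?A" by simp
  have "1 * 1 \<le> real n * (real \<nu>)\<^sup>2" using n1 \<nu> by (intro mult_mono one_le_power) auto
  then have "2 * pi * ?A \<le> 2 * pi * (2 * (real n * (real \<nu>)\<^sup>2))" by (intro mult_left_mono) auto
  also have "\<dots> = 4 * pi * (real \<nu>)\<^sup>2 * real n" by simp
  also have "\<dots> \<le> 4 * pi * (real \<nu>)\<^sup>2 * k ^ \<nu>" using n_le by (intro mult_left_mono) auto
  finally have A_le: "2 * pi * ?A \<le> 4 * pi * (real \<nu>)\<^sup>2 * k ^ \<nu>" .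
  have "1 * 1 \<le> (2 * pi) * ?A" using A pi_gt3 by (intro mult_mono) auto
  then have one: "1 \<le> 2 * pi * ?A" by simp
  have lnA: "ln (2 * pi * ?A) \<le> ln (4 * pi * (real \<nu>)\<^sup>2) + real \<nu> * ln k"
  proof -
    have "ln (2 * pi * ?A) \<le> ln (4 * pi * (real \<nu>)\<^sup>2 * k ^ \<nu>)" using A_le one by (intro ln_mono) auto
    also have "\<dots> = ln (4 * pi * (real \<nu>)\<^sup>2) + real \<nu> * ln k"
      using k_ge_1 \<nu> by (subst ln_mult) (auto simp: ln_realpow)
    finally show ?thesis .
  qed
  have "sqrt (2 * pi * ?A) ^ d = exp (real d / 2 * ln (2 * pi * ?A))"
  proof -
    have "sqrt (2 * pi * ?A) = exp (ln (2 * pi * ?A) / 2)" using one by (simp add: ln_sqrt[symmetric])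
    then show ?thesis by (simp only: exp_of_nat_mult[symmetric]) simp
  qed
  also have "\<dots> \<le> exp (real \<nu> * k / 2 * (ln (4 * pi * (real \<nu>)\<^sup>2) + real \<nu> * ln k))"
    unfolding exp_le_cancel_iff using d_le lnA one by (intro mult_mono) auto
  finally have sq: "sqrt (2 * pi * ?A) ^ d \<le> exp (real \<nu> * k / 2 * (ln (4 * pi * (real \<nu>)\<^sup>2) + real \<nu> * ln k))" .
  have "sqrt (2 * pi / ?A) * sqrt (2 * pi * ?A) = 2 * pi"
  proof -
    have "(p / a) * (p * a) = p\<^sup>2" if "0 < a" for p a :: real using that by (simp add: power2_eq_square)
    from this[of ?A "2 * pi"] have "(2 * pi / ?A) * (2 * pi * ?A) = (2 * pi)\<^sup>2" using A by linarith
    then show ?thesis unfolding real_sqrt_mult[symmetric] by (intro real_sqrt_unique) auto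
  qed
  then have "(2 * pi) ^ d = sqrt (2 * pi / ?A) ^ d * sqrt (2 * pi * ?A) ^ d"
    by (simp only: power_mult_distrib[symmetric])
  also have "\<dots> \<le> mass * exp (real \<nu> * k / 2 * (ln (4 * pi * (real \<nu>)\<^sup>2) + real \<nu> * ln k))"
    using mass_ge[of ?A] form_le A sq mass_sq(1) by (intro mult_mono) auto
  finally show ?thesis .
qed

text \<open>No smallness is obtained here; the bound serves the range of \<open>k\<close> below the
  threshold, where a constant is enough.\<close>

lemma crude_error:
  "norm ((\<integral>t. Psi t \<partial>Leb d) - of_real mass) \<le>
    (1 + exp (real \<nu> * k / 2 * (ln (4 * pi * (real \<nu>)\<^sup>2) + real \<nu> * ln k))) * mass"
proof -
  have "norm ((\<integral>t. Psi t \<partial>Leb d) - of_real mass) \<le> norm (\<integral>t. Psi t \<partial>Leb d) + norm (complex_of_real mass)"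
    by (rule norm_triangle_ineq4)
  also have "norm (complex_of_real mass) = mass" using mass_sq(1) by simp
  finally show ?thesis using norm_integral_Psi_le two_pi_power_le by (simp add: algebra_simps)
qed

text \<open>The factor \<open>16 * \<nu> ^ 4 / (r\<^sup>2 * \<omega> ^ \<nu>)\<close> comes from
  \<open>n * (K / r)\<^sup>2\<close> and \<open>n \<ge> \<omega> ^ \<nu> * k ^ \<nu>\<close>. Of the
  summand 3, the Gaussian tails account for 2 and the far part of the torus for 1.\<close>

lemma asymptotic_error:
  fixes \<omega> :: real
  defines "B \<equiv> 1600 * real \<nu> ^ 4 / (r\<^sup>2 * \<omega> ^ \<nu>)"
    and "c \<equiv> r * (sin (1 / (4 * real \<nu>)))\<^sup>2 * \<omega> ^ \<nu> / (2 * (real \<nu>)\<^sup>2)"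
  assumes \<omega>: "0 < \<omega>" "\<And>j. j < length ks \<Longrightarrow> \<omega> * k \<le> real (ks ! j)"
    and k1: "80 * real \<nu> ^ 3 / (r * \<omega> ^ \<nu>) \<le> k"
    and k2: "exp (- (c * k\<^sup>2)) * exp (real \<nu> * k / 2 * (ln (4 * pi * (real \<nu>)\<^sup>2) + real \<nu> * ln k)) \<le> 1 / k ^ \<nu>"
  shows "norm ((\<integral>t. Psi t \<partial>Leb d) - of_real mass) \<le>
    ((3 * exp B + 8 / r) * (16 * real \<nu> ^ 4 / (r\<^sup>2 * \<omega> ^ \<nu>)) + 3) * (k\<^sup>2 / k ^ \<nu>) * mass"
proof -
  \<comment> \<open>Chosen so that \<open>exp (- L / 10) = exp (- 2 * \<nu> * k)\<close> beats
    \<open>sqrt 5 ^ d\<close>, which is at most \<open>exp (\<nu> * k)\<close>, with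
    \<open>exp (- \<nu> * k)\<close> to spare. The constants 80 and 1600 in \<open>k1\<close> and
    \<open>B\<close> are \<open>4 * 20\<close> and \<open>4 * 20\<^sup>2\<close>.\<close>
  define L where "L = 20 * real \<nu> * k"
  define K where "K = 4 * (real \<nu>)\<^sup>2 * k / real n"
  have \<nu>: "3 \<le> real \<nu>" "3 \<le> \<nu>" using len by (simp_all add: \<nu>_def)
  have k: "1 \<le> k" "0 < k" using k_ge_1 by auto
  have np: "0 < real n" using n_pos by simp
  have w: "0 < \<omega> ^ \<nu>" using \<omega> by simp
  have n_ge: "\<omega> ^ \<nu> * k ^ \<nu> \<le> real n"
    unfolding n_def \<nu>_def power_mult_distrib[symmetric]
    using \<omega> k le_k by (intro prod_list_bounds(1)[of _ _ k]) (auto simp: in_set_conv_nth)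
  \<comment> \<open>With at least three directions \<open>n\<close> is at least of order
    \<open>k ^ 3\<close>; the conditions on \<open>L\<close> and the quadratic growth of the
    exponent \<open>D\<close> rest on this.\<close>
  have k3: "k ^ 3 \<le> k ^ \<nu>" using k \<nu> by (intro power_increasing) auto
  have n_ge3: "\<omega> ^ \<nu> * k ^ 3 \<le> real n"
    using mult_left_mono[OF k3, of "\<omega> ^ \<nu>"] w n_ge by linarith
  have L0: "0 \<le> L" using k \<nu> by (simp add: L_def)
  have KL: "K / r * L \<le> 1"
  proof -
    have "80 * real \<nu> ^ 3 * k\<^sup>2 \<le> (k * (r * \<omega> ^ \<nu>)) * k\<^sup>2"
      using k1 r w by (intro mult_right_mono) (simp_all add: pos_divide_le_eq)
    also have "\<dots> = r * (\<omega> ^ \<nu> * k ^ 3)" by (simp add: power2_eq_square power3_eq_cube)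
    also have "\<dots> \<le> r * real n" using n_ge3 r by (intro mult_left_mono) auto
    finally show ?thesis using np r by (simp add: K_def L_def field_simps power2_eq_square power3_eq_cube)
  qed
  have KL2: "K / r * L\<^sup>2 / r \<le> B"
  proof -
    have "K / r * L\<^sup>2 / r = 1600 * real \<nu> ^ 4 / r\<^sup>2 * (k ^ 3 / real n)"
      by (simp add: K_def L_def power2_eq_square power3_eq_cube power4_eq_xxxx mult_ac)
    also have "\<dots> \<le> 1600 * real \<nu> ^ 4 / r\<^sup>2 * (1 / \<omega> ^ \<nu>)"
      using n_ge3 np w by (intro mult_left_mono) (simp_all add: field_simps)
    finally show ?thesis by (simp add: B_def)
  qed
  have D: "c * k\<^sup>2 \<le> r * (sin (1 / (4 * real \<nu>)))\<^sup>2 * real n / (2 * (real \<nu>)\<^sup>2 * k)"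
  proof -
    have "c * k\<^sup>2 = r * (sin (1 / (4 * real \<nu>)))\<^sup>2 * (\<omega> ^ \<nu> * k ^ 3) / (2 * (real \<nu>)\<^sup>2 * k)"
      using k by (simp add: c_def power2_eq_square power3_eq_cube)
    also have "\<dots> \<le> r * (sin (1 / (4 * real \<nu>)))\<^sup>2 * real n / (2 * (real \<nu>)\<^sup>2 * k)"
      using n_ge3 r k by (intro divide_right_mono mult_left_mono) auto
    finally show ?thesis .
  qed
  have e1: "(3 * exp B + 8 / r) * n * (K / r)\<^sup>2 \<le> (3 * exp B + 8 / r) * (16 * real \<nu> ^ 4 / (r\<^sup>2 * \<omega> ^ \<nu>)) * (k\<^sup>2 / k ^ \<nu>)"
  proof -
    have "n * (K / r)\<^sup>2 = 16 * real \<nu> ^ 4 / r\<^sup>2 * (k\<^sup>2 / real n)"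
      using np by (simp add: K_def power2_eq_square power4_eq_xxxx mult_ac)
    also have "\<dots> \<le> 16 * real \<nu> ^ 4 / r\<^sup>2 * (k\<^sup>2 / (\<omega> ^ \<nu> * k ^ \<nu>))"
      using n_ge w k np by (intro mult_left_mono divide_left_mono) auto
    finally have "n * (K / r)\<^sup>2 \<le> 16 * real \<nu> ^ 4 / (r\<^sup>2 * \<omega> ^ \<nu>) * (k\<^sup>2 / k ^ \<nu>)" by simp
    then have "(3 * exp B + 8 / r) * (n * (K / r)\<^sup>2) \<le> (3 * exp B + 8 / r) * (16 * real \<nu> ^ 4 / (r\<^sup>2 * \<omega> ^ \<nu>) * (k\<^sup>2 / k ^ \<nu>))"
      using r by (intro mult_left_mono) auto
    then show ?thesis by (simp only: mult.assoc)
  qed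
  have one_le: "1 / k ^ \<nu> \<le> k\<^sup>2 / k ^ \<nu>" using k by (intro divide_right_mono) auto
  have e2: "2 * exp (- L / 10) * sqrt 5 ^ d \<le> 2 * (k\<^sup>2 / k ^ \<nu>)"
  proof -
    have "sqrt 5 \<le> exp (1 :: real)"
    proof -
      have "sqrt 5 \<le> 1 + 1 + 1 / 2" by (rule real_le_lsqrt) (auto simp: power2_eq_square)
      also have "\<dots> \<le> exp (1 :: real)" using exp_lower_Taylor_quadratic[of "1 :: real"] by simp
      finally show ?thesis .
    qed
    then have "sqrt 5 ^ d \<le> exp 1 ^ d" by (intro power_mono) auto
    also have "\<dots> = exp (real d)" by (simp add: exp_of_nat_mult[symmetric])
    also have "\<dots> \<le> exp (real \<nu> * k)" using d_le by simp
    finally have "exp (- L / 10) * sqrt 5 ^ d \<le> exp (- L / 10) * exp (real \<nu> * k)" by (intro mult_left_mono) auto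
    also have "\<dots> = exp (- (real \<nu> * k))" unfolding exp_add[symmetric] L_def by simp
    also have "\<dots> = 1 / exp k ^ \<nu>" by (simp only: exp_minus exp_of_nat_mult inverse_eq_divide)
    also have "\<dots> \<le> 1 / k ^ \<nu>"
    proof -
      have "k \<le> exp k" using exp_ge_add_one_self[of k] by linarith
      then show ?thesis using k by (intro divide_left_mono power_mono) auto
    qed
    finally show ?thesis using one_le by simp
  qed
  have e3: "exp (- (c * k\<^sup>2)) * (2 * pi) ^ d \<le> (k\<^sup>2 / k ^ \<nu>) * mass"
  proof -
    have "exp (- (c * k\<^sup>2)) * (2 * pi) ^ d \<le> exp (- (c * k\<^sup>2)) * (mass * exp (real \<nu> * k / 2 * (ln (4 * pi * (real \<nu>)\<^sup>2) + real \<nu> * ln k)))"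
      using two_pi_power_le by (rule mult_left_mono) simp
    also have "\<dots> \<le> (1 / k ^ \<nu>) * mass"
      using mult_right_mono[OF k2, of mass] mass_sq(1) by (simp add: mult_ac)
    also have "\<dots> \<le> (k\<^sup>2 / k ^ \<nu>) * mass" using one_le mass_sq(1) by (intro mult_right_mono) auto
    finally show ?thesis .
  qed
  have torus: "(\<forall>j<n. \<bar>U j t\<bar> \<le> 1) \<or> c * k\<^sup>2 \<le> (\<Sum>j<n. 2 * s j * (sin (U j t / 2))\<^sup>2)" if "t \<in> box" for t
    using torus_dichotomy[OF that] D by (meson order_trans)
  have main: "norm ((\<integral>t. Psi t \<partial>Leb d) - of_real mass) \<le>
      mass * ((3 * exp B + 8 / r) * n * (K / r)\<^sup>2 + 2 * exp (- L / 10) * sqrt 5 ^ d) + exp (- (c * k\<^sup>2)) * (2 * pi) ^ d"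
    using integral_Psi[OF L0 KL[unfolded K_def] KL2[unfolded K_def] torus] by (simp only: K_def)
  have "mass * ((3 * exp B + 8 / r) * n * (K / r)\<^sup>2 + 2 * exp (- L / 10) * sqrt 5 ^ d) \<le>
      mass * ((3 * exp B + 8 / r) * (16 * real \<nu> ^ 4 / (r\<^sup>2 * \<omega> ^ \<nu>)) * (k\<^sup>2 / k ^ \<nu>) + 2 * (k\<^sup>2 / k ^ \<nu>))"
    using e1 e2 mass_sq(1) by (intro mult_left_mono add_mono) auto
  with main e3 have "norm ((\<integral>t. Psi t \<partial>Leb d) - of_real mass) \<le>
      mass * ((3 * exp B + 8 / r) * (16 * real \<nu> ^ 4 / (r\<^sup>2 * \<omega> ^ \<nu>)) * (k\<^sup>2 / k ^ \<nu>) + 2 * (k\<^sup>2 / k ^ \<nu>)) + (k\<^sup>2 / k ^ \<nu>) * mass"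
    by linarith
  moreover have regroup: "m * (X * y + 2 * y) + y * m = (X + 3) * y * m" for m X y :: real
    by (simp add: algebra_simps)
  ultimately show ?thesis unfolding regroup by blast
qed

end

theorem theorem1p2:
  fixes \<nu> :: nat and r \<omega> :: real
  assumes "\<nu> \<ge> 3" and "r > 0" and "0 < \<omega>" and "\<omega> < 1"
  shows "\<exists>\<Gamma> N :: real. \<forall>(ks :: nat list) (S :: nat \<Rightarrow> nat \<Rightarrow> real) (z :: real Matrix.vec) (k :: real).
    (let n = prod_list ks; d = sum_list ks;
         P = transportation_polytope ks S;
         q = covariance_form (transportation_mat ks) z;
         E = exp (entropy z) / (2 * pi) powr ((real d - real \<nu> + 1) / 2)
               * form_det_on d (reduced_space ks) q powr (- 1 / 2);
         M = real (card (P \<inter> binary_vecs n))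
     in length ks = \<nu> \<longrightarrow>
        (\<forall>j<\<nu>. \<forall>m<ks ! j. S j m \<in> \<int>) \<longrightarrow>
        is_arg_max entropy (\<lambda>x. x \<in> P \<inter> cube01 n) z \<longrightarrow>
        k > 0 \<longrightarrow>
        (\<forall>j<\<nu>. \<omega> * k \<le> real (ks ! j) \<and> real (ks ! j) \<le> k) \<longrightarrow>
        (\<forall>i<n. r \<le> z $ i - (z $ i)\<^sup>2) \<longrightarrow>
        \<omega> * k \<ge> 2 \<longrightarrow>
        10 * real \<nu> ^ 4 * 2 ^ \<nu> / (r * \<omega> ^ \<nu>) * ln k * k powr (- real \<nu> + 2)
          \<le> 1 / (4 * (real \<nu>)\<^sup>2) \<longrightarrow>
        20 * real \<nu> ^ 6 * 2 ^ \<nu> / (r\<^sup>2 * \<omega> ^ \<nu>) * ln k * k powr (- real \<nu> + 2) \<le> 3 / 4 \<longrightarrow>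
        approximates_within M E (\<Gamma> * k powr (- real \<nu> + 2.5)) \<and>
        (k \<ge> N \<longrightarrow>
          approximates_within M E
            (400 * real \<nu> ^ 12 * 2 ^ \<nu> / (r\<^sup>2 * \<omega> ^ (2 * \<nu>)) * k powr (- real \<nu> + 2.5))))"
proof -
  define c where "c = r * (sin (1 / (4 * real \<nu>)))\<^sup>2 * \<omega> ^ \<nu> / (2 * (real \<nu>)\<^sup>2)"
  define B where "B = 1600 * real \<nu> ^ 4 / (r\<^sup>2 * \<omega> ^ \<nu>)"
  define C where "C = (3 * exp B + 8 / r) * (16 * real \<nu> ^ 4 / (r\<^sup>2 * \<omega> ^ \<nu>)) + 3"
  define C0 where "C0 = 400 * real \<nu> ^ 12 * 2 ^ \<nu> / (r\<^sup>2 * \<omega> ^ (2 * \<nu>))"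
  define c1 where "c1 = ln (4 * pi * (real \<nu>)\<^sup>2)"
  define X where "X k = exp (real \<nu> * k / 2 * (c1 + real \<nu> * ln k))" for k
  have \<nu>: "3 \<le> real \<nu>" using assms(1) by simp
  have C0: "0 < C0" unfolding C0_def using assms by (intro divide_pos_pos mult_pos_pos) auto
  have C: "0 \<le> C" unfolding C_def using assms by (intro add_nonneg_nonneg mult_nonneg_nonneg divide_nonneg_nonneg) auto
  have c1: "0 \<le> c1"
  proof -
    have "1 * 1 \<le> (4 * pi) * (real \<nu>)\<^sup>2" using \<nu> pi_gt3 by (intro mult_mono one_le_power) auto
    then show ?thesis by (simp add: c1_def)
  qed
  have "0 < sin (1 / (4 * real \<nu>))"
  proof (rule sin_gt_zero)
    have "1 / (4 * real \<nu>) \<le> 1" using \<nu> by simp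
    then show "1 / (4 * real \<nu>) < pi" using pi_gt3 by linarith
  qed (use \<nu> in simp)
  then have c: "0 < c" unfolding c_def using assms \<nu> by (intro divide_pos_pos mult_pos_pos) auto
  obtain N1 where N1: "1 \<le> N1" "\<And>k. N1 \<le> k \<Longrightarrow> exp (- (c * k\<^sup>2)) * exp (real \<nu> * k / 2 * (c1 + real \<nu> * ln k)) \<le> 1 / k ^ \<nu>"
    using exponential_threshold[OF c, where \<nu> = \<nu> and ?c1.0 = c1] by blast
  \<comment> \<open>The thresholds are, in order, for the exponential comparison, for the condition
    \<open>K / r * L \<le> 1\<close>, and for \<open>sqrt k\<close> to absorb the quotient
    \<open>C / C0\<close>.\<close>
  define N where "N = max N1 (max (80 * real \<nu> ^ 3 / (r * \<omega> ^ \<nu>)) ((C / C0)\<^sup>2))"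
  \<comment> \<open>For \<open>k\<close> below \<open>N\<close> the crude bound
    \<open>1 + X k\<close> is at most \<open>1 + X N\<close>. Since the exponent
    \<open>- \<nu> + 2.5\<close> is negative, \<open>k powr (- \<nu> + 2.5)\<close> is at least its
    value at \<open>N\<close>, which the denominator compensates.\<close>
  define \<Gamma> where "\<Gamma> = max C0 ((1 + X N) / N powr (- real \<nu> + 2.5))"
  have N: "1 \<le> N" "N1 \<le> N" using N1 by (auto simp: N_def)
  show ?thesis
  proof (rule exI[of _ \<Gamma>], rule exI[of _ N], unfold Let_def C0_def[symmetric], intro allI impI)
    fix ks :: "nat list" and S :: "nat \<Rightarrow> nat \<Rightarrow> real" and z :: "real Matrix.vec" and k :: real
    let ?P = "transportation_polytope ks S" and ?n = "prod_list ks" and ?d = "sum_list ks"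
    let ?E = "exp (entropy z) / (2 * pi) powr ((real ?d - real \<nu> + 1) / 2) *
      form_det_on ?d (reduced_space ks) (covariance_form (transportation_mat ks) z) powr (- 1 / 2)"
    let ?M = "real (card (?P \<inter> binary_vecs ?n))"
    assume ks_len: "length ks = \<nu>" and ints: "\<forall>j<\<nu>. \<forall>m<ks ! j. S j m \<in> \<int>"
      and max: "is_arg_max entropy (\<lambda>x. x \<in> ?P \<inter> cube01 ?n) z" and k0: "0 < k"
      and ks: "\<forall>j<\<nu>. \<omega> * k \<le> real (ks ! j) \<and> real (ks ! j) \<le> k"
      and r_le: "\<forall>i<?n. r \<le> z $ i - (z $ i)\<^sup>2" and k2: "2 \<le> \<omega> * k"
    have zin: "z \<in> cube01 ?n" using max by (simp add: is_arg_max_def)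
    have pos: "0 < ks ! j" if "j < length ks" for j
    proof -
      have "2 \<le> real (ks ! j)" using ks k2 that ks_len by fastforce
      then show ?thesis by simp
    qed
    have "transportation ks z r k"
      by unfold_locales (use assms ks ks_len zin r_le pos in \<open>auto simp: cube01_def\<close>)
    then interpret transportation ks z r k "length ks" ?n ?d by simp_all
    have approx: "approximates_within ?M ?E e"
      if "norm ((\<integral>t. Psi t \<partial>Leb ?d) - of_real mass) \<le> e * mass" for e
    proof -
      have "S j m \<in> \<int>" if "j < length ks" "m < ks ! j" for j m using ints ks_len that by simp
      from approximates_within_estimate[OF this max that] show ?thesis unfolding ks_len .
    qed
    show "approximates_within ?M ?E (\<Gamma> * k powr (- real \<nu> + 2.5)) \<and>
      (N \<le> k \<longrightarrow> approximates_within ?M ?E (C0 * k powr (- real \<nu> + 2.5)))"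
    proof (cases "N \<le> k")
      case True
      have k1: "1 \<le> k" using N True by simp
      have bound: "norm ((\<integral>t. Psi t \<partial>Leb ?d) - of_real mass) \<le> C * (k\<^sup>2 / k ^ \<nu>) * mass"
        using asymptotic_error[of \<omega>] ks assms(3) N1(2)[of k] N True ks_len
        by (simp add: C_def B_def c_def c1_def N_def)
      have le: "C * (k\<^sup>2 / k ^ \<nu>) \<le> C0 * k powr (- real \<nu> + 2.5)"
      proof -
        have "(C / C0)\<^sup>2 \<le> k" using True by (simp add: N_def)
        then have "C / C0 \<le> sqrt k" by (rule real_le_rsqrt)
        then have "C \<le> C0 * sqrt k" using C0 by (simp add: field_simps)
        then have "C * (k\<^sup>2 / k ^ \<nu>) \<le> (C0 * sqrt k) * (k\<^sup>2 / k ^ \<nu>)" using k1 by (intro mult_right_mono) auto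
        moreover have "sqrt k * (k\<^sup>2 / k ^ \<nu>) = k powr (- real \<nu> + 2.5)"
        proof -
          have "sqrt k * (k\<^sup>2 / k ^ \<nu>) = k powr (1 / 2) * (k powr 2 / k powr real \<nu>)"
            using k0 by (simp add: powr_half_sqrt powr_realpow)
          also have "\<dots> = k powr (1 / 2 + (2 - real \<nu>))" by (simp only: powr_add powr_diff)
          finally show ?thesis by simp
        qed
        ultimately show ?thesis by (simp only: mult.assoc)
      qed
      have err: "norm ((\<integral>t. Psi t \<partial>Leb ?d) - of_real mass) \<le> C0 * k powr (- real \<nu> + 2.5) * mass"
        using bound mult_right_mono[OF le less_imp_le[OF mass_sq(1)]] by (rule order_trans)
      also have "\<dots> \<le> \<Gamma> * k powr (- real \<nu> + 2.5) * mass"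
        using mass_sq(1) by (intro mult_right_mono) (auto simp: \<Gamma>_def)
      finally show ?thesis using approx err by blast
    next
      case False
      then have kN: "k \<le> N" by simp
      have "X k \<le> X N"
      proof -
        have "ln k \<le> ln N" using kN k0 by (intro ln_mono) auto
        moreover have "0 \<le> ln k" using k_ge_1 by simp
        ultimately show ?thesis
          unfolding X_def exp_le_cancel_iff using kN k0 c1 \<nu>
          by (intro mult_mono add_mono divide_right_mono mult_left_mono add_nonneg_nonneg) auto
      qed
      moreover have "N powr (- real \<nu> + 2.5) \<le> k powr (- real \<nu> + 2.5)"
        using kN k0 \<nu> by (intro powr_mono2') auto
      moreover have "1 + X N = (1 + X N) / N powr (- real \<nu> + 2.5) * N powr (- real \<nu> + 2.5)" using N by simp
      moreover have "\<dots> \<le> \<Gamma> * k powr (- real \<nu> + 2.5)"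
        using C0 \<open>N powr (- real \<nu> + 2.5) \<le> k powr (- real \<nu> + 2.5)\<close> by (intro mult_mono) (auto simp: \<Gamma>_def X_def)
      ultimately have "1 + X k \<le> \<Gamma> * k powr (- real \<nu> + 2.5)" by linarith
      then have "(1 + X k) * mass \<le> \<Gamma> * k powr (- real \<nu> + 2.5) * mass"
        using mass_sq(1) by (intro mult_right_mono) auto
      then have "norm ((\<integral>t. Psi t \<partial>Leb ?d) - of_real mass) \<le> \<Gamma> * k powr (- real \<nu> + 2.5) * mass"
        using crude_error unfolding X_def c1_def ks_len by (rule order_trans[rotated])
      then show ?thesis using approx False by blast
    qed
  qed
qed

end
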